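(* Let $V$ be an $n$-dimensional vector space over a field $F$ ($n\ge 1$) and suppose that $$\sum_i a_i\,\mathrm C\big[u_0^{(i)}:\cdots:u_n^{(i)}\big]=0\quad\text{in }\mathrm{St}^\infty(V)$$ (a finite sum), where $a_i\in\mathbb Q$ and each $u_0^{(i)},\dots,u_n^{(i)}$ is an affine basis of $V$. Then the element $$\sum_i a_i\,\mathrm{Cor}^{\mathcal G}\big(h(u_0^{(i)}),\dots,h(u_n^{(i)})\big)\in\mathcal G_n(F)$$ is independent of the choice of nonzero linear functional $h\in V^\vee$. Equivalently, for any two nonzero linear functionals $h_1,h_2\in V^\vee$, $$\sum_i a_i\,\mathrm{Cor}^{\mathcal G}\big(h_1(u_0^{(i)}),\dots,h_1(u_n^{(i)})\big)=\sum_i a_i\,\mathrm{Cor}^{\mathcal G}\big(h_2(u_0^{(i)}),\dots,h_2(u_n^{(i)})\big)\quad\text{in }\mathcal G_n(F).$$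
   Context: **The set $T(n)$ and signs.** Let $\omega_{ij}=\omega_{ji}$ ($i\ne j$) be letters. In the free associative algebra on these letters define inductively $\mathbf S(s_0,s_1)=\omega_{s_0s_1}$ and $\mathbf S(s_0,\dots,s_n)=\mathbf S(s_0,\dots,s_{n-1})\otimes\omega_{s_0s_n}-\sum_{i=1}^{n-1}\mathbf S(s_0,\dots,\widehat{s_{i+1}},\dots,s_n)\otimes\omega_{s_is_{i+1}}+\sum_{i=1}^{n-1}\mathbf S(s_0,\dots,\widehat{s_i},\dots,s_n)\otimes\omega_{s_is_{i+1}}.$ There are a unique set $T(n)$ of ordered $n$-tuples of edges of the complete graph on $\{0,\dots,n\}$ and a unique $\mathrm{sign}:T(n)\to\{\pm1\}$ with $\mathbf S(0,\dots,n)=\sum_{\iota\in T(n)}\mathrm{sign}(\iota)\,\omega_{i_1j_1}\otimes\cdots\otimes\omega_{i_nj_n}$, $\iota=(\{i_1,j_1\},\dots,\{i_n,j_n\})$. **Steinberg modules.** All homology is rational. For an $F$-vector space $V$ of dimension $n\ge 1$, $\mathrm{St}(V)=\widetilde H_{n-2}(T(V);\mathbb Q)$ where $T(V)$ is the Tits building. It is generated by apartment classes $[v_1,\dots,v_n]$ of ordered $n$-tuples of vectors, subject to: $[v_1,\dots,v_n]=0$ if the $v_i$ are linearly dependent; $[v_{\tau(1)},\dots,v_{\tau(n)}]=\mathrm{sgn}(\tau)[v_1,\dots,v_n]$; $[\lambda v_1,v_2,\dots,v_n]=[v_1,\dots,v_n]$ for $\lambda\in F^\times$; $\sum_{i=0}^n(-1)^i[v_0,\dots,\widehat{v_i},\dots,v_n]=0$.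 Put $\mathrm{St}^2(V)=\mathrm{St}(V)\otimes\mathrm{St}(V)$; for $V=V_1\oplus V_2$ concatenating apartments in both factors gives a product. $\mathrm{St}^\infty(V)$ is the cokernel of $\bigoplus_{V_1\oplus V_2=V,\;V_1,V_2\neq0}\mathrm{St}^2(V_1)\otimes\mathrm{St}^2(V_2)\to\mathrm{St}^2(V)$, with quotient map $\pi$. An affine basis of $V$ is a tuple $u_0,\dots,u_n$ such that $u_1-u_0,\dots,u_n-u_0$ is a basis; put $\mathrm C[u_0:\cdots:u_n]=\pi\big([u_n-u_0,\dots,u_1-u_0]\otimes[u_n-u_0,u_{n-1}-u_n,\dots,u_1-u_2]\big)\in\mathrm{St}^\infty(V)$. **$\mathcal G_n(F)$.** $\mathcal G_n(F)=H^{E_\infty}_{n,2n-1}(\mathbf{BGL}(F)_{\mathbb Q})$: homology in rank $n$, degree $2n-1$ of the derived indecomposables of the nonunital $E_\infty$-algebra $n\mapsto C_*(B\mathrm{GL}_n(F);\mathbb Q)$, $n\ge 1$ (product: block sum) in $\mathbb N$-graded rational chain complexes; canonically identified with $H_1(\mathrm{GL}(V);\mathrm{St}^\infty(V))$ for any $V$ with $\dim V=n$. **Correlators.** $\mathrm{FC}(V)$ is generated by symbols $\mathrm{FC}[u_0:\cdots:u_n]$ for affine bases of $V$, modulo translation invariance, cyclic symmetry, and shuffle relations (for $n=n_1+n_2$, $n_1,n_2>0$, the sum of $\mathrm{FC}[u_0:w]$ over all shuffles $w$ of $(u_1,\dots,u_{n_1})$ and $(u_{n_1+1},\dots,u_n)$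 is $0$). $\mathrm{FCR}(V)=\ker(\mathrm{FC}(V)\to\mathrm{St}^\infty(V))$, where $\mathrm{FC}[u_0:\cdots:u_n]\mapsto\mathrm C[u_0:\cdots:u_n]$; the connecting homomorphism gives $\mathcal G_n(F)\cong\mathrm{FCR}(V)_{\mathrm{GL}(V)}$. For $0\ne h\in V^\vee$, $D_h(\mathrm{FC}[u_0:\cdots:u_n])=\sum_{\iota\in T(n)}\mathrm{sign}(\iota)\,\mathrm{FC}\big[0:\tfrac{u_{i_1}-u_{j_1}}{h(u_{i_1}-u_{j_1})}:\cdots:\tfrac{u_{i_n}-u_{j_n}}{h(u_{i_n}-u_{j_n})}\big]$, omitting terms with a zero denominator; $\mathrm{id}-D_h$ lands in $\mathrm{FCR}(V)$. For $x_0,\dots,x_n\in F$ not all equal, $\mathrm{Cor}^{\mathcal G}(x_0,\dots,x_n)\in\mathcal G_n(F)$ is the class of $(\mathrm{id}-D_h)(\mathrm{FC}[u_0:\cdots:u_n])$ for any affine basis and $0\neq h\in V^\vee$ with $h(u_i)-h(u_0)=x_i-x_0$ (independent of choices). *)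

theory Defs
  imports Complex_Main "HOL-Library.Poly_Mapping" "HOL-Combinatorics.Permutations"
begin

section \<open>Free rational vector spaces\<close>

text \<open>The type \<open>'x \<Rightarrow>\<^sub>0 rat\<close> is the rational vector space with basis \<open>'x\<close>. Every rational vector
  space below is a subquotient \<open>A / R\<close> of such a space; its elements are the cosets of \<open>R\<close>.\<close>

definition qscale :: "rat \<Rightarrow> ('x \<Rightarrow>\<^sub>0 rat) \<Rightarrow> ('x \<Rightarrow>\<^sub>0 rat)" where
  "qscale c p = Poly_Mapping.map ((*) c) p"

lemma lookup_qscale [simp]: "Poly_Mapping.lookup (qscale c p) x = c * Poly_Mapping.lookup p x"
  by (simp add: qscale_def Poly_Mapping.map.rep_eq when_def)

interpretation rat_free: vector_space "qscale :: rat \<Rightarrow> ('x \<Rightarrow>\<^sub>0 rat) \<Rightarrow> ('x \<Rightarrow>\<^sub>0 rat)"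
  by unfold_locales (auto intro!: poly_mapping_eqI simp: lookup_add algebra_simps)

abbreviation basis_elt :: "'x \<Rightarrow> ('x \<Rightarrow>\<^sub>0 rat)" where
  "basis_elt x \<equiv> Poly_Mapping.single x 1"

definition lin_ext :: "('x \<Rightarrow> ('y \<Rightarrow>\<^sub>0 rat)) \<Rightarrow> ('x \<Rightarrow>\<^sub>0 rat) \<Rightarrow> ('y \<Rightarrow>\<^sub>0 rat)" where
  "lin_ext f p = (\<Sum>x\<in>Poly_Mapping.keys p. qscale (Poly_Mapping.lookup p x) (f x))"

definition free_on :: "'x set \<Rightarrow> ('x \<Rightarrow>\<^sub>0 rat) set" where
  "free_on X = {p. Poly_Mapping.keys p \<subseteq> X}"

definition tensor :: "('x \<Rightarrow>\<^sub>0 rat) \<Rightarrow> ('y \<Rightarrow>\<^sub>0 rat) \<Rightarrow> ('x \<times> 'y \<Rightarrow>\<^sub>0 rat)" where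
  "tensor p q = lin_ext (\<lambda>x. lin_ext (\<lambda>y. basis_elt (x, y)) q) p"

text \<open>Since tensor products over a field are exact, for subspaces \<open>A\<close>, \<open>B\<close> of the free spaces on
  \<open>'x\<close>, \<open>'y\<close> the tensor product is a subspace of the free space on \<open>'x \<times> 'y\<close>.\<close>

definition tensor_space ::
  "('x \<Rightarrow>\<^sub>0 rat) set \<Rightarrow> ('y \<Rightarrow>\<^sub>0 rat) set \<Rightarrow> ('x \<times> 'y \<Rightarrow>\<^sub>0 rat) set" where
  "tensor_space A B = rat_free.span {tensor a b |a b. a \<in> A \<and> b \<in> B}"

definition coset :: "('x \<Rightarrow>\<^sub>0 rat) set \<Rightarrow> ('x \<Rightarrow>\<^sub>0 rat) \<Rightarrow> ('x \<Rightarrow>\<^sub>0 rat) set" where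
  "coset R x = {y. y - x \<in> R}"

text \<open>The linear combination of the cosets \<open>X i\<close> with coefficients \<open>a i\<close> in the quotient by \<open>R\<close>;
  it does not depend on the chosen representatives.\<close>

definition quot_lincomb ::
  "('x \<Rightarrow>\<^sub>0 rat) set \<Rightarrow> 'i set \<Rightarrow> ('i \<Rightarrow> rat) \<Rightarrow> ('i \<Rightarrow> ('x \<Rightarrow>\<^sub>0 rat) set) \<Rightarrow> ('x \<Rightarrow>\<^sub>0 rat) set" where
  "quot_lincomb R I a X = coset R (\<Sum>i\<in>I. qscale (a i) (SOME x. x \<in> X i))"

definition del_nth :: "nat \<Rightarrow> 'x list \<Rightarrow> 'x list" where
  "del_nth i xs = take i xs @ drop (Suc i) xs"


section \<open>The noncommutative polynomials \<open>S(s\<^sub>0,\<dots>,s\<^sub>n)\<close> and the signed set \<open>T(n)\<close>\<close>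

text \<open>An edge \<open>{i, j}\<close> is encoded by the pair \<open>(min i j, max i j)\<close>, and a noncommutative monomial
  by the list of its letters.\<close>

definition edge :: "nat \<Rightarrow> nat \<Rightarrow> nat \<times> nat" where
  "edge i j = (min i j, max i j)"

definition mult_letter ::
  "((nat \<times> nat) list \<Rightarrow>\<^sub>0 rat) \<Rightarrow> nat \<times> nat \<Rightarrow> ((nat \<times> nat) list \<Rightarrow>\<^sub>0 rat)" where
  "mult_letter p e = lin_ext (\<lambda>w. basis_elt (w @ [e])) p"

function S_poly :: "nat list \<Rightarrow> ((nat \<times> nat) list \<Rightarrow>\<^sub>0 rat)" where
  "S_poly s =
    (if length s < 2 then 0
     else if length s = 2 then basis_elt [edge (s ! 0) (s ! 1)]
     else let n = length s - 1 in
       mult_letter (S_poly (del_nth n s)) (edge (s ! 0) (s ! n))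
       - (\<Sum>i\<in>{1..n-1}. mult_letter (S_poly (del_nth (i + 1) s)) (edge (s ! i) (s ! (i + 1))))
       + (\<Sum>i\<in>{1..n-1}. mult_letter (S_poly (del_nth i s)) (edge (s ! i) (s ! (i + 1)))))"
  by pat_completeness auto
termination
  by (relation "measure length") (auto simp: del_nth_def)

declare S_poly.simps [simp del]

text \<open>\<open>T(n)\<close> and the signs are determined by \<open>S(0,\<dots>,n)\<close>: they are its support and its
  coefficients, which are all \<open>\<plusminus>1\<close>.\<close>

definition T_set :: "nat \<Rightarrow> (nat \<times> nat) list set" where
  "T_set n = Poly_Mapping.keys (S_poly [0..<n+1])"

definition T_sign :: "nat \<Rightarrow> (nat \<times> nat) list \<Rightarrow> rat" where
  "T_sign n \<iota> = Poly_Mapping.lookup (S_poly [0..<n+1]) \<iota>"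


section \<open>Group homology in degree one\<close>

text \<open>Let \<open>G\<close> be a group of bijections of \<open>'v\<close> acting through \<open>act\<close> on the set \<open>'b\<close>, hence on the
  free space on \<open>'b\<close>, and let \<open>R \<subseteq> A\<close> be \<open>G\<close>-stable subspaces of the latter. The first homology of
  \<open>G\<close> with coefficients in \<open>M = A / R\<close> is computed by the inhomogeneous bar complex
  \<open>M \<otimes> \<rat>[G\<^sup>k]\<close>, with \<open>\<partial>(m \<otimes> [g]) = g\<inverse>m - m\<close> and
  \<open>\<partial>(m \<otimes> [g|k]) = g\<inverse>m \<otimes> [k] - m \<otimes> [gk] + m \<otimes> [g]\<close>.\<close>

definition bar_bd1 ::
  "(('v \<Rightarrow> 'v) \<Rightarrow> 'b \<Rightarrow> 'b) \<Rightarrow> ('b \<times> ('v \<Rightarrow> 'v) \<Rightarrow>\<^sub>0 rat) \<Rightarrow> ('b \<Rightarrow>\<^sub>0 rat)" where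
  "bar_bd1 act = lin_ext (\<lambda>(b, g). basis_elt (act (inv g) b) - basis_elt b)"

definition bar_bd2 ::
  "(('v \<Rightarrow> 'v) \<Rightarrow> 'b \<Rightarrow> 'b) \<Rightarrow> ('b \<times> ('v \<Rightarrow> 'v) \<times> ('v \<Rightarrow> 'v) \<Rightarrow>\<^sub>0 rat)
    \<Rightarrow> ('b \<times> ('v \<Rightarrow> 'v) \<Rightarrow>\<^sub>0 rat)" where
  "bar_bd2 act = lin_ext (\<lambda>(b, g, k).
     basis_elt (act (inv g) b, k) - basis_elt (b, g \<circ> k) + basis_elt (b, g))"

definition H1_cycles ::
  "('v \<Rightarrow> 'v) set \<Rightarrow> (('v \<Rightarrow> 'v) \<Rightarrow> 'b \<Rightarrow> 'b) \<Rightarrow> ('b \<Rightarrow>\<^sub>0 rat) set \<Rightarrow> ('b \<Rightarrow>\<^sub>0 rat) set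
    \<Rightarrow> ('b \<times> ('v \<Rightarrow> 'v) \<Rightarrow>\<^sub>0 rat) set" where
  "H1_cycles G act A R = {c \<in> tensor_space A (free_on G). bar_bd1 act c \<in> R}"

definition H1_boundaries ::
  "('v \<Rightarrow> 'v) set \<Rightarrow> (('v \<Rightarrow> 'v) \<Rightarrow> 'b \<Rightarrow> 'b) \<Rightarrow> ('b \<Rightarrow>\<^sub>0 rat) set \<Rightarrow> ('b \<Rightarrow>\<^sub>0 rat) set
    \<Rightarrow> ('b \<times> ('v \<Rightarrow> 'v) \<Rightarrow>\<^sub>0 rat) set" where
  "H1_boundaries G act A R =
     {bar_bd2 act d + r |d r. d \<in> tensor_space A (free_on (G \<times> G)) \<and> r \<in> tensor_space R (free_on G)}"

definition group_H1 ::
  "('v \<Rightarrow> 'v) set \<Rightarrow> (('v \<Rightarrow> 'v) \<Rightarrow> 'b \<Rightarrow> 'b) \<Rightarrow> ('b \<Rightarrow>\<^sub>0 rat) set \<Rightarrow> ('b \<Rightarrow>\<^sub>0 rat) set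
    \<Rightarrow> ('b \<times> ('v \<Rightarrow> 'v) \<Rightarrow>\<^sub>0 rat) set set" where
  "group_H1 G act A R = coset (H1_boundaries G act A R) ` H1_cycles G act A R"


locale correlator_space = vector_space scale
  for scale :: "'a::field \<Rightarrow> 'b::ab_group_add \<Rightarrow> 'b" (infixr "*s" 75)
begin

section \<open>Steinberg modules\<close>

text \<open>Throughout, \<open>V\<close> is the whole type \<open>'b\<close>, of dimension \<open>dim UNIV\<close>.\<close>

text \<open>A simplex of the Tits building is the increasing list of its vertices; the empty list is the
  simplex of dimension \<open>-1\<close> of the augmented complex.\<close>

definition tits_simplex :: "'b set list \<Rightarrow> bool" where
  "tits_simplex \<sigma> \<longleftrightarrow>
     (\<forall>W\<in>set \<sigma>. subspace W \<and> W \<noteq> {0} \<and> W \<noteq> UNIV) \<and> sorted_wrt (\<subset>) \<sigma>"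

definition tits_bd :: "('b set list \<Rightarrow>\<^sub>0 rat) \<Rightarrow> ('b set list \<Rightarrow>\<^sub>0 rat)" where
  "tits_bd = lin_ext (\<lambda>\<sigma>. \<Sum>i<length \<sigma>. qscale ((-1) ^ i) (basis_elt (del_nth i \<sigma>)))"

text \<open>Reduced homology of the Tits building in degree \<open>n - 2\<close>, \<open>n = dim UNIV\<close>. Simplices of this
  dimension have \<open>n - 1\<close> vertices, and there are none with \<open>n\<close> vertices, so the homology is the
  space of cycles.\<close>

definition Steinberg :: "('b set list \<Rightarrow>\<^sub>0 rat) set" where
  "Steinberg =
     {z \<in> free_on {\<sigma>. tits_simplex \<sigma> \<and> length \<sigma> = dim UNIV - 1}. tits_bd z = 0}"

definition indep_list :: "'b list \<Rightarrow> bool" where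
  "indep_list vs \<longleftrightarrow> distinct vs \<and> independent (set vs)"

definition basis_list :: "'b list \<Rightarrow> bool" where
  "basis_list vs \<longleftrightarrow> indep_list vs \<and> span (set vs) = UNIV"

text \<open>The fundamental class of the apartment of \<open>v\<^sub>1,\<dots>,v\<^sub>n\<close>, triangulated by the flags
  \<open>\<langle>v\<^sub>\<tau>\<^sub>(\<^sub>1\<^sub>)\<rangle> \<subset> \<langle>v\<^sub>\<tau>\<^sub>(\<^sub>1\<^sub>), v\<^sub>\<tau>\<^sub>(\<^sub>2\<^sub>)\<rangle> \<subset> \<dots>\<close> with sign \<open>sgn \<tau>\<close>.\<close>

definition apartment :: "'b list \<Rightarrow> ('b set list \<Rightarrow>\<^sub>0 rat)" where
  "apartment vs =
     (if basis_list vs then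
        (\<Sum>\<tau> | \<tau> permutes {..<length vs}.
           qscale (of_int (sign \<tau>))
             (basis_elt (map (\<lambda>k. span ((\<lambda>i. vs ! \<tau> i) ` {..<k})) [1..<length vs])))
      else 0)"

definition Steinberg2 :: "('b set list \<times> 'b set list \<Rightarrow>\<^sub>0 rat) set" where
  "Steinberg2 = tensor_space Steinberg Steinberg"

definition direct_sum_decomp :: "'b set \<Rightarrow> 'b set \<Rightarrow> bool" where
  "direct_sum_decomp V1 V2 \<longleftrightarrow>
     subspace V1 \<and> subspace V2 \<and> V1 \<noteq> {0} \<and> V2 \<noteq> {0} \<and>
     V1 \<inter> V2 = {0} \<and> {x + y |x y. x \<in> V1 \<and> y \<in> V2} = UNIV"

text \<open>The image of the product maps: as Steinberg modules are spanned by apartment classes, it is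
  spanned by the products of \<open>[a] \<otimes> [b]\<close>, with \<open>a\<close>, \<open>b\<close> tuples in \<open>V\<^sub>1\<close>, and \<open>[c] \<otimes> [d]\<close>, with
  \<open>c\<close>, \<open>d\<close> tuples in \<open>V\<^sub>2\<close>.\<close>

definition decomposables :: "('b set list \<times> 'b set list \<Rightarrow>\<^sub>0 rat) set" where
  "decomposables = rat_free.span
     {tensor (apartment (a @ c)) (apartment (b @ d)) |a b c d.
        \<exists>V1 V2. direct_sum_decomp V1 V2 \<and>
          set a \<subseteq> V1 \<and> length a = dim V1 \<and> set b \<subseteq> V1 \<and> length b = dim V1 \<and>
          set c \<subseteq> V2 \<and> length c = dim V2 \<and> set d \<subseteq> V2 \<and> length d = dim V2}"

text \<open>\<open>St\<^sup>\<infinity>(V)\<close> is \<open>Steinberg2\<close> modulo \<open>decomposables\<close>.\<close>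

definition affine_basis :: "'b list \<Rightarrow> bool" where
  "affine_basis u \<longleftrightarrow> u \<noteq> [] \<and> basis_list (map (\<lambda>x. x - hd u) (tl u))"

definition C_rep :: "'b list \<Rightarrow> ('b set list \<times> 'b set list \<Rightarrow>\<^sub>0 rat)" where
  "C_rep u = (let n = length u - 1 in
     tensor (apartment (map (\<lambda>i. u ! i - u ! 0) (rev [1..<n+1])))
            (apartment ((u ! n - u ! 0) # map (\<lambda>i. u ! i - u ! (i + 1)) (rev [1..<n]))))"

definition C_class :: "'b list \<Rightarrow> ('b set list \<times> 'b set list \<Rightarrow>\<^sub>0 rat) set" where
  "C_class u = coset decomposables (C_rep u)"


section \<open>The space \<open>\<G>\<^sub>n(F)\<close>\<close>

definition GL :: "('b \<Rightarrow> 'b) set" where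
  "GL = {g. Vector_Spaces.linear scale scale g \<and> bij g}"

definition flag_act ::
  "('b \<Rightarrow> 'b) \<Rightarrow> 'b set list \<times> 'b set list \<Rightarrow> 'b set list \<times> 'b set list" where
  "flag_act g = map_prod (map (image g)) (map (image g))"

text \<open>\<open>\<G>\<^sub>n(F)\<close>, the \<open>E\<^sub>\<infinity>\<close>-homology of \<open>n \<mapsto> C\<^sub>*(BGL\<^sub>n(F); \<rat>)\<close> in rank \<open>n\<close> and degree
  \<open>2n - 1\<close>, is taken in its canonical model \<open>H\<^sub>1(GL(V); St\<^sup>\<infinity>(V))\<close>, \<open>n = dim V\<close>.\<close>

definition G_boundaries :: "(('b set list \<times> 'b set list) \<times> ('b \<Rightarrow> 'b) \<Rightarrow>\<^sub>0 rat) set" where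
  "G_boundaries = H1_boundaries GL flag_act Steinberg2 decomposables"

definition G_space :: "(('b set list \<times> 'b set list) \<times> ('b \<Rightarrow> 'b) \<Rightarrow>\<^sub>0 rat) set set" where
  "G_space = group_H1 GL flag_act Steinberg2 decomposables"


section \<open>Formal correlators\<close>

text \<open>\<open>FC(V)\<close> is \<open>free_on {u. affine_basis u}\<close> modulo \<open>FC_rel\<close>. The entries of an affine basis are
  distinct, so the shuffles of its parts form a set without multiplicities.\<close>

definition FC_rel :: "('b list \<Rightarrow>\<^sub>0 rat) set" where
  "FC_rel = rat_free.span
     ({basis_elt (map (\<lambda>x. x + t) u) - basis_elt u |t u. affine_basis u}
      \<union> {basis_elt (rotate1 u) - basis_elt u |u. affine_basis u}
      \<union> {\<Sum>w\<in>shuffles p q. basis_elt (x # w) |x p q. affine_basis (x # p @ q) \<and> p \<noteq> [] \<and> q \<noteq> []})"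

text \<open>\<open>FCR(V) = FCR_lift / FC_rel\<close>, and its coinvariants are \<open>FCR_lift / FCR_coinv_rel\<close>.\<close>

definition FCR_lift :: "('b list \<Rightarrow>\<^sub>0 rat) set" where
  "FCR_lift = {p \<in> free_on {u. affine_basis u}. lin_ext C_rep p \<in> decomposables}"

definition FCR_coinv_rel :: "('b list \<Rightarrow>\<^sub>0 rat) set" where
  "FCR_coinv_rel = rat_free.span
     (FC_rel \<union> {lin_ext (\<lambda>u. basis_elt (map g u)) p - p |g p. g \<in> GL \<and> p \<in> FCR_lift})"

text \<open>The graph of the connecting homomorphism
  \<open>H\<^sub>1(GL(V); St\<^sup>\<infinity>(V)) \<rightarrow> FCR(V)\<^bsub>GL(V)\<^esub>\<close> of the sequence \<open>0 \<rightarrow> FCR \<rightarrow> FC \<rightarrow> St\<^sup>\<infinity> \<rightarrow> 0\<close>: a cycle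
  \<open>c\<close> representing \<open>z\<close> is lifted to a chain \<open>e\<close> with coefficients in \<open>FC(V)\<close>, and the boundary of
  \<open>e\<close> lies in \<open>FCR(V)\<close>.\<close>

definition connecting ::
  "(('b set list \<times> 'b set list) \<times> ('b \<Rightarrow> 'b) \<Rightarrow>\<^sub>0 rat) set \<Rightarrow> ('b list \<Rightarrow>\<^sub>0 rat) set \<Rightarrow> bool" where
  "connecting z y \<longleftrightarrow> z \<in> G_space \<and>
     (\<exists>c\<in>z. \<exists>e\<in>tensor_space (free_on {u. affine_basis u}) (free_on GL).
        lin_ext (\<lambda>(u, g). tensor (C_rep u) (basis_elt g)) e - c
          \<in> tensor_space decomposables (free_on GL) \<and>
        bar_bd1 map e \<in> FCR_lift \<and>
        y = coset FCR_coinv_rel (bar_bd1 map e))"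

definition nonzero_functional :: "('b \<Rightarrow> 'a) \<Rightarrow> bool" where
  "nonzero_functional h \<longleftrightarrow> Vector_Spaces.linear scale (*) h \<and> (\<exists>v. h v \<noteq> 0)"

definition D_map :: "('b \<Rightarrow> 'a) \<Rightarrow> 'b list \<Rightarrow> ('b list \<Rightarrow>\<^sub>0 rat)" where
  "D_map h u = (let n = length u - 1 in
     (\<Sum>\<iota> | \<iota> \<in> T_set n \<and> (\<forall>(i, j)\<in>set \<iota>. h (u ! i - u ! j) \<noteq> 0).
        qscale (T_sign n \<iota>)
          (basis_elt (0 # map (\<lambda>(i, j). inverse (h (u ! i - u ! j)) *s (u ! i - u ! j)) \<iota>))))"

text \<open>\<open>Cor\<^sup>\<G>(x\<^sub>0,\<dots>,x\<^sub>n)\<close>: the element of \<open>\<G>\<^sub>n(F)\<close> which the connecting isomorphism sends to the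
  class of \<open>(id - D\<^sub>h)(FC[u\<^sub>0:\<dots>:u\<^sub>n])\<close>.\<close>

definition Cor :: "'a list \<Rightarrow> (('b set list \<times> 'b set list) \<times> ('b \<Rightarrow> 'b) \<Rightarrow>\<^sub>0 rat) set" where
  "Cor x = (THE z. \<exists>u h. affine_basis u \<and> nonzero_functional h \<and> length x = length u \<and>
     (\<forall>i<length u. h (u ! i) - h (u ! 0) = x ! i - x ! 0) \<and>
     connecting z (coset FCR_coinv_rel (basis_elt u - D_map h u)))"

end

end

theory Submission
  imports Defs "HOL-Combinatorics.Multiset_Permutations"
begin

text \<open>
  For a nonzero functional \<open>h\<close>, send a pair of complete flags \<open>L\<close>, \<open>M\<close> to \<open>FC[0 : e\<^sub>1 : \<dots> : e\<^sub>n]\<close>,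
  where \<open>e\<^sub>i\<close> spans the line \<open>L\<^sub>i \<inter> M\<^sub>n\<^sub>+\<^sub>1\<^sub>-\<^sub>i\<close> and \<open>h(e\<^sub>i) = 1\<close>, and to \<open>0\<close> if the flags are not
  opposite or \<open>h\<close> vanishes on one of these lines. On a product of two pairs of apartments the words
  \<open>e\<^sub>1 \<dots> e\<^sub>n\<close> form a shuffle product, so that the induced map on \<open>St\<^sup>2(V)\<close> kills decomposable
  elements modulo the shuffle relations. On \<open>C[u\<^sub>0 : \<dots> : u\<^sub>n]\<close> the lines are spanned by differences
  \<open>u\<^sub>i - u\<^sub>j\<close>, and peeling off the last line reproduces the recursion of \<open>S(0,\<dots>,n)\<close>; hence the map
  is \<open>D\<^sub>h\<close> up to sign, and \<open>D\<^sub>h\<close> kills \<open>FCR(V)\<close>. Thus, if \<open>p = \<Sum> a\<^sub>i FC[u\<^sup>i]\<close> lies in \<open>FCR(V)\<close>, the sum of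
  correlators is the class of \<open>p - D\<^sub>h p = p\<close>, whatever \<open>h\<close> is.

  That the correlators are well defined is part of the claim. Expanding apartments along one line at
  a time shows that \<open>id - D\<^sub>h\<close> lands in \<open>FCR(V)\<close>. The connecting map is injective because \<open>FC(V)\<close> is
  a quotient of a free module over \<open>GL(V)\<close> by relations whose coinvariants embed into \<open>\<rat>\<close>: all
  shuffle relations are rational multiples of one symmetric element in the coinvariants.
\<close>

section \<open>Linear extensions\<close>

text \<open>Every relation between apartments is d d = 0 in disguise: an apartment is built by
  iterated signed deletion, two deletions anticommute, and if all terms of a relation share their
  largest subspace, it can be split off, leaving one more deletion that cancels. This gives the
  Steinberg relation (\<open>asum_flag_class_dependent\<close>) and a relation among the projections
  of a list along its own members (\<open>proj_sum_eq_0\<close>). The latter yields the star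
  relation needed for cyclic symmetry, the three-term relation behind the shuffles and the expansion
  that produces D_h. The obstacle is \<open>Cor\<close>, a definite description: it says nothing
  before existence and uniqueness are known. Uniqueness is injectivity of the connecting map.
  Existence requires an element of FC(V) to be a boundary modulo relations, and only its coefficient
  sum obstructs this. In dimension at least 2 a relation with nonzero coefficient sum corrects it;
  in dimension 1 there are no shuffle relations, but D_h of a generator is a single generator, so
  the sum is 0 from the start. Rational coefficients matter: n! and the length of a rotation are
  divided by.\<close>

abbreviation qlinear :: "(('x \<Rightarrow>\<^sub>0 rat) \<Rightarrow> ('y \<Rightarrow>\<^sub>0 rat)) \<Rightarrow> bool" where
  "qlinear \<equiv> Vector_Spaces.linear qscale qscale"

lemma qlinear_iff:
  "qlinear T \<longleftrightarrow> (\<forall>p q. T (p + q) = T p + T q) \<and> (\<forall>c p. T (qscale c p) = qscale c (T p))"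
  unfolding Vector_Spaces.linear_def module_hom_def module_hom_axioms_def
  by (auto intro: rat_free.module_axioms rat_free.vector_space_axioms)

lemma qlinearI:
  "(\<And>p q. T (p + q) = T p + T q) \<Longrightarrow> (\<And>c p. T (qscale c p) = qscale c (T p)) \<Longrightarrow> qlinear T"
  by (simp add: qlinear_iff)


lemma
  assumes "qlinear T"
  shows qlinear_add': "T (p + q) = T p + T q"
    and qlinear_scale: "T (qscale c p) = qscale c (T p)"
    and qlinear_0: "T 0 = 0"
    and qlinear_minus: "T (- p) = - T p"
    and qlinear_diff: "T (p - q) = T p - T q"
    and qlinear_sum: "T (sum f S) = (\<Sum>x\<in>S. T (f x))"
proof -
  interpret T: Vector_Spaces.linear qscale qscale T by fact
  show "T (p + q) = T p + T q" "T (qscale c p) = qscale c (T p)" "T 0 = 0" "T (- p) = - T p"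
    "T (p - q) = T p - T q" "T (sum f S) = (\<Sum>x\<in>S. T (f x))"
    by (rule T.add T.scale T.zero T.neg T.diff T.sum)+
qed

lemma lin_ext_superset:
  assumes "finite S" "Poly_Mapping.keys p \<subseteq> S"
  shows "lin_ext f p = (\<Sum>x\<in>S. qscale (Poly_Mapping.lookup p x) (f x))"
  unfolding lin_ext_def
  by (rule sum.mono_neutral_left) (use assms in \<open>auto simp: in_keys_iff\<close>)

lemma qlinear_lin_ext: "qlinear (lin_ext f)"
proof (rule qlinearI)
  fix p q :: "'a \<Rightarrow>\<^sub>0 rat"
  let ?S = "Poly_Mapping.keys p \<union> Poly_Mapping.keys q"
  have "lin_ext f (p + q) = (\<Sum>x\<in>?S. qscale (Poly_Mapping.lookup (p + q) x) (f x))"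
    by (rule lin_ext_superset) (auto simp: Poly_Mapping.keys_add)
  also have "\<dots> = (\<Sum>x\<in>?S. qscale (Poly_Mapping.lookup p x) (f x)) + (\<Sum>x\<in>?S. qscale (Poly_Mapping.lookup q x) (f x))"
    by (simp add: lookup_add rat_free.scale_left_distrib sum.distrib)
  also have "\<dots> = lin_ext f p + lin_ext f q"
    by (subst (1 2) lin_ext_superset[of ?S]) auto
  finally show "lin_ext f (p + q) = lin_ext f p + lin_ext f q" .
next
  fix c and p :: "'a \<Rightarrow>\<^sub>0 rat"
  have "lin_ext f (qscale c p) = (\<Sum>x\<in>Poly_Mapping.keys p. qscale (Poly_Mapping.lookup (qscale c p) x) (f x))"
    by (rule lin_ext_superset) (auto simp: in_keys_iff)
  then show "lin_ext f (qscale c p) = qscale c (lin_ext f p)"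
    by (simp add: lin_ext_def rat_free.scale_sum_right)
qed

lemmas lin_ext_add = qlinear_add'[OF qlinear_lin_ext]
  and lin_ext_scale = qlinear_scale[OF qlinear_lin_ext]
  and lin_ext_0 [simp] = qlinear_0[OF qlinear_lin_ext]
  and lin_ext_diff = qlinear_diff[OF qlinear_lin_ext]
  and lin_ext_sum = qlinear_sum[OF qlinear_lin_ext]

lemma lin_ext_basis [simp]: "lin_ext f (basis_elt x) = f x"
  by (simp add: lin_ext_def)

lemma lin_ext_cong:
  "(\<And>x. x \<in> Poly_Mapping.keys p \<Longrightarrow> f x = g x) \<Longrightarrow> lin_ext f p = lin_ext g p"
  by (simp add: lin_ext_def)

lemma lin_ext_basis_elt [simp]: "lin_ext basis_elt p = p"
proof (rule poly_mapping_eqI)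
  fix k
  have "Poly_Mapping.lookup (lin_ext basis_elt p) k
      = (\<Sum>x\<in>Poly_Mapping.keys p. Poly_Mapping.lookup p x * (1 when x = k))"
    unfolding lin_ext_def by (simp only: lookup_sum lookup_qscale lookup_single)
  also have "\<dots> = Poly_Mapping.lookup p k"
    by (simp add: when_def in_keys_iff if_distrib[of "(*) _"] sum.delta cong: if_cong)
  finally show "Poly_Mapping.lookup (lin_ext basis_elt p) k = Poly_Mapping.lookup p k" .
qed

lemma qlinear_lin_ext_comp:
  assumes "qlinear T"
  shows "T (lin_ext f p) = lin_ext (\<lambda>x. T (f x)) p"
  by (simp add: lin_ext_def qlinear_sum[OF assms] qlinear_scale[OF assms])

lemma qlinear_eq_lin_ext:
  assumes "qlinear T"
  shows "T p = lin_ext (\<lambda>x. T (basis_elt x)) p"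
  using qlinear_lin_ext_comp[OF assms, of basis_elt p] by simp

lemma qlinear_eqI:
  assumes "qlinear S" "qlinear T" "\<And>x. x \<in> Poly_Mapping.keys p \<Longrightarrow> S (basis_elt x) = T (basis_elt x)"
  shows "S p = T p"
  by (subst qlinear_eq_lin_ext[OF assms(1)], subst qlinear_eq_lin_ext[OF assms(2)])
     (rule lin_ext_cong, rule assms(3))

lemma lin_ext_lin_ext: "lin_ext f (lin_ext g p) = lin_ext (\<lambda>x. lin_ext f (g x)) p"
  by (rule qlinear_lin_ext_comp[OF qlinear_lin_ext])

lemma lin_ext_in_subspace:
  assumes "rat_free.subspace S" "\<And>x. x \<in> Poly_Mapping.keys p \<Longrightarrow> f x \<in> S"
  shows "lin_ext f p \<in> S"
  unfolding lin_ext_def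
  by (intro rat_free.subspace_sum rat_free.subspace_scale assms)

lemma qlinear_comp: "qlinear S \<Longrightarrow> qlinear T \<Longrightarrow> qlinear (\<lambda>p. S (T p))"
  by (simp add: qlinear_iff)

lemma qlinear_lin_ext_right:
  assumes "\<And>x. qlinear (T x)"
  shows "qlinear (\<lambda>q. lin_ext (\<lambda>x. T x q) p)"
proof (rule qlinearI)
  fix c q
  show "lin_ext (\<lambda>x. T x (qscale c q)) p = qscale c (lin_ext (\<lambda>x. T x q) p)"
    unfolding lin_ext_def qlinear_scale[OF assms] rat_free.scale_sum_right
    by (rule sum.cong[OF refl], rule rat_free.scale_left_commute)
qed (simp add: lin_ext_def qlinear_add'[OF assms] rat_free.scale_right_distrib sum.distrib)

lemma free_on_subspace: "rat_free.subspace (free_on X)"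
proof -
  have "Poly_Mapping.keys (qscale c p) \<subseteq> X" if "Poly_Mapping.keys p \<subseteq> X"
    for c and p :: "'a \<Rightarrow>\<^sub>0 rat"
    using that by (auto simp: in_keys_iff)
  moreover have "Poly_Mapping.keys (p + q) \<subseteq> X" if "Poly_Mapping.keys p \<subseteq> X" "Poly_Mapping.keys q \<subseteq> X"
    for p q :: "'a \<Rightarrow>\<^sub>0 rat"
    using that Poly_Mapping.keys_add[of p q] by auto
  ultimately show ?thesis
    unfolding rat_free.subspace_def free_on_def by simp
qed

lemma basis_elt_in_free_on [simp]: "basis_elt x \<in> free_on X \<longleftrightarrow> x \<in> X"
  by (simp add: free_on_def)

lemma in_free_onD: "p \<in> free_on X \<Longrightarrow> x \<in> Poly_Mapping.keys p \<Longrightarrow> x \<in> X"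
  by (auto simp: free_on_def)

lemma span_induct_linear:
  assumes "p \<in> rat_free.span S" "rat_free.subspace R" "qlinear T" "\<And>x. x \<in> S \<Longrightarrow> T x \<in> R"
  shows "T p \<in> R"
  using assms(1)
proof (induction rule: rat_free.span_induct_alt)
  case base
  then show ?case using assms(2) by (simp add: qlinear_0[OF assms(3)] rat_free.subspace_0)
next
  case (step c x y)
  then show ?case
    by (simp add: qlinear_add'[OF assms(3)] qlinear_scale[OF assms(3)] assms(4)
        rat_free.subspace_add rat_free.subspace_scale assms(2))
qed

lemma qlinear_tensor_left: "qlinear (\<lambda>p. tensor p q)"
  unfolding tensor_def by (rule qlinear_lin_ext)

lemma qlinear_tensor_right: "qlinear (tensor p)"
  unfolding tensor_def by (intro qlinear_lin_ext_right qlinear_lin_ext)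

lemma tensor_basis [simp]: "tensor (basis_elt x) (basis_elt y) = basis_elt (x, y)"
  by (simp add: tensor_def)

lemmas tensor_add_left = qlinear_add'[OF qlinear_tensor_left]
  and tensor_minus_left = qlinear_minus[OF qlinear_tensor_left]
  and tensor_scale_left = qlinear_scale[OF qlinear_tensor_left]
  and tensor_0_left [simp] = qlinear_0[OF qlinear_tensor_left]
  and tensor_add_right = qlinear_add'[OF qlinear_tensor_right]
  and tensor_scale_right = qlinear_scale[OF qlinear_tensor_right]
  and tensor_0_right [simp] = qlinear_0[OF qlinear_tensor_right]

lemma tensor_space_subspace: "rat_free.subspace (tensor_space A B)"
  unfolding tensor_space_def by (rule rat_free.subspace_span)

lemma tensor_in_tensor_space: "a \<in> A \<Longrightarrow> b \<in> B \<Longrightarrow> tensor a b \<in> tensor_space A B"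
  unfolding tensor_space_def by (rule rat_free.span_base) auto

lemma tensor_space_free: "tensor_space (free_on X) (free_on Y) = free_on (X \<times> Y)"
proof
  have "tensor p q \<in> free_on (X \<times> Y)" if "p \<in> free_on X" "q \<in> free_on Y"
    for p :: "'a \<Rightarrow>\<^sub>0 rat" and q :: "'b \<Rightarrow>\<^sub>0 rat"
    unfolding tensor_def
    by (intro lin_ext_in_subspace free_on_subspace) (use that in \<open>auto dest: in_free_onD\<close>)
  then show "tensor_space (free_on X) (free_on Y) \<subseteq> free_on (X \<times> Y)"
    unfolding tensor_space_def by (intro rat_free.span_minimal free_on_subspace) auto
next
  show "free_on (X \<times> Y) \<subseteq> tensor_space (free_on X) (free_on Y)"
  proof
    fix p assume p: "p \<in> free_on (X \<times> Y)"
    have "lin_ext basis_elt p \<in> tensor_space (free_on X) (free_on Y)"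
    proof (intro lin_ext_in_subspace tensor_space_subspace)
      fix x assume "x \<in> Poly_Mapping.keys p"
      then obtain a b where "x = (a, b)" "a \<in> X" "b \<in> Y" using p by (auto dest: in_free_onD)
      then show "basis_elt x \<in> tensor_space (free_on X) (free_on Y)"
        using tensor_in_tensor_space[of "basis_elt a" "free_on X" "basis_elt b" "free_on Y"] by simp
    qed
    then show "p \<in> tensor_space (free_on X) (free_on Y)" by simp
  qed
qed

lemma self_neg_zero: "p = - p \<Longrightarrow> p = (0 :: 'x \<Rightarrow>\<^sub>0 rat)"
proof (rule poly_mapping_eqI)
  fix k assume "p = - p"
  then have "Poly_Mapping.lookup p k = - Poly_Mapping.lookup p k" by (metis lookup_uminus)
  then show "Poly_Mapping.lookup p k = Poly_Mapping.lookup 0 k" by simp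
qed

lemma qscale_sign_sign [simp]: "qscale ((-1) ^ k) (qscale ((-1) ^ k) p) = p"
  by (simp add: power_mult_distrib[symmetric])


section \<open>Alternating sums over lists\<close>

text \<open>The simplicial boundary of a list: the entry at place j is removed with sign (-1)^j, and
  \<open>F\<close> receives both the entry and the remaining list. The entries already passed are
  absorbed into \<open>F\<close>, which keeps the recursion structural.\<close>

primrec asum :: "('a \<Rightarrow> 'a list \<Rightarrow> ('y \<Rightarrow>\<^sub>0 rat)) \<Rightarrow> 'a list \<Rightarrow> ('y \<Rightarrow>\<^sub>0 rat)" where
  "asum F [] = 0"
| "asum F (x # xs) = F x xs - asum (\<lambda>y r. F y (x # r)) xs"

lemma asum_cong:
  "(\<And>xs y ys. vs = xs @ y # ys \<Longrightarrow> F y (xs @ ys) = G y (xs @ ys)) \<Longrightarrow> asum F vs = asum G vs"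
proof (induction vs arbitrary: F G)
  case (Cons v vs)
  have "asum (\<lambda>y r. F y (v # r)) vs = asum (\<lambda>y r. G y (v # r)) vs"
    by (rule Cons.IH) (use Cons.prems[of "v # _"] in simp)
  then show ?case using Cons.prems[of "[]"] by simp
qed simp

lemma asum_zero_fun [simp]: "asum (\<lambda>y r. 0) vs = 0"
  by (induction vs) auto

lemma asum_eq_0:
  "(\<And>xs y ys. vs = xs @ y # ys \<Longrightarrow> F y (xs @ ys) = 0) \<Longrightarrow> asum F vs = 0"
  using asum_cong[of vs F "\<lambda>_ _. 0"] by simp

lemma asum_linear: "qlinear T \<Longrightarrow> T (asum F vs) = asum (\<lambda>y r. T (F y r)) vs"
  by (induction vs arbitrary: F) (auto simp: qlinear_0 qlinear_diff)

lemma asum_diff: "asum (\<lambda>y r. F y r - G y r) vs = asum F vs - asum G vs"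
  by (induction vs arbitrary: F G) auto

lemma asum_add: "asum (\<lambda>y r. F y r + G y r) vs = asum F vs + asum G vs"
  by (induction vs arbitrary: F G) (auto simp: algebra_simps)

lemma asum_scale: "asum (\<lambda>y r. qscale c (F y r)) vs = qscale c (asum F vs)"
  by (induction vs arbitrary: F) (auto simp: rat_free.scale_right_diff_distrib)

lemma asum_map: "asum F (map g vs) = asum (\<lambda>y r. F (g y) (map g r)) vs"
  by (induction vs arbitrary: F) auto

lemma asum_append:
  "asum F (xs @ ys) = asum (\<lambda>y r. F y (r @ ys)) xs
     + qscale ((-1) ^ length xs) (asum (\<lambda>y r. F y (xs @ r)) ys)"
  by (induction xs arbitrary: F) auto

lemma asum_in_subspace:
  assumes "rat_free.subspace S" "\<And>xs y ys. vs = xs @ y # ys \<Longrightarrow> F y (xs @ ys) \<in> S"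
  shows "asum F vs \<in> S"
  using assms(2)
proof (induction vs arbitrary: F)
  case Nil
  then show ?case using assms(1) by (simp add: rat_free.subspace_0)
next
  case (Cons v vs)
  have "asum (\<lambda>y r. F y (v # r)) vs \<in> S"
    by (rule Cons.IH) (use Cons.prems[of "v # _"] in simp)
  then show ?case using Cons.prems[of "[]"] assms(1) by (simp add: rat_free.subspace_diff)
qed

lemma del_nth_Cons_Suc [simp]: "del_nth (Suc j) (x # xs) = x # del_nth j xs"
  and del_nth_Cons_0 [simp]: "del_nth 0 (x # xs) = xs"
  by (simp_all add: del_nth_def)

lemma asum_index:
  "asum F vs = (\<Sum>j<length vs. qscale ((-1) ^ j) (F (vs ! j) (del_nth j vs)))"
  by (induction vs arbitrary: F) (simp_all add: sum.lessThan_Suc_shift sum_negf[symmetric] del: sum.lessThan_Suc)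

text \<open>Both orders of removal leave the same list, but removing the earlier entry first shifts
  the place of the later one by one; hence the sign.\<close>

lemma asum_swap:
  "asum (\<lambda>x. asum (\<lambda>y s. F x y s)) vs = - asum (\<lambda>y. asum (\<lambda>x s. F x y s)) vs"
proof (induction vs arbitrary: F)
  case (Cons a vs)
  have *: "asum (\<lambda>x. asum (F x)) (a # vs) = asum (F a) vs - asum (\<lambda>x. F x a) vs
      + asum (\<lambda>x. asum (\<lambda>y s. F x y (a # s))) vs" for F :: "_ \<Rightarrow> _ \<Rightarrow> _ \<Rightarrow> (_ \<Rightarrow>\<^sub>0 rat)"
    by (simp add: asum_diff algebra_simps)
  show ?case
    unfolding *[of F] *[of "\<lambda>x y. F y x"] Cons.IH[of "\<lambda>x y s. F x y (a # s)"] by simp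
qed simp

text \<open>This is d d = 0. The sum equals its own negative, which suffices over the
  rationals.\<close>

lemma asum_asum_symmetric:
  assumes "\<And>x y s. F x y s = F y x s"
  shows "asum (\<lambda>x. asum (F x)) vs = 0"
  using asum_swap[of F vs] assms by (intro self_neg_zero) simp

text \<open>For \<open>n = length vs\<close> this is the signed sum of \<open>f\<close> over all
  orderings of \<open>vs\<close>, generated by choosing the first entry. The number \<open>n\<close>
  drives the recursion because the lists \<open>r\<close> are not tails of
  \<open>vs\<close>.\<close>

primrec alt :: "nat \<Rightarrow> ('a list \<Rightarrow> ('y \<Rightarrow>\<^sub>0 rat)) \<Rightarrow> 'a list \<Rightarrow> ('y \<Rightarrow>\<^sub>0 rat)" where
  "alt 0 f vs = f []"
| "alt (Suc n) f vs = asum (\<lambda>y r. alt n (\<lambda>w. f (y # w)) r) vs"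

lemma alt_cong:
  "length vs = n \<Longrightarrow> (\<And>w. mset w = mset vs \<Longrightarrow> f w = g w) \<Longrightarrow> alt n f vs = alt n g vs"
proof (induction n arbitrary: f g vs)
  case (Suc n)
  show ?case unfolding alt.simps
    by (intro asum_cong Suc.IH) (use Suc.prems in auto)
qed simp

lemma alt_linear: "qlinear T \<Longrightarrow> T (alt n f vs) = alt n (\<lambda>w. T (f w)) vs"
  by (induction n arbitrary: f vs) (auto simp: asum_linear)

lemma alt_map: "alt n f (map g vs) = alt n (\<lambda>w. f (map g w)) vs"
  by (induction n arbitrary: f vs) (auto simp: asum_map)

text \<open>The same sum generated by choosing the last entry. This form cuts flags at the top, the
  defining one at the bottom; carrying an entry from one end to the other costs (-1)^n.\<close>

lemma alt_snoc:
  "alt (Suc n) f vs = qscale ((-1) ^ n) (asum (\<lambda>y r. alt n (\<lambda>w. f (w @ [y])) r) vs)"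
proof (induction n arbitrary: f vs)
  case (Suc n)
  have "alt (Suc (Suc n)) f vs = asum (\<lambda>x r. alt (Suc n) (\<lambda>w. f (x # w)) r) vs"
    by (rule alt.simps)
  also have "\<dots> = asum (\<lambda>x r. qscale ((-1) ^ n)
      (asum (\<lambda>y s. alt n (\<lambda>w. f (x # w @ [y])) s) r)) vs"
    by (rule asum_cong, subst Suc.IH) (rule refl)
  also have "\<dots> = qscale ((-1) ^ n)
      (asum (\<lambda>x. asum (\<lambda>y s. alt n (\<lambda>w. f (x # w @ [y])) s)) vs)"
    by (rule asum_scale)
  also have "\<dots> = qscale ((-1) ^ Suc n)
      (asum (\<lambda>y r. asum (\<lambda>x s. alt n (\<lambda>w. f (x # w @ [y])) s) r) vs)"
    by (subst asum_swap) simp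
  also have "\<dots> = qscale ((-1) ^ Suc n) (asum (\<lambda>y r. alt (Suc n) (\<lambda>w. f (w @ [y])) r) vs)"
    by (rule arg_cong[where f = "qscale _"], rule asum_cong) (simp only: alt.simps append_Cons)
  finally show ?case .
next
  case 0
  have "alt 0 g = (\<lambda>r. g [])" for g :: "'a list \<Rightarrow> ('b \<Rightarrow>\<^sub>0 rat)" by (rule ext) simp
  then show ?case by simp
qed

text \<open>Orderings that differ by exchanging the places \<open>i\<close> and \<open>i + 1\<close>
  cancel. This is what makes apartments cycles.\<close>

lemma alt_symmetric_eq_0:
  assumes "\<And>p a b q. length p = i \<Longrightarrow> f (p @ a # b # q) = f (p @ b # a # q)" "Suc i < n"
  shows "alt n f vs = 0"
  using assms
proof (induction i arbitrary: n f vs)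
  case 0
  obtain m where n: "n = Suc (Suc m)" using \<open>Suc 0 < n\<close> by (cases n; cases "n - 1") auto
  have sym: "f (x # y # w) = f (y # x # w)" for x y w using 0(1)[of "[]" x y w] by simp
  have "asum (\<lambda>x. asum (\<lambda>y s. alt m (\<lambda>w. f (x # y # w)) s)) vs = 0"
    by (rule asum_asum_symmetric) (subst sym, rule refl)
  then show ?case by (simp only: n alt.simps)
next
  case (Suc i)
  obtain m where n: "n = Suc m" "Suc i < m" using \<open>Suc (Suc i) < n\<close> by (cases n) auto
  have "alt m (\<lambda>w. f (y # w)) r = 0" for y r
    by (rule Suc.IH) (use Suc.prems(1)[of "y # _"] n in auto)
  then show ?case unfolding n alt.simps by (intro asum_eq_0)
qed

text \<open>The shape of the sum in \<open>apartment\<close>. It serves to identify that definition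
  with \<open>alt\<close> and to supply the sign for moving an entry, which is awkward to see in the
  recursive form.\<close>

definition palt :: "('a list \<Rightarrow> ('y \<Rightarrow>\<^sub>0 rat)) \<Rightarrow> 'a list \<Rightarrow> ('y \<Rightarrow>\<^sub>0 rat)" where
  "palt f vs = (\<Sum>\<tau> | \<tau> permutes {..<length vs}.
     qscale (of_int (sign \<tau>)) (f (map (\<lambda>i. vs ! \<tau> i) [0..<length vs])))"

lemma palt_swap: "palt f (xs @ a # b # ys) = - palt f (xs @ b # a # ys)"
proof -
  let ?vs = "xs @ a # b # ys" and ?ws = "xs @ b # a # ys"
  let ?i = "length xs" let ?t = "transpose ?i (Suc ?i)"
  have t: "?t permutes {..<length ?ws}" by (rule permutes_swap_id) auto
  have nth: "?vs ! (?t k) = ?ws ! k" for k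
    by (auto simp: transpose_def nth_append nth_Cons split: nat.split)
  have nth': "?vs ! k = ?ws ! (?t k)" for k
    by (auto simp: transpose_def nth_append nth_Cons split: nat.split)
  have sg: "sign (?t \<circ> \<tau>) = - sign \<tau>" if "\<tau> permutes {..<length ?ws}" for \<tau>
  proof -
    have "permutation \<tau>" using that permutes_imp_permutation by blast
    then show ?thesis by (simp add: sign_compose permutation_swap_id sign_swap_id)
  qed
  have "palt f ?vs = (\<Sum>\<tau> | \<tau> permutes {..<length ?ws}. - qscale (of_int (sign (?t \<circ> \<tau>)))
     (f (map (\<lambda>i. ?ws ! ((?t \<circ> \<tau>) i)) [0..<length ?ws])))"
    unfolding palt_def
  proof (rule sum.cong)
    fix \<tau> assume "\<tau> \<in> {\<tau>. \<tau> permutes {..<length ?ws}}"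
    then have *: "sign (?t \<circ> \<tau>) = - sign \<tau>" using sg by simp
    show "qscale (of_int (sign \<tau>)) (f (map (\<lambda>i. ?vs ! \<tau> i) [0..<length ?vs])) =
          - qscale (of_int (sign (?t \<circ> \<tau>))) (f (map (\<lambda>i. ?ws ! ((?t \<circ> \<tau>) i)) [0..<length ?ws]))"
      unfolding * by (simp add: nth')
  qed simp
  also have "\<dots> = - palt f ?ws"
    unfolding palt_def sum_negf
      setum_permutations_compose_left[OF t, of "\<lambda>\<tau>. qscale (of_int (sign \<tau>))
         (f (map (\<lambda>i. ?ws ! \<tau> i) [0..<length ?ws]))"] by simp
  finally show ?thesis .
qed

lemma palt_move: "palt f (xs @ v # X @ ys) = qscale ((-1) ^ length X) (palt f (xs @ X @ v # ys))"
proof (induction X arbitrary: xs)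
  case (Cons x X)
  have "palt f (xs @ v # (x # X) @ ys) = - palt f ((xs @ [x]) @ v # X @ ys)"
    using palt_swap[of f xs v x "X @ ys"] by simp
  then show ?case unfolding Cons by simp
qed simp


text \<open>Permutations are sorted by the index \<open>b\<close> that is put last: each is a
  permutation of the first \<open>n\<close> indices followed by the transposition of
  \<open>n\<close> and \<open>b\<close>.\<close>

lemma palt_snoc:
  assumes "length vs = Suc n"
  shows "palt f vs = qscale ((-1) ^ n) (asum (\<lambda>y r. palt (\<lambda>w. f (w @ [y])) r) vs)"
proof -
  let ?t = "\<lambda>b. transpose n b"
  let ?P = "{q. q permutes {..<n}}"
  let ?g = "\<lambda>b w. f (w @ [vs ! b])"
  have inner: "(\<Sum>q\<in>?P. qscale (of_int (sign (?t b \<circ> q)))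
        (f (map (\<lambda>i. vs ! (?t b \<circ> q) i) [0..<Suc n])))
      = qscale ((-1) ^ (n + b)) (palt (?g b) (del_nth b vs))" if b: "b \<le> n" for b
  proof -
    \<comment> \<open>For \<open>b < n\<close> this is \<open>vs\<close> without its last entry,
      which has taken the place of entry \<open>b\<close>. Moving it back across n - b - 1 entries
      and the sign of the transposition together give (-1)^(n + b).\<close>
    define vs' where "vs' = map (\<lambda>i. vs ! ?t b i) [0..<n]"
    have "qscale (of_int (sign (?t b \<circ> q))) (f (map (\<lambda>i. vs ! (?t b \<circ> q) i) [0..<Suc n]))
        = qscale (if b = n then 1 else -1) (qscale (of_int (sign q))
            (?g b (map (\<lambda>i. vs' ! q i) [0..<length vs'])))" if q: "q permutes {..<n}" for q
    proof -
      have "permutation q" using q permutes_imp_permutation by blast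
      then have sg: "sign (?t b \<circ> q) = (if b = n then 1 else -1) * sign q"
        by (simp add: sign_compose permutation_swap_id sign_swap_id)
      have qn: "q n = n" using q by (simp add: permutes_def)
      have qi: "q i < n" if "i < n" for i using that q permutes_in_image[OF q, of i] by simp
      have "map (\<lambda>i. vs ! (?t b \<circ> q) i) [0..<Suc n]
          = map (\<lambda>i. vs' ! q i) [0..<length vs'] @ [vs ! b]"
        using qn qi by (simp add: vs'_def)
      then show ?thesis by (simp add: sg del: upt_Suc)
    qed
    then have "(\<Sum>q\<in>?P. qscale (of_int (sign (?t b \<circ> q)))
          (f (map (\<lambda>i. vs ! (?t b \<circ> q) i) [0..<Suc n])))
        = qscale (if b = n then 1 else -1) (palt (?g b) vs')"
      by (simp add: palt_def rat_free.scale_sum_right vs'_def)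
    also have "\<dots> = qscale ((-1) ^ (n + b)) (palt (?g b) (del_nth b vs))"
    proof (cases "b = n")
      case True
      have "vs' = del_nth b vs"
        by (rule nth_equalityI) (use assms True in \<open>auto simp: vs'_def del_nth_def\<close>)
      then show ?thesis using True by (simp add: power_add[symmetric] mult_2[symmetric])
    next
      case False
      define xs ys where "xs = take b vs" and "ys = take (n - Suc b) (drop (Suc b) vs)"
      have len: "length xs = b" "length ys = n - Suc b" using b False assms by (auto simp: xs_def ys_def)
      have vs: "vs = xs @ vs ! b # ys @ [vs ! n]"
        by (rule nth_equalityI)
           (use b False assms in \<open>auto simp: xs_def ys_def nth_append nth_Cons min_def split: nat.split
              intro!: arg_cong[of _ _ "(!) vs"]\<close>)
      have "vs' = xs @ vs ! n # ys"
        by (rule nth_equalityI)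
           (use b False assms in \<open>auto simp: vs'_def xs_def ys_def nth_append nth_Cons min_def
              transpose_def split: nat.split intro!: arg_cong[of _ _ "(!) vs"]\<close>)
      moreover have "del_nth b vs = xs @ ys @ [vs ! n]"
        by (subst vs) (simp add: del_nth_def len)
      moreover have "(-1::rat) ^ (n + b) = - ((-1) ^ (n - Suc b))"
      proof -
        have "n + b = Suc (n - Suc b) + 2 * b" using b False by simp
        then show ?thesis by (simp only: power_add power_mult) simp
      qed
      ultimately show ?thesis using palt_move[of "?g b" xs "vs ! n" ys "[]"] False len by simp
    qed
    finally show ?thesis .
  qed
  have ins: "{..<Suc n} = insert n {..<n}" by auto
  have "palt f vs = (\<Sum>b\<in>insert n {..<n}. \<Sum>q\<in>?P. qscale (of_int (sign (?t b \<circ> q)))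
      (f (map (\<lambda>i. vs ! (?t b \<circ> q) i) [0..<Suc n])))"
    unfolding palt_def assms ins by (rule sum_over_permutations_insert) auto
  also have "\<dots> = (\<Sum>b<Suc n. qscale ((-1) ^ (n + b)) (palt (?g b) (del_nth b vs)))"
    unfolding ins by (rule sum.cong) (use inner in auto)
  finally show ?thesis
    by (simp add: asum_index assms rat_free.scale_sum_right power_add del: sum.lessThan_Suc)
qed

lemma alt_eq_palt: "length vs = n \<Longrightarrow> alt n f vs = palt f vs"
proof (induction n arbitrary: f vs)
  case 0
  then show ?case by (simp add: palt_def permutes_empty sign_id)
next
  case (Suc n)
  have "asum (\<lambda>y r. alt n (\<lambda>w. f (w @ [y])) r) vs = asum (\<lambda>y r. palt (\<lambda>w. f (w @ [y])) r) vs"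
    by (intro asum_cong Suc.IH) (use Suc.prems in auto)
  then show ?case unfolding alt_snoc palt_snoc[OF Suc.prems] by simp
qed

lemma alt_move:
  assumes "length (xs @ v # X @ ys) = n"
  shows "alt n f (xs @ v # X @ ys) = qscale ((-1) ^ length X) (alt n f (xs @ X @ v # ys))"
  using assms palt_move[of f xs v X ys] by (simp add: alt_eq_palt)

section \<open>Apartments and their relations\<close>

context correlator_space
begin

lemma indep_list_Nil [simp]: "indep_list []"
  by (simp add: indep_list_def independent_empty)

lemma indep_list_Cons: "indep_list (x # xs) \<longleftrightarrow> indep_list xs \<and> x \<notin> span (set xs)"
  unfolding indep_list_def by (auto simp: independent_insert span_base)

lemma indep_list_mset: "mset ws = mset vs \<Longrightarrow> indep_list ws \<longleftrightarrow> indep_list vs"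
  unfolding indep_list_def by (metis mset_eq_imp_distinct_iff mset_eq_setD)

lemma indep_list_insert:
  "indep_list (xs @ y # ys) \<longleftrightarrow> indep_list (xs @ ys) \<and> y \<notin> span (set (xs @ ys))"
  using indep_list_mset[of "xs @ y # ys" "y # xs @ ys"] by (simp add: indep_list_Cons)

lemma indep_list_appendD1: "indep_list (xs @ ys) \<Longrightarrow> indep_list xs"
  unfolding indep_list_def using independent_mono[of "set (xs @ ys)" "set xs"] by auto

lemma indep_list_appendD2: "indep_list (xs @ ys) \<Longrightarrow> indep_list ys"
  unfolding indep_list_def using independent_mono[of "set (xs @ ys)" "set ys"] by auto

lemma indep_list_nonzero: "indep_list vs \<Longrightarrow> 0 \<notin> set vs"
  unfolding indep_list_def using dependent_zero by blast

text \<open>Steinitz: an independent list does not lie in the span of fewer vectors, which rules out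
  repetitions and dependencies in \<open>ws\<close> and members of \<open>ws\<close> outside the
  span of \<open>vs\<close> alike.\<close>

lemma indep_list_exchange:
  assumes "indep_list vs" "set vs \<subseteq> span (set ws)" "length ws \<le> length vs"
  shows "indep_list ws \<and> span (set ws) = span (set vs)"
proof -
  have card: "card (set vs) = length vs" and ind: "independent (set vs)"
    using assms(1) by (auto simp: indep_list_def distinct_card)
  have bound: "length vs \<le> card T" if "finite T" "set vs \<subseteq> span T" for T
    using independent_span_bound[OF that(1) ind that(2)] card by simp
  have "distinct ws"
    using bound[of "set ws"] assms(2,3) card_length[of ws] by (intro card_distinct) auto
  moreover have "independent (set ws)"
  proof
    assume "dependent (set ws)"
    then obtain a where a: "a \<in> set ws" "a \<in> span (set ws - {a})"
      by (auto simp: dependent_def)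
    then have "span (set ws - {a}) = span (set ws)"
      by (metis insert_Diff span_redundant)
    then have "length vs \<le> card (set ws - {a})" using bound[of "set ws - {a}"] assms(2) by simp
    moreover have "card (set ws - {a}) < card (set ws)" using a(1) by (intro card_Diff1_less) auto
    ultimately show False using card_length[of ws] assms(3) by linarith
  qed
  moreover have "set ws \<subseteq> span (set vs)"
  proof
    fix w assume w: "w \<in> set ws"
    show "w \<in> span (set vs)"
    proof (rule ccontr)
      assume nin: "w \<notin> span (set vs)"
      then have "independent (insert w (set vs))" by (simp add: independent_insert ind)
      moreover have "insert w (set vs) \<subseteq> span (set ws)" using w assms(2) by (auto intro: span_base)
      ultimately have "card (insert w (set vs)) \<le> card (set ws)"
        using independent_span_bound[of "set ws" "insert w (set vs)"] by simp
      moreover have "w \<notin> set vs" using nin span_base by blast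
      ultimately show False using card card_length[of ws] assms(3) by simp
    qed
  qed
  ultimately show ?thesis
    using assms(2) by (auto simp: indep_list_def span_eq)
qed

text \<open>The top space is kept, although simplices of the Tits building omit it: flags of a
  proper subspace can then be extended, and \<open>butlast\<close> returns to simplices.\<close>

definition full_flag :: "'b list \<Rightarrow> 'b set list" where
  "full_flag w = map (\<lambda>k. span (set (take k w))) [1..<Suc (length w)]"

lemma full_flag_Nil [simp]: "full_flag [] = []"
  by (simp add: full_flag_def)

lemma full_flag_snoc: "full_flag (w @ [x]) = full_flag w @ [span (insert x (set w))]"
proof -
  have "take k (w @ [x]) = take k w" if "k \<in> set [1..<Suc (length w)]" for k
    using that by (auto simp del: upt_Suc)
  moreover have "[1..<Suc (length (w @ [x]))] = [1..<Suc (length w)] @ [Suc (length w)]" by simp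
  ultimately show ?thesis by (simp add: full_flag_def del: upt_Suc cong: map_cong)
qed

lemma length_full_flag [simp]: "length (full_flag w) = length w"
  by (simp add: full_flag_def del: upt_Suc)

lemma full_flag_Cons: "full_flag (x # w) = span {x} # map (\<lambda>k. span (insert x (set (take k w)))) [1..<Suc (length w)]"
proof -
  have "[1..<Suc (length (x # w))] = 1 # map Suc [1..<Suc (length w)]"
    using upt_conv_Cons[of 1 "Suc (length (x # w))"] map_Suc_upt[of 1 "Suc (length w)"]
    by (simp del: upt_Suc)
  then show ?thesis by (simp add: full_flag_def comp_def del: upt_Suc)
qed

lemma butlast_full_flag: "butlast (full_flag w) = map (\<lambda>k. span (set (take k w))) [1..<length w]"
  by (cases w) (auto simp: full_flag_def map_butlast[symmetric])

lemma apartment_eq_alt: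
  "apartment vs = (if basis_list vs then alt (length vs) (\<lambda>w. basis_elt (butlast (full_flag w))) vs else 0)"
proof -
  have *: "(\<lambda>i. vs ! \<tau> i) ` {..<k} = set (take k (map (\<lambda>i. vs ! \<tau> i) [0..<length vs]))"
    if "k < length vs" for \<tau> :: "nat \<Rightarrow> nat" and k
    using that by (auto simp: take_map)
  have "map (\<lambda>k. span ((\<lambda>i. vs ! \<tau> i) ` {..<k})) [1..<length vs] =
      butlast (full_flag (map (\<lambda>i. vs ! \<tau> i) [0..<length vs]))" for \<tau> :: "nat \<Rightarrow> nat"
    unfolding butlast_full_flag by (auto simp: * simp del: set_take_subset)
  then show ?thesis unfolding apartment_def by (simp add: alt_eq_palt palt_def)
qed

text \<open>The apartment of the subspace spanned by \<open>vs\<close>, whatever its dimension, with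
  that subspace still on top. Inductions on the length can then stay inside one ambient
  space.\<close>

definition flag_class :: "'b list \<Rightarrow> ('b set list \<Rightarrow>\<^sub>0 rat)" where
  "flag_class vs = (if indep_list vs then alt (length vs) (\<lambda>w. basis_elt (full_flag w)) vs else 0)"

abbreviation add_top :: "'b set \<Rightarrow> ('b set list \<Rightarrow>\<^sub>0 rat) \<Rightarrow> ('b set list \<Rightarrow>\<^sub>0 rat)" where
  "add_top W \<equiv> lin_ext (\<lambda>\<sigma>. basis_elt (\<sigma> @ [W]))"

text \<open>All orderings of \<open>vs\<close> end in the same space, so it splits off and the
  boundary of the list remains; the sign is that of \<open>alt_snoc\<close>.\<close>

lemma flag_class_rec:
  assumes "indep_list vs" "vs \<noteq> []"
  shows "flag_class vs = qscale ((-1) ^ (length vs - 1))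
    (add_top (span (set vs)) (asum (\<lambda>_. flag_class) vs))"
proof -
  obtain m where m: "length vs = Suc m" using assms(2) by (cases vs) auto
  have "asum (\<lambda>y r. alt m (\<lambda>w. basis_elt (full_flag (w @ [y]))) r) vs
      = asum (\<lambda>y r. add_top (span (set vs)) (flag_class r)) vs"
  proof (rule asum_cong)
    fix xs y ys assume vs: "vs = xs @ y # ys"
    have len: "length (xs @ ys) = m" using m vs by simp
    have ind: "indep_list (xs @ ys)" using assms(1) vs by (simp add: indep_list_insert)
    have "alt m (\<lambda>w. basis_elt (full_flag (w @ [y]))) (xs @ ys)
        = alt m (\<lambda>w. add_top (span (set vs)) (basis_elt (full_flag w))) (xs @ ys)"
    proof (rule alt_cong[OF len])
      fix w assume "mset w = mset (xs @ ys)"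
      then have "set w = set (xs @ ys)" by (rule mset_eq_setD)
      then show "basis_elt (full_flag (w @ [y])) = add_top (span (set vs)) (basis_elt (full_flag w))"
        using vs by (simp add: full_flag_snoc)
    qed
    also have "\<dots> = add_top (span (set vs)) (flag_class (xs @ ys))"
      using ind len by (simp add: flag_class_def alt_linear[OF qlinear_lin_ext])
    finally show "alt m (\<lambda>w. basis_elt (full_flag (w @ [y]))) (xs @ ys)
        = add_top (span (set vs)) (flag_class (xs @ ys))" .
  qed
  then show ?thesis
    using assms m alt_snoc[of m "\<lambda>w. basis_elt (full_flag w)" vs]
    by (simp add: flag_class_def asum_linear[OF qlinear_lin_ext])
qed

text \<open>Deleting an entry leaves either a dependent list, whose class is 0 and whose boundary is
  0 by induction, or an independent one with the span of \<open>vs\<close>. So the same top splits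
  off from every term, and d d = 0 remains. The list \<open>[0]\<close> shows why zero vectors are
  excluded: its boundary is the class of the empty list.\<close>

lemma asum_flag_class_dependent:
  assumes "0 \<notin> set vs" "\<not> indep_list vs"
  shows "asum (\<lambda>_. flag_class) vs = 0"
  using assms
proof (induction "length vs" arbitrary: vs rule: less_induct)
  case less
  have "asum (\<lambda>_. flag_class) vs = asum (\<lambda>_ r. qscale ((-1) ^ (length vs - 2))
      (add_top (span (set vs)) (asum (\<lambda>_. flag_class) r))) vs"
  proof (rule asum_cong)
    fix xs y ys assume vs: "vs = xs @ y # ys"
    show "flag_class (xs @ ys) = qscale ((-1) ^ (length vs - 2))
      (add_top (span (set vs)) (asum (\<lambda>_. flag_class) (xs @ ys)))"
    proof (cases "indep_list (xs @ ys)")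
      case True
      then have y: "y \<in> span (set (xs @ ys))" using less.prems vs by (simp add: indep_list_insert)
      then have "span (insert y (set (xs @ ys))) = span (set (xs @ ys))" by (rule span_redundant)
      then have "span (set vs) = span (set (xs @ ys))" using vs by simp
      moreover have "xs @ ys \<noteq> []" using y less.prems(1) vs by auto
      ultimately show ?thesis using flag_class_rec[OF True] vs by simp
    next
      case False
      have "asum (\<lambda>_. flag_class) (xs @ ys) = 0"
        by (rule less.hyps) (use False less.prems vs in auto)
      then show ?thesis using False by (simp add: flag_class_def)
    qed
  qed
  also have "\<dots> = qscale ((-1) ^ (length vs - 2))
      (add_top (span (set vs)) (asum (\<lambda>_. asum (\<lambda>_. flag_class)) vs))"
    by (simp add: asum_scale asum_linear[OF qlinear_lin_ext])
  also have "asum (\<lambda>_. asum (\<lambda>_. flag_class)) vs = 0"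
    by (rule asum_asum_symmetric) simp
  finally show ?case by simp
qed

text \<open>A pair \<open>(x, c)\<close> stands for a vector \<open>x\<close> on which some linear functional takes the value \<open>c\<close>.
  For \<open>c \<noteq> 0\<close>, \<open>proj_along (x, c)\<close> projects the other vectors along \<open>x\<close> to its kernel.\<close>

definition proj_along :: "'b \<times> 'a \<Rightarrow> 'b \<times> 'a \<Rightarrow> 'b" where
  "proj_along p q = fst q - (snd q / snd p) *s fst p"

text \<open>No functional on V is fixed. A pair can be read as a vector of V + F with the second
  coordinate as functional; its kernel is V, and all projections land there.\<close>

definition proj_sum :: "('b \<times> 'a) list \<Rightarrow> ('b set list \<Rightarrow>\<^sub>0 rat)" where
  "proj_sum ps = asum (\<lambda>p r. if snd p \<noteq> 0 then flag_class (map (proj_along p) r) else 0) ps"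

lemma proj_along_in_span:
  assumes "ps = xs @ l # ys" "snd l \<noteq> 0" "p \<in> set ps"
  shows "proj_along l p \<in> span (proj_along l ` set (xs @ ys))"
proof (cases "p = l")
  case True
  then have "proj_along l p = 0" using assms(2) by (simp add: proj_along_def)
  then show ?thesis by (simp add: span_zero)
next
  case False
  then show ?thesis using assms by (auto intro!: span_base)
qed

lemma proj_along_change:
  assumes "snd l \<noteq> 0" "snd p \<noteq> 0"
  shows "proj_along p q = proj_along l q - (snd q / snd p) *s proj_along l p"
  using assms by (simp add: proj_along_def algebra_simps)

text \<open>Changing the direction of projection does not change the span of the projected list, so
  all nonzero terms have the same top \<open>K\<close>. Once \<open>K\<close> is split off,
  exchanging the two deletions leaves sums of the same kind for lists with one entry fewer.
  Induction applies as long as two entries with nonzero value survive.\<close>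

lemma proj_sum_eq_0:
  assumes "length (filter (\<lambda>p. snd p \<noteq> 0) ps) \<ge> 2"
  shows "proj_sum ps = 0"
  using assms
proof (induction "length ps" arbitrary: ps rule: less_induct)
  case less
  let ?J = "\<lambda>ps. length (filter (\<lambda>p :: 'b \<times> 'a. snd p \<noteq> 0) ps)"
  show ?case
  proof (cases "\<exists>xs p ys. ps = xs @ p # ys \<and> snd p \<noteq> 0 \<and> indep_list (map (proj_along p) (xs @ ys))")
    case False
    have "(if snd p \<noteq> 0 then flag_class (map (proj_along p) (xs @ ys)) else 0) = 0"
      if "ps = xs @ p # ys" for xs p ys
    proof -
      have "\<not> (snd p \<noteq> 0 \<and> indep_list (map (proj_along p) (xs @ ys)))" using False that by blast
      then show ?thesis unfolding flag_class_def by argo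
    qed
    then show ?thesis unfolding proj_sum_def by (rule asum_eq_0)
  next
    case True
    then obtain xs0 p0 ys0 where p0: "ps = xs0 @ p0 # ys0" "snd p0 \<noteq> 0"
      "indep_list (map (proj_along p0) (xs0 @ ys0))" by blast
    define K where "K = span (set (map (proj_along p0) (xs0 @ ys0)))"
    have 1: "(if snd p \<noteq> 0 then flag_class (map (proj_along p) (xs @ ys)) else 0)
       = qscale ((-1) ^ (length ps - 2)) (add_top K
           (asum (\<lambda>q s. if snd p \<noteq> 0 then flag_class (map (proj_along p) s) else 0) (xs @ ys)))"
      if ps: "ps = xs @ p # ys" for xs p ys
    proof (cases "snd p \<noteq> 0")
      case True
      have "set (map (proj_along p0) (xs0 @ ys0)) \<subseteq> span (set (map (proj_along p) (xs @ ys)))"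
      proof
        fix z assume "z \<in> set (map (proj_along p0) (xs0 @ ys0))"
        then obtain q where q: "q \<in> set ps" "z = proj_along p0 q" using p0 by auto
        have "proj_along p q \<in> span (proj_along p ` set (xs @ ys))"
          "proj_along p p0 \<in> span (proj_along p ` set (xs @ ys))"
          using proj_along_in_span[OF ps True, of q] proj_along_in_span[OF ps True, of p0] q(1)
          unfolding p0(1) by simp_all
        then show "z \<in> span (set (map (proj_along p) (xs @ ys)))"
          unfolding q proj_along_change[OF True p0(2)] set_map by (intro span_diff span_scale)
      qed
      moreover have "length (map (proj_along p) (xs @ ys)) \<le> length (map (proj_along p0) (xs0 @ ys0))"
        using arg_cong[OF trans[OF ps[symmetric] p0(1)], of length] by simp
      ultimately have ind: "indep_list (map (proj_along p) (xs @ ys))"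
        and sp: "span (set (map (proj_along p) (xs @ ys))) = K"
        using indep_list_exchange[OF p0(3)] unfolding K_def by blast+
      have "length ps \<ge> 2" using less.prems length_filter_le[of _ ps] order_trans by blast
      then have "xs @ ys \<noteq> []" using ps by auto
      then show ?thesis
        using flag_class_rec[OF ind] sp True ps by (simp add: asum_map del: map_append)
    qed simp
    have "proj_sum ps = asum (\<lambda>p r. qscale ((-1) ^ (length ps - 2)) (add_top K
           (asum (\<lambda>q s. if snd p \<noteq> 0 then flag_class (map (proj_along p) s) else 0) r))) ps"
      unfolding proj_sum_def by (rule asum_cong) (rule 1)
    also have "\<dots> = qscale ((-1) ^ (length ps - 2)) (add_top K
        (asum (\<lambda>p. asum (\<lambda>q s. if snd p \<noteq> 0 then flag_class (map (proj_along p) s) else 0)) ps))"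
      by (simp add: asum_scale asum_linear[OF qlinear_lin_ext])
    also have "asum (\<lambda>p. asum (\<lambda>q s. if snd p \<noteq> 0 then flag_class (map (proj_along p) s) else 0)) ps
        = - asum (\<lambda>q. proj_sum) ps"
      unfolding proj_sum_def by (rule asum_swap)
    also have "asum (\<lambda>q. proj_sum) ps = 0"
    proof (cases "?J ps = 2")
      case False
      show ?thesis
      proof (rule asum_eq_0)
        fix xs y ys assume ps: "ps = xs @ y # ys"
        show "proj_sum (xs @ ys) = 0"
          by (rule less.hyps) (use ps less.prems False in \<open>auto split: if_splits\<close>)
      qed
    next
      \<comment> \<open>Exactly two values are nonzero. After one of these entries is deleted,
        projecting along the other moves nothing, as all remaining values are 0; the terms become
        symmetric in the two entries and cancel.\<close>
      case True
      have "asum (\<lambda>q. proj_sum) ps = asum (\<lambda>q. asum (\<lambda>p s. if snd q \<noteq> 0 \<and> snd p \<noteq> 0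
          then flag_class (map fst s) else 0)) ps"
      proof (rule asum_cong)
        fix xs q ys assume ps: "ps = xs @ q # ys"
        show "proj_sum (xs @ ys) = asum (\<lambda>p s. if snd q \<noteq> 0 \<and> snd p \<noteq> 0
          then flag_class (map fst s) else 0) (xs @ ys)"
        proof (cases "snd q = 0")
          case True
          have "proj_sum (xs @ ys) = 0"
            by (rule less.hyps) (use ps less.prems True in auto)
          then show ?thesis using True by simp
        next
          case False
          have J: "?J (xs @ ys) = 1" using ps \<open>?J ps = 2\<close> False by simp
          show ?thesis unfolding proj_sum_def
          proof (rule asum_cong)
            fix as p bs assume eq: "xs @ ys = as @ p # bs"
            have "map (proj_along p) (as @ bs) = map fst (as @ bs)" if "snd p \<noteq> 0"
            proof -
              have "?J (as @ bs) = 0" using J that unfolding eq by simp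
              then have "snd z = 0" if "z \<in> set (as @ bs)" for z
                using that by (auto simp: filter_empty_conv)
              then show ?thesis by (simp add: proj_along_def)
            qed
            then show "(if snd p \<noteq> 0 then flag_class (map (proj_along p) (as @ bs)) else 0) =
              (if snd q \<noteq> 0 \<and> snd p \<noteq> 0 then flag_class (map fst (as @ bs)) else 0)"
              using False by argo
          qed
        qed
      qed
      also have "\<dots> = 0" by (rule asum_asum_symmetric) (simp add: conj_commute)
      finally show ?thesis .
    qed
    finally show ?thesis by simp
  qed
qed

lemma indep_list_map:
  assumes "Vector_Spaces.linear scale scale g" "inj g"
  shows "indep_list (map g vs) \<longleftrightarrow> indep_list vs"
proof -
  interpret g: Vector_Spaces.linear scale scale g by fact
  show ?thesis
    by (induction vs) (simp_all add: indep_list_Cons g.span_image inj_image_mem_iff[OF assms(2)])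
qed

lemma indep_list_append_disjoint:
  assumes "indep_list (a @ c)" "x \<in> span (set a)" "x \<in> span (set c)"
  shows "x = 0"
  using assms
proof (induction a)
  case (Cons y a)
  from Cons.prems(2) obtain k where k: "x - k *s y \<in> span (set a)"
    by (auto simp: span_breakdown_eq)
  have y: "y \<notin> span (set (a @ c))" using Cons.prems(1) by (simp add: indep_list_Cons)
  have sub: "span (set a) \<subseteq> span (set (a @ c))" "span (set c) \<subseteq> span (set (a @ c))"
    by (intro span_mono; simp)+
  have "x - (x - k *s y) \<in> span (set (a @ c))"
    by (rule span_diff) (use k Cons.prems(3) sub in blast)+
  then have ky: "k *s y \<in> span (set (a @ c))" by (simp only: diff_diff_eq2 add_diff_cancel_left')
  have "k = 0"
  proof (rule ccontr)
    assume "k \<noteq> 0"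
    then have "inverse k *s (k *s y) = y" by simp
    then show False using span_scale[OF ky, of "inverse k"] y by simp
  qed
  then show ?case using k Cons by (simp add: indep_list_Cons)
qed simp

section \<open>Stars and paths of points\<close>

definition star :: "'b \<Rightarrow> 'b list \<Rightarrow> 'b list" where
  "star x vs = map (\<lambda>v. v - x) vs"

primrec path_edges :: "'b \<Rightarrow> 'b list \<Rightarrow> 'b list" where
  "path_edges x [] = []"
| "path_edges x (v # vs) = (v - x) # path_edges v vs"

lemma star_simps [simp]: "star x [] = []" "star x (v # vs) = (v - x) # star x vs"
  "star x (vs @ ws) = star x vs @ star x ws"
  by (simp_all add: star_def)

lemma length_star [simp]: "length (star x vs) = length vs"
  by (simp add: star_def)

lemma length_path_edges [simp]: "length (path_edges x vs) = length vs"
  by (induction vs arbitrary: x) auto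

lemma path_edges_append [simp]:
  "path_edges x (vs @ y # ws) = path_edges x vs @ (y - last (x # vs)) # path_edges y ws"
  by (induction vs arbitrary: x) auto

lemma nth_path_edges: "j < length vs \<Longrightarrow> path_edges x vs ! j = vs ! j - (x # vs) ! j"
proof (induction vs arbitrary: x j)
  case (Cons v vs)
  then show ?case by (cases j) auto
qed simp

lemma star_translate: "star (x + t) (map (\<lambda>v. v + t) vs) = star x vs"
  by (simp add: star_def)

lemma path_edges_translate: "path_edges (x + t) (map (\<lambda>v. v + t) vs) = path_edges x vs"
  by (induction vs arbitrary: x) auto

definition C_path :: "'b \<Rightarrow> 'b list \<Rightarrow> ('b set list \<times> 'b set list \<Rightarrow>\<^sub>0 rat)" where
  "C_path x rs = tensor (apartment (star x rs)) (apartment (path_edges x rs))"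

text \<open>The second factor walks from u_0 through u_n, u_(n-1), ..., u_1, so the points after the
  first are read backwards. For a single point the lists in the second factor would have different
  lengths.\<close>

lemma C_rep_eq_C_path:
  assumes "vs \<noteq> []"
  shows "C_rep (x # vs) = C_path x (rev vs)"
proof -
  let ?u = "x # vs" let ?m = "length vs"
  have 1: "map (\<lambda>i. ?u ! i - ?u ! 0) (rev [1..<?m + 1]) = star x (rev vs)"
    by (rule nth_equalityI) (auto simp: star_def rev_nth nth_Cons' simp del: upt_Suc)
  have 2: "(?u ! ?m - ?u ! 0) # map (\<lambda>i. ?u ! i - ?u ! (i + 1)) (rev [1..<?m]) = path_edges x (rev vs)"
  proof (rule nth_equalityI)
    show "length ((?u ! ?m - ?u ! 0) # map (\<lambda>i. ?u ! i - ?u ! (i + 1)) (rev [1..<?m])) = length (path_edges x (rev vs))"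
      using Suc_le_eq[of 0 ?m] assms by simp
    fix j assume "j < length ((?u ! ?m - ?u ! 0) # map (\<lambda>i. ?u ! i - ?u ! (i + 1)) (rev [1..<?m]))"
    then have j: "j < ?m" using Suc_le_eq[of 0 ?m] assms by simp
    show "((?u ! ?m - ?u ! 0) # map (\<lambda>i. ?u ! i - ?u ! (i + 1)) (rev [1..<?m])) ! j = path_edges x (rev vs) ! j"
    proof (cases j)
      case 0
      then show ?thesis using assms j by (simp add: nth_path_edges rev_nth nth_Cons')
    next
      case (Suc k)
      then have "Suc (?m - Suc (Suc k)) = ?m - Suc k" using j by simp
      then show ?thesis using j Suc by (auto simp: nth_path_edges rev_nth nth_Cons' Suc_diff_Suc)
    qed
  qed
  show ?thesis
    unfolding C_rep_def C_path_def Let_def using 1 2 by simp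
qed

lemma basis_list_mset: "mset ws = mset vs \<Longrightarrow> basis_list ws \<longleftrightarrow> basis_list vs"
  unfolding basis_list_def using indep_list_mset mset_eq_setD by metis

lemma apartment_move:
  "apartment (xs @ v # X @ ys) = qscale ((-1) ^ length X) (apartment (xs @ X @ v # ys))"
  using basis_list_mset[of "xs @ v # X @ ys" "xs @ X @ v # ys"]
    alt_move[where f = "\<lambda>w. basis_elt (butlast (full_flag w))" and xs = xs and v = v and X = X and ys = ys, OF refl]
  by (simp add: apartment_eq_alt del: alt.simps)

abbreviation (input) proportional :: "'b \<Rightarrow> 'b \<Rightarrow> bool" where
  "proportional x y \<equiv> \<exists>c. c \<noteq> 0 \<and> y = c *s x"

lemma span_proportional:
  assumes "\<And>z. z \<in> Z \<Longrightarrow> proportional (fst z) (snd z)"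
  shows "span (fst ` Z) = span (snd ` Z)"
proof (rule span_eq[THEN iffD2], intro conjI subsetI)
  fix x assume "x \<in> fst ` Z"
  then obtain z where z: "z \<in> Z" "x = fst z" by auto
  then obtain c where "c \<noteq> 0" "snd z = c *s fst z" using assms by blast
  then have "x = inverse c *s snd z" using z by simp
  then show "x \<in> span (snd ` Z)" using z by (auto intro: span_scale span_base)
next
  fix x assume "x \<in> snd ` Z"
  then obtain z where z: "z \<in> Z" "x = snd z" by auto
  then obtain c where "snd z = c *s fst z" using assms by blast
  then show "x \<in> span (fst ` Z)" using z by (auto intro: span_scale span_base)
qed

text \<open>The flags of an apartment see only the lines spanned by its vectors. This absorbs all
  signs and normalisations by \<open>h\<close> below.\<close>

lemma apartment_proportional:
  assumes "list_all2 proportional vs ws"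
  shows "apartment vs = apartment ws"
proof -
  define zs where "zs = zip vs ws"
  have len: "length vs = length ws" using assms by (rule list_all2_lengthD)
  have zs: "map fst zs = vs" "map snd zs = ws" "length zs = length ws" using len by (auto simp: zs_def)
  have pr: "proportional (fst z) (snd z)" if "z \<in> set zs" for z
    using assms that unfolding zs_def list_all2_iff by (cases z) auto
  have sp: "span (set (take k (map fst w))) = span (set (take k (map snd w)))"
    if "set w \<subseteq> set zs" for w k
  proof -
    have "span (fst ` set (take k w)) = span (snd ` set (take k w))"
    proof (rule span_proportional)
      fix z assume "z \<in> set (take k w)"
      then have "z \<in> set zs" using that in_set_takeD by fast
      then show "proportional (fst z) (snd z)" by (rule pr)
    qed
    then show ?thesis by (simp only: take_map set_map)
  qed
  have spn: "span (set vs) = span (set ws)" using sp[OF subset_refl, of "length zs"] unfolding zs using len by simp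
  have "indep_list vs \<longleftrightarrow> indep_list ws"
    using indep_list_exchange[of vs ws] indep_list_exchange[of ws vs] spn len
      span_superset[of "set vs"] span_superset[of "set ws"] by (metis order_refl)
  then have "basis_list vs \<longleftrightarrow> basis_list ws" using spn by (simp add: basis_list_def)
  moreover have "alt (length ws) (\<lambda>w. basis_elt (butlast (full_flag w))) (map fst zs)
      = alt (length ws) (\<lambda>w. basis_elt (butlast (full_flag w))) (map snd zs)"
    unfolding alt_map
  proof (rule alt_cong)
    fix w assume "mset w = mset zs"
    then have "set w \<subseteq> set zs" using mset_eq_setD by blast
    then have "full_flag (map fst w) = full_flag (map snd w)"
      by (simp only: full_flag_def sp length_map)
    then show "basis_elt (butlast (full_flag (map fst w))) = basis_elt (butlast (full_flag (map snd w)))"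
      by simp
  qed (rule zs)
  ultimately show ?thesis unfolding zs by (simp add: apartment_eq_alt len)
qed

lemma decomposables_subspace: "rat_free.subspace decomposables"
  unfolding decomposables_def by (rule rat_free.subspace_span)

text \<open>No subspaces have to be supplied: if \<open>a @ c\<close> is not a basis the tensor is
  0, and otherwise the spans of \<open>a\<close> and \<open>c\<close> form the
  decomposition.\<close>

lemma tensor_in_decomposables:
  assumes "a \<noteq> []" "c \<noteq> []" "length b = length a" "length d = length c"
    "set b \<subseteq> span (set a)" "set d \<subseteq> span (set c)"
  shows "tensor (apartment (a @ c)) (apartment (b @ d)) \<in> decomposables"
proof (cases "basis_list (a @ c)")
  case False
  then show ?thesis
    using decomposables_subspace by (simp add: apartment_def rat_free.subspace_0)
next
  case True
  then have ind: "indep_list (a @ c)" and sp: "span (set (a @ c)) = UNIV" by (auto simp: basis_list_def)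
  have ia: "indep_list a" "indep_list c" by (rule indep_list_appendD1[OF ind], rule indep_list_appendD2[OF ind])
  have nz: "span (set a) \<noteq> {0}" if "indep_list a" "a \<noteq> []" for a
    using that indep_list_nonzero[OF that(1)] span_base[of "hd a" "set a"] by (cases a) auto
  have dim: "dim (span (set a)) = length a" if "indep_list a" for a
    using that by (simp add: indep_list_def dim_eq_card_independent distinct_card)
  have "direct_sum_decomp (span (set a)) (span (set c))"
    unfolding direct_sum_decomp_def
  proof (intro conjI)
    show "span (set a) \<inter> span (set c) = {0}"
      using indep_list_append_disjoint[OF ind] by (auto simp: span_zero)
    have "{x + y |x y. x \<in> span (set a) \<and> y \<in> span (set c)} = span (set (a @ c))"
      unfolding set_append span_Un by auto
    then show "{x + y |x y. x \<in> span (set a) \<and> y \<in> span (set c)} = UNIV" using sp by simp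
  qed (use nz ia assms in auto)
  moreover have "set a \<subseteq> span (set a)" "set c \<subseteq> span (set c)" by (rule span_superset)+
  moreover have "length a = dim (span (set a))" "length b = dim (span (set a))"
    "length c = dim (span (set c))" "length d = dim (span (set c))"
    using dim[OF ia(1)] dim[OF ia(2)] assms(3,4) by simp_all
  ultimately show ?thesis
    unfolding decomposables_def using assms(5,6)
    apply -
    apply (rule rat_free.span_base, rule CollectI, rule exI[of _ a], rule exI[of _ b], rule exI[of _ c], rule exI[of _ d])
    apply (rule conjI[OF refl], rule exI[of _ "span (set a)"], rule exI[of _ "span (set c)"])
    apply (intro conjI; assumption)
    done
qed

lemma apartment_map:
  assumes "g \<in> GL"
  shows "apartment (map g vs) = lin_ext (\<lambda>\<sigma>. basis_elt (map (image g) \<sigma>)) (apartment vs)"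
proof -
  have lin: "Vector_Spaces.linear scale scale g" and bij: "bij g" using assms by (auto simp: GL_def)
  interpret g: Vector_Spaces.linear scale scale g by (rule lin)
  have inj: "inj g" using bij by (rule bij_is_inj)
  have "span (set (map g vs)) = UNIV \<longleftrightarrow> span (set vs) = UNIV"
    using bij by (simp add: g.span_image) (metis bij_is_surj inj inj_image_eq_iff)
  then have "basis_list (map g vs) \<longleftrightarrow> basis_list vs"
    by (simp add: basis_list_def indep_list_map[OF lin inj])
  moreover have "butlast (full_flag (map g w)) = map (image g) (butlast (full_flag w))" for w
    unfolding butlast_full_flag by (simp add: take_map g.span_image)
  ultimately show ?thesis
    by (simp add: apartment_eq_alt alt_map alt_linear[OF qlinear_lin_ext])
qed

text \<open>With the space at place i removed, every remaining initial segment contains both or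
  neither of the entries at places i and i + 1, so the alternating sum over orderings
  vanishes.\<close>

lemma tits_bd_alt_flag:
  assumes "length vs = m"
  shows "tits_bd (alt m (\<lambda>w. basis_elt (butlast (full_flag w))) vs) = 0"
proof -
  let ?f = "\<lambda>i w. basis_elt (del_nth i (butlast (full_flag w)))"
  have zero: "alt m (?f i) vs = 0" if "i < m - 1" for i
  proof (rule alt_symmetric_eq_0)
    fix p q :: "'b list" and a b assume p: "length p = i"
    have "del_nth i (butlast (full_flag (p @ a # b # q))) =
      map (\<lambda>k. span (set (take k (p @ a # b # q)))) (del_nth i [1..<length (p @ a # b # q)])" for a b q
      unfolding butlast_full_flag by (simp add: del_nth_def take_map drop_map del: upt_Suc)
    moreover have "set (take k (p @ a # b # q)) = set (take k (p @ b # a # q))"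
      if "k \<in> set (del_nth i [1..<length (p @ a # b # q)])" for k
    proof -
      have "k \<noteq> Suc i" using that p by (auto simp: del_nth_def take_upt drop_upt simp del: upt_Suc)
      then consider "k \<le> i" | "k \<ge> Suc (Suc i)" by linarith
      then show ?thesis
      proof cases
        case 2
        then obtain l where "k = i + Suc (Suc l)" by (metis add_Suc_right le_iff_add add_Suc)
        then show ?thesis using p by auto
      qed (use p in auto)
    qed
    ultimately show "?f i (p @ a # b # q) = ?f i (p @ b # a # q)"
      by (simp cong: map_cong)
  qed (use that in simp)
  have "tits_bd (alt m (\<lambda>w. basis_elt (butlast (full_flag w))) vs)
    = alt m (\<lambda>w. tits_bd (basis_elt (butlast (full_flag w)))) vs"
    unfolding tits_bd_def by (rule alt_linear[OF qlinear_lin_ext])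
  also have "\<dots> = alt m (\<lambda>w. \<Sum>i<m - 1. qscale ((-1) ^ i) (?f i w)) vs"
    by (rule alt_cong[OF assms]) (auto simp: tits_bd_def assms[symmetric] dest!: mset_eq_length)
  also have "\<dots> = (\<Sum>i<m - 1. qscale ((-1) ^ i) (alt m (?f i) vs))"
  proof -
    have "alt k (\<lambda>w. \<Sum>i\<in>S. qscale ((-1) ^ i) (h i w)) us = (\<Sum>i\<in>S. qscale ((-1) ^ i) (alt k (h i) us))"
      if "finite S" for k h us and S :: "nat set"
    proof (induction k arbitrary: h us)
      case (Suc k)
      have "asum (\<lambda>y r. \<Sum>i\<in>S. qscale ((-1) ^ i) (F i y r)) us
          = (\<Sum>i\<in>S. qscale ((-1) ^ i) (asum (F i) us))" for F
        by (induction us arbitrary: F) (simp_all add: sum_subtractf rat_free.scale_right_diff_distrib)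
      then show ?case by (simp add: Suc)
    qed simp
    from this[of "{..<m - 1}" m ?f vs] show ?thesis by simp
  qed
  also have "\<dots> = 0" by (rule sum.neutral) (simp add: zero)
  finally show ?thesis .
qed

end

section \<open>Relations among apartments of V\<close>

locale fd_correlator_space = correlator_space +
  fixes n :: nat
  assumes n_pos: "n \<ge> 1" and dim_UNIV: "dim UNIV = n"
begin

lemma ex_basis: "\<exists>B. finite B \<and> independent B \<and> span B = UNIV \<and> card B = n"
proof -
  obtain B where B: "independent B" "span B = UNIV" "card B = n"
    using dim_UNIV basis_exists[of UNIV] by (metis UNIV_eq_I subset_UNIV top.extremum_uniqueI)
  moreover have "finite B" using B(3) n_pos by (simp add: card_ge_0_finite)
  ultimately show ?thesis by blast
qed

lemma basis_list_iff: "basis_list vs \<longleftrightarrow> indep_list vs \<and> length vs = n"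
proof -
  obtain B where B: "finite B" "independent B" "span B = UNIV" "card B = n" using ex_basis by blast
  obtain bs where bs: "set bs = B" "distinct bs" using finite_distinct_list[OF B(1)] by blast
  have ib: "indep_list bs" "length bs = n"
    using B bs distinct_card[OF bs(2)] by (auto simp: indep_list_def)
  have le: "length vs \<le> n" if "indep_list vs"
    using independent_span_bound[OF B(1), of "set vs"] that B by (auto simp: indep_list_def distinct_card)
  show ?thesis
  proof
    assume vs: "basis_list vs"
    then have i: "indep_list vs" and s: "span (set vs) = UNIV" by (auto simp: basis_list_def)
    have "card B \<le> card (set vs)"
      using independent_span_bound[of "set vs" B] B(2) s by auto
    then have "n \<le> length vs" using B(4) card_length[of vs] by simp
    then show "indep_list vs \<and> length vs = n" using le i by auto
  next
    assume vs: "indep_list vs \<and> length vs = n"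
    then have "span (set bs) = span (set vs)"
      using indep_list_exchange[of vs bs] ib bs B by auto
    then show "basis_list vs" using vs bs B by (simp add: basis_list_def)
  qed
qed

lemma apartment_eq_flag_class:
  "length vs = n \<Longrightarrow> apartment vs = lin_ext (\<lambda>\<sigma>. basis_elt (butlast \<sigma>)) (flag_class vs)"
  by (simp add: apartment_eq_alt flag_class_def basis_list_iff alt_linear[OF qlinear_lin_ext])

lemma apartment_wrong_length: "length vs \<noteq> n \<Longrightarrow> apartment vs = 0"
  by (simp add: apartment_def basis_list_iff)

lemma asum_apartment_eq_0:
  assumes "length vs = Suc n" "0 \<notin> set vs"
  shows "asum (\<lambda>_. apartment) vs = 0"
proof -
  have "asum (\<lambda>_. apartment) vs = asum (\<lambda>_ r. lin_ext (\<lambda>\<sigma>. basis_elt (butlast \<sigma>)) (flag_class r)) vs"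
    by (rule asum_cong, rule apartment_eq_flag_class) (use assms in simp)
  also have "\<dots> = lin_ext (\<lambda>\<sigma>. basis_elt (butlast \<sigma>)) (asum (\<lambda>_. flag_class) vs)"
    by (simp add: asum_linear[OF qlinear_lin_ext])
  also have "asum (\<lambda>_. flag_class) vs = 0"
  proof (rule asum_flag_class_dependent[OF assms(2)])
    show "\<not> indep_list vs"
    proof
      assume *: "indep_list vs"
      obtain v ws where vs: "vs = v # ws" using assms(1) by (cases vs) auto
      have "basis_list ws" using * assms(1) vs by (simp add: basis_list_iff indep_list_Cons)
      then show False using * vs by (simp add: basis_list_def indep_list_Cons)
    qed
  qed
  finally show ?thesis by simp
qed

lemma asum_proj_along_eq_0:
  assumes "length ps = Suc n" "length (filter (\<lambda>p. snd p \<noteq> 0) ps) \<ge> 2"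
  shows "asum (\<lambda>p r. if snd p \<noteq> 0 then apartment (map (proj_along p) r) else 0) ps = 0"
proof -
  let ?T = "lin_ext (\<lambda>\<sigma>. basis_elt (butlast \<sigma>))"
  have "asum (\<lambda>p r. if snd p \<noteq> 0 then apartment (map (proj_along p) r) else 0) ps
      = asum (\<lambda>p r. ?T (if snd p \<noteq> 0 then flag_class (map (proj_along p) r) else 0)) ps"
    by (rule asum_cong) (use assms(1) in \<open>auto simp: apartment_eq_flag_class\<close>)
  also have "\<dots> = ?T (proj_sum ps)" by (simp add: proj_sum_def asum_linear[OF qlinear_lin_ext])
  finally show ?thesis using proj_sum_eq_0[OF assms(2)] by simp
qed

text \<open>Give every point the value 1: projecting along a point is then subtracting it.\<close>

lemma asum_star_eq_0:
  assumes "length us = Suc n"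
  shows "asum (\<lambda>y r. apartment (star y r)) us = 0"
proof -
  have "length (filter (\<lambda>p. snd p \<noteq> 0) (map (\<lambda>u. (u, 1 :: 'a)) us)) \<ge> 2"
    using assms n_pos by (subst filter_True) auto
  from asum_proj_along_eq_0[OF _ this]
  have "asum (\<lambda>p r. if snd p \<noteq> 0 then apartment (map (proj_along p) r) else 0)
      (map (\<lambda>u. (u, 1 :: 'a)) us) = 0" using assms by simp
  moreover have "asum (\<lambda>p r. if snd p \<noteq> 0 then apartment (map (proj_along p) r) else 0)
      (map (\<lambda>u. (u, 1 :: 'a)) us) = asum (\<lambda>y r. apartment (star y r)) us"
    unfolding asum_map by (rule asum_cong) (simp add: comp_def proj_along_def star_def)
  ultimately show ?thesis by simp
qed

text \<open>The projection relation for 0, \<open>a\<close>, \<open>b\<close> with value 1. The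
  entries of \<open>X\<close> and \<open>Y\<close> have value 0, so no projection is along them and
  none moves them.\<close>

lemma apartment_three_term:
  "apartment (X @ a # b # Y) = apartment (X @ a # (b - a) # Y) - apartment (X @ b # (a - b) # Y)"
proof (cases "length (X @ a # b # Y) = n")
  case True
  let ?X = "map (\<lambda>x. (x, 0 :: 'a)) X" and ?Y = "map (\<lambda>x. (x, 0 :: 'a)) Y"
  let ?ps = "?X @ [(0, 1 :: 'a), (a, 1), (b, 1)] @ ?Y"
  let ?F = "\<lambda>p r. if snd p \<noteq> 0 then apartment (map (proj_along p) r) else 0"
  have zero: "asum (\<lambda>y r. if snd y \<noteq> 0 then G y r else 0) (map (\<lambda>x. (x, 0)) W) = 0"
    for G :: "'b \<times> 'a \<Rightarrow> ('b \<times> 'a) list \<Rightarrow> ('b set list \<Rightarrow>\<^sub>0 rat)" and W :: "'b list"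
    by (rule asum_eq_0) (auto simp: map_eq_append_conv)
  have id: "map (proj_along (x, 1) \<circ> (\<lambda>x. (x, 0))) Z = Z" for x Z
    by (simp add: proj_along_def comp_def)
  have "asum ?F ?ps = 0" by (rule asum_proj_along_eq_0) (use True in auto)
  then have "asum (\<lambda>y r. ?F y (?X @ r)) ([(0, 1), (a, 1), (b, 1)] @ ?Y) = 0"
    by (simp only: asum_append[of _ ?X] zero) simp
  then have "apartment (X @ a # b # Y) - (apartment (X @ (- a) # (b - a) # Y) - apartment (X @ (- b) # (a - b) # Y)) = 0"
    by (simp only: asum_append[of _ "[_, _, _]"] zero asum.simps append_Cons append_Nil map_append
        list.map map_map id snd_conv) (simp add: proj_along_def)
  moreover have neg: "apartment (X @ (- x) # Z) = apartment (X @ x # Z)" for x Z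
  proof (rule apartment_proportional)
    have "list_all2 proportional X X" "list_all2 proportional Z Z"
      by (rule list.rel_refl, rule exI[of _ 1], simp)+
    then show "list_all2 proportional (X @ - x # Z) (X @ x # Z)"
      by (intro list_all2_appendI list.rel_intros exI[of _ "-1"]) auto
  qed
  ultimately show ?thesis by simp
qed (simp add: apartment_wrong_length)

lemma apartment_in_Steinberg: "apartment vs \<in> Steinberg"
proof (cases "basis_list vs")
  case False
  then show ?thesis
    by (simp add: apartment_def Steinberg_def rat_free.subspace_0[OF free_on_subspace] tits_bd_def)
next
  case True
  then have ind: "indep_list vs" and len: "length vs = n" and sp: "span (set vs) = UNIV"
    unfolding basis_list_iff by (blast, blast) (use True in \<open>simp add: basis_list_def\<close>)
  let ?S = "free_on {\<sigma>. tits_simplex \<sigma> \<and> length \<sigma> = dim UNIV - 1}"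
  have "alt n (\<lambda>w. basis_elt (butlast (full_flag w))) vs \<in> ?S"
  proof -
    have simplex: "tits_simplex (butlast (full_flag w))" if w: "mset w = mset vs" for w
    proof -
      have iw: "indep_list w" using w ind indep_list_mset by blast
      have bw: "basis_list w" using w True basis_list_mset by blast
      have nin: "w ! k \<notin> span (set (take k w))" if "k < length w" for k
      proof -
        have "indep_list (take k w @ w ! k # drop (Suc k) w)" using iw id_take_nth_drop[OF that] by argo
        moreover have "span (set (take k w)) \<subseteq> span (set (take k w @ drop (Suc k) w))"
          by (rule span_mono) simp
        ultimately show ?thesis unfolding indep_list_insert by blast
      qed
      have strict: "span (set (take i w)) \<subset> span (set (take j w))" if "i < j" "j \<le> length w" for i j
      proof -
        have "w ! i \<in> set (take j w)" using that by (auto simp: in_set_conv_nth intro!: exI[of _ i])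
        moreover have "span (set (take i w)) \<subseteq> span (set (take j w))"
          using that by (intro span_mono set_take_subset_set_take) simp
        moreover have "w ! i \<notin> span (set (take i w))" using nin that by simp
        moreover have "w ! i \<in> span (set (take j w))"
          using \<open>w ! i \<in> set (take j w)\<close> by (rule span_base)
        ultimately show ?thesis by auto
      qed
      have top: "span (set (take (length w) w)) = UNIV" using bw by (simp add: basis_list_def)
      have "sorted_wrt (\<subset>) (map (\<lambda>k. span (set (take k w))) [1..<length w])"
        unfolding sorted_wrt_map
        by (rule sorted_wrt_mono_rel[OF _ sorted_wrt_upt]) (auto intro!: strict)
      moreover have "span (set (take k w)) \<noteq> {0} \<and> span (set (take k w)) \<noteq> UNIV"
        if "1 \<le> k" "k < length w" for k
      proof
        have "span (set (take 0 w)) \<subset> span (set (take k w))" by (rule strict) (use that in auto)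
        then show "span (set (take k w)) \<noteq> {0}" by auto
        have "span (set (take k w)) \<subset> span (set (take (length w) w))" by (rule strict) (use that in auto)
        then show "span (set (take k w)) \<noteq> UNIV" unfolding top by auto
      qed
      ultimately show ?thesis unfolding tits_simplex_def butlast_full_flag by auto
    qed
    have gen: "alt k f us \<in> ?S" if "length us = k" "\<And>w. mset w = mset us \<Longrightarrow> f w \<in> ?S" for k f and us :: "'b list"
      using that
    proof (induction k arbitrary: f us)
      case (Suc k)
      show ?case unfolding alt.simps
      proof (rule asum_in_subspace[OF free_on_subspace])
        fix xs y ys assume us: "us = xs @ y # ys"
        show "alt k (\<lambda>w. f (y # w)) (xs @ ys) \<in> ?S"
        proof (rule Suc.IH)
          show "length (xs @ ys) = k" using Suc.prems(1) us by simp
          fix w assume "mset w = mset (xs @ ys)"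
          then show "f (y # w) \<in> ?S" using us by (intro Suc.prems(2)) simp
        qed
      qed
    next
      case 0
      have "f us \<in> ?S" by (rule 0(2)) (rule refl)
      then show ?case using 0(1) by (simp only: length_0_conv alt.simps)
    qed
    show ?thesis
    proof (rule gen[OF len])
      fix w assume w: "mset w = mset vs"
      then have "length w = n" using len mset_eq_length by blast
      then have "length (butlast (full_flag w)) = dim UNIV - 1" by (simp only: length_butlast length_full_flag dim_UNIV)
      then show "basis_elt (butlast (full_flag w)) \<in> ?S" using simplex[OF w] by (simp only: basis_elt_in_free_on mem_Collect_eq)
    qed
  qed
  then show ?thesis
    using tits_bd_alt_flag[OF len] True unfolding Steinberg_def apartment_eq_alt len by simp
qed

lemma C_rep_in_Steinberg2: "C_rep u \<in> Steinberg2"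
  unfolding C_rep_def Let_def Steinberg2_def
  by (rule tensor_in_tensor_space[OF apartment_in_Steinberg apartment_in_Steinberg])

end

section \<open>Shuffle and cyclic symmetry of correlator classes\<close>

lemma rev_in_shuffles:
  assumes "set xs \<inter> set ys = {}" "zs \<in> shuffles xs ys"
  shows "rev zs \<in> shuffles (rev xs) (rev ys)"
  using partition_in_shuffles[of "rev zs" "\<lambda>x. x \<in> set xs"] filter_shuffles_disjoint1[OF assms]
  by (simp add: rev_filter[symmetric])

lemma sum_shuffles_rev:
  assumes "set xs \<inter> set ys = {}"
  shows "(\<Sum>zs\<in>shuffles xs ys. f (rev zs)) = (\<Sum>zs\<in>shuffles (rev xs) (rev ys). f zs)"
  using rev_in_shuffles[OF assms] rev_in_shuffles[of "rev xs" "rev ys"] assms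
  by (intro sum.reindex_bij_witness[of _ rev rev]) auto

lemma sum_shuffles_Cons:
  fixes f :: "'x list \<Rightarrow> 'c::comm_monoid_add"
  assumes "x \<noteq> y"
  shows "(\<Sum>zs\<in>shuffles (x # xs) (y # ys). f zs)
    = (\<Sum>zs\<in>shuffles xs (y # ys). f (x # zs)) + (\<Sum>zs\<in>shuffles (x # xs) ys. f (y # zs))"
proof -
  have "(#) x ` shuffles xs (y # ys) \<inter> (#) y ` shuffles (x # xs) ys = {}" using assms by auto
  then show ?thesis
    by (simp add: sum.union_disjoint sum.reindex)
qed

context correlator_space
begin

lemma path_edges_in_subspace:
  assumes "subspace S" "\<And>v. v \<in> set (x # vs) \<Longrightarrow> v - z \<in> S"
  shows "set (path_edges x vs) \<subseteq> S"
  using assms(2)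
proof (induction vs arbitrary: x)
  case (Cons v vs)
  have "v - x = (v - z) - (x - z)" by simp
  then have "v - x \<in> S" using subspace_diff[OF assms(1), of "v - z" "x - z"] Cons.prems by simp
  moreover have "set (path_edges v vs) \<subseteq> S" by (rule Cons.IH) (use Cons.prems in simp)
  ultimately show ?case by simp
qed simp

lemma path_edges_in_span_star: "set (path_edges z vs) \<subseteq> span (set (star z vs))"
proof (rule path_edges_in_subspace[OF subspace_span])
  fix v assume "v \<in> set (z # vs)"
  then show "v - z \<in> span (set (star z vs))"
    by (auto simp: star_def span_zero intro: span_base)
qed

lemma path_edges_eq_append:
  "path_edges x vs = es @ e # fs \<Longrightarrow>
    \<exists>ps q qs. vs = ps @ q # qs \<and> es = path_edges x ps \<and> fs = path_edges q qs"
proof (induction vs arbitrary: x es)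
  case (Cons v vs)
  show ?case
  proof (cases es)
    case Nil
    then show ?thesis using Cons.prems by (intro exI[of _ "[]"]) auto
  next
    case (Cons a es')
    then have "path_edges v vs = es' @ e # fs" using Cons.prems by simp
    from Cons.IH[OF this] obtain ps q qs
      where "vs = ps @ q # qs" "es' = path_edges v ps" "fs = path_edges q qs" by blast
    then show ?thesis using Cons Cons.prems by (intro exI[of _ "v # ps"]) auto
  qed
qed simp

lemma path_edges_nonzero: "distinct (x # vs) \<Longrightarrow> 0 \<notin> set (path_edges x vs)"
  by (induction vs arbitrary: x) auto

end

context fd_correlator_space
begin

text \<open>The factors are changed one after the other. In the star relation for the points of the
  path, the star at an inner point \<open>y\<close> is decomposable against the path, as both split
  at \<open>y\<close>. This replaces the star at \<open>x\<close> by the star at \<open>z\<close>.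
  In the Steinberg relation for the edges of the closed polygon through \<open>z\<close>,
  \<open>x\<close> and \<open>ts\<close>, omitting an inner edge again splits both factors; this
  replaces the path ending in \<open>z\<close> by the path starting there. The signs (-1)^(length
  ts) of the two replacements cancel.\<close>

lemma C_path_cyclic:
  assumes len: "length (ts @ [z]) = n" and dist: "distinct (x # ts @ [z])"
  shows "C_path x (ts @ [z]) - C_path z (x # ts) \<in> decomposables"
proof -
  let ?s = "(-1 :: rat) ^ length ts"
  let ?P = "apartment (path_edges x (ts @ [z]))" and ?S = "apartment (star z (x # ts))"
  let ?M1 = "asum (\<lambda>y r. tensor (apartment (star y (x # r @ [z]))) ?P) ts"
  let ?e = "z - last (x # ts)"
  let ?M2 = "asum (\<lambda>_ r. tensor ?S (apartment ((x - z) # r @ [?e]))) (path_edges x ts)"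
  have M1: "?M1 \<in> decomposables"
  proof (rule asum_in_subspace[OF decomposables_subspace])
    fix as y bs assume ts: "ts = as @ y # bs"
    have "tensor (apartment (star y (x # as) @ star y (bs @ [z])))
        (apartment (path_edges x (as @ [y]) @ path_edges y (bs @ [z]))) \<in> decomposables"
    proof (rule tensor_in_decomposables)
      show "set (path_edges x (as @ [y])) \<subseteq> span (set (star y (x # as)))"
        by (rule path_edges_in_subspace[OF subspace_span, of _ _ y])
           (auto simp: star_def span_zero intro: span_base)
      show "set (path_edges y (bs @ [z])) \<subseteq> span (set (star y (bs @ [z])))"
        by (rule path_edges_in_span_star)
    qed auto
    moreover have "path_edges x (ts @ [z]) = path_edges x (as @ [y]) @ path_edges y (bs @ [z])"
      unfolding ts by simp
    moreover have "star y (x # (as @ bs) @ [z]) = star y (x # as) @ star y (bs @ [z])" by simp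
    ultimately show "tensor (apartment (star y (x # (as @ bs) @ [z]))) ?P \<in> decomposables" by metis
  qed
  have M2: "?M2 \<in> decomposables"
  proof (rule asum_in_subspace[OF decomposables_subspace])
    fix es e fs assume "path_edges x ts = es @ e # fs"
    then obtain as q bs where ts: "ts = as @ q # bs" "es = path_edges x as" "fs = path_edges q bs"
      using path_edges_eq_append by blast
    have "tensor (apartment (star z (x # as) @ star z (q # bs)))
        (apartment (path_edges z (x # as) @ path_edges q (bs @ [z]))) \<in> decomposables"
    proof (rule tensor_in_decomposables)
      show "set (path_edges q (bs @ [z])) \<subseteq> span (set (star z (q # bs)))"
        by (rule path_edges_in_subspace[OF subspace_span, of _ _ z])
           (auto simp: star_def span_zero intro: span_base)
      show "set (path_edges z (x # as)) \<subseteq> span (set (star z (x # as)))"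
        by (rule path_edges_in_span_star)
    qed auto
    then show "tensor ?S (apartment ((x - z) # (es @ fs) @ [?e])) \<in> decomposables"
      unfolding ts by simp
  qed
  have "asum (\<lambda>y r. tensor (apartment (star y r)) ?P) (x # ts @ [z]) = 0"
    using asum_linear[OF qlinear_tensor_left, of "\<lambda>y r. apartment (star y r)" "x # ts @ [z]" ?P]
      asum_star_eq_0[of "x # ts @ [z]"] len by simp
  then have 1: "C_path x (ts @ [z]) - (?M1 + qscale ?s (tensor ?S ?P)) = 0"
    unfolding asum.simps asum_append C_path_def by simp
  have "asum (\<lambda>_. apartment) ((x - z) # path_edges x (ts @ [z])) = 0"
    using path_edges_nonzero[OF dist] dist len by (intro asum_apartment_eq_0) auto
  then have "asum (\<lambda>_ r. tensor ?S (apartment r)) ((x - z) # path_edges x ts @ [?e]) = 0"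
    using asum_linear[OF qlinear_tensor_right, of ?S "\<lambda>_. apartment" "(x - z) # path_edges x ts @ [?e]"]
    by simp
  then have 2: "tensor ?S (apartment (path_edges x ts @ [?e])) -
      (?M2 + qscale ?s (C_path z (x # ts))) = 0"
    unfolding asum.simps asum_append C_path_def by simp
  have "C_path x (ts @ [z]) = ?M1 + qscale ?s (?M2 + qscale ?s (C_path z (x # ts)))"
    using 1 2 by simp
  then have "C_path x (ts @ [z]) - C_path z (x # ts) = ?M1 + qscale ?s ?M2"
    by (simp only: rat_free.scale_right_distrib qscale_sign_sign) simp
  then show ?thesis using M1 M2 decomposables_subspace
    by (simp only: rat_free.subspace_add rat_free.subspace_scale)
qed

text \<open>\<open>A\<close> and \<open>B\<close> hold the vectors already placed, \<open>y\<close>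
  is the point reached. By induction the shuffles beginning with \<open>v\<close> or with
  \<open>w\<close> add up to a path that forks at that point; the three-term relation for v - y and
  w - y merges the two forks into one at \<open>y\<close>.\<close>

lemma sum_shuffles_star_path:
  assumes "set ps \<inter> set qs = {}"
  shows "(\<Sum>rs\<in>shuffles ps qs. tensor (apartment (A @ star x rs)) (apartment (B @ path_edges y rs)))
    = tensor (apartment (A @ star x (ps @ qs))) (apartment (B @ path_edges y ps @ path_edges y qs))"
  using assms
proof (induction ps qs arbitrary: A B y rule: shuffles.induct)
  case (3 v ps w qs)
  let ?X = "path_edges v ps" and ?Y = "path_edges w qs" and ?s = "(-1 :: rat) ^ length ps"
  let ?A = "apartment (A @ (v - x) # star x ps @ (w - x) # star x qs)"
  have vw: "v \<noteq> w" using 3(3) by auto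
  have 1: "(\<Sum>rs\<in>shuffles ps (w # qs). tensor (apartment (A @ star x (v # rs))) (apartment (B @ path_edges y (v # rs))))
      = tensor ?A (apartment (B @ (v - y) # ?X @ (w - v) # ?Y))"
    using 3(1)[of "A @ [v - x]" "B @ [v - y]" v] 3(3) by simp
  have 2: "(\<Sum>rs\<in>shuffles (v # ps) qs. tensor (apartment (A @ star x (w # rs))) (apartment (B @ path_edges y (w # rs))))
      = tensor (apartment (A @ (w - x) # ((v - x) # star x ps) @ star x qs)) (apartment (B @ (w - y) # (v - w) # ?X @ ?Y))"
    using 3(2)[of "A @ [w - x]" "B @ [w - y]" w] 3(3) by simp
  have 3: "apartment (A @ (w - x) # ((v - x) # star x ps) @ star x qs) = qscale (- ?s) ?A"
    unfolding apartment_move[of A "w - x"] by simp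
  have 4: "apartment (B @ (v - y) # ?X @ u # ?Y) = qscale ?s (apartment (B @ (v - y) # u # ?X @ ?Y))" for u
  proof -
    have "apartment (B @ (v - y) # u # ?X @ ?Y) = qscale ?s (apartment (B @ (v - y) # ?X @ u # ?Y))"
      using apartment_move[of "B @ [v - y]" u ?X ?Y] by simp
    then show ?thesis by simp
  qed
  have 5: "apartment (B @ (v - y) # (w - v) # ?X @ ?Y)
      = apartment (B @ (v - y) # (w - y) # ?X @ ?Y) + apartment (B @ (w - y) # (v - w) # ?X @ ?Y)"
    using apartment_three_term[of B "v - y" "w - y" "?X @ ?Y"] by simp
  show ?case
    unfolding sum_shuffles_Cons[OF vw] 1 2 3 4 5
    by (simp add: 4 5 tensor_scale_left tensor_scale_right rat_free.scale_right_distrib tensor_add_right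
        tensor_minus_left)
qed simp_all

text \<open>The fork produced by the shuffles sits at \<open>x\<close>, the centre of the star, so
  both factors split into the part of \<open>p\<close> and the part of \<open>q\<close>.\<close>

lemma C_rep_shuffle:
  assumes "set p \<inter> set q = {}" "p \<noteq> []" "q \<noteq> []"
  shows "(\<Sum>w\<in>shuffles p q. C_rep (x # w)) \<in> decomposables"
proof -
  have "(\<Sum>w\<in>shuffles p q. C_rep (x # w)) = (\<Sum>w\<in>shuffles p q. C_path x (rev w))"
    using assms by (intro sum.cong refl C_rep_eq_C_path) auto
  also have "\<dots> = (\<Sum>w\<in>shuffles (rev p) (rev q). C_path x w)"
    by (rule sum_shuffles_rev[OF assms(1)])
  also have "\<dots> = tensor (apartment (star x (rev p) @ star x (rev q)))
      (apartment (path_edges x (rev p) @ path_edges x (rev q)))"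
    using sum_shuffles_star_path[of "rev p" "rev q" "[]" x "[]" x] assms(1) by (simp add: C_path_def)
  also have "\<dots> \<in> decomposables"
    by (rule tensor_in_decomposables[OF _ _ _ _ path_edges_in_span_star path_edges_in_span_star])
       (use assms in \<open>auto simp: star_def\<close>)
  finally show ?thesis .
qed

end

section \<open>Words attached to a pair of bases\<close>

context correlator_space
begin

text \<open>In contrast to \<open>proj_along\<close>, the target \<open>P\<close> is prescribed and
  not the kernel of a functional. The coefficient chosen by \<open>SOME\<close> is unique when
  \<open>P\<close> is a subspace, \<open>y\<close> lies outside it and \<open>z\<close> lies in the
  span of \<open>y\<close> and \<open>P\<close>.\<close>

definition proj_span :: "'b set \<Rightarrow> 'b \<Rightarrow> 'b \<Rightarrow> 'b" where
  "proj_span P y z = z - (SOME c. z - c *s y \<in> P) *s y"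

lemma proj_span_eq:
  assumes "subspace P" "y \<notin> P" "z - c *s y \<in> P"
  shows "proj_span P y z = z - c *s y"
proof -
  have "d = c" if "z - d *s y \<in> P" for d
  proof (rule ccontr)
    assume "d \<noteq> c"
    have "(z - c *s y) - (z - d *s y) \<in> P" using assms(1,3) that by (rule subspace_diff)
    moreover have "(z - c *s y) - (z - d *s y) = (d - c) *s y" by (simp add: scale_left_diff_distrib)
    ultimately have "inverse (d - c) *s ((d - c) *s y) \<in> P" using subspace_scale[OF assms(1)] by metis
    moreover have "inverse (d - c) *s ((d - c) *s y) = y" using \<open>d \<noteq> c\<close> by simp
    ultimately show False using assms(2) by metis
  qed
  then have "(SOME c. z - c *s y \<in> P) = c" using assms(3) by blast
  then show ?thesis by (simp add: proj_span_def)
qed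

lemma proj_span_in:
  assumes "subspace P" "y \<notin> P" "z \<in> span (insert y P)"
  shows "proj_span P y z \<in> P"
proof -
  obtain c where "z - c *s y \<in> span P" using assms(3) by (auto simp: span_breakdown_eq)
  then have "z - c *s y \<in> P" using assms(1) span_eq_iff by blast
  then show ?thesis using proj_span_eq[OF assms(1,2)] by simp
qed

lemma proj_span_id: "subspace P \<Longrightarrow> y \<notin> P \<Longrightarrow> z \<in> P \<Longrightarrow> proj_span P y z = z"
  using proj_span_eq[of P y z 0] by simp

abbreviation cons_letter :: "'c \<Rightarrow> ('c list \<Rightarrow>\<^sub>0 rat) \<Rightarrow> ('c list \<Rightarrow>\<^sub>0 rat)" where
  "cons_letter v \<equiv> lin_ext (\<lambda>w. basis_elt (v # w))"

text \<open>Letters are collected from the last to the first, so the words occurring here are the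
  reverses of those of the paper.\<close>

primrec opp_words :: "('b \<Rightarrow> 'a) \<Rightarrow> nat \<Rightarrow> 'b list \<Rightarrow> 'b list \<Rightarrow> ('b list \<Rightarrow>\<^sub>0 rat)" where
  "opp_words h 0 a b = basis_elt []"
| "opp_words h (Suc k) a b = asum (\<lambda>x r. asum (\<lambda>y t.
     if y \<notin> span (set r) \<and> h y \<noteq> 0
     then cons_letter (inverse (h y) *s y) (opp_words h k r (map (proj_span (span (set r)) y) t))
     else 0) b) a"

lemma span_insert_span: "span (insert y (span S)) = span (insert y S)"
proof (rule span_eq[THEN iffD2], intro conjI)
  have "span S \<subseteq> span (insert y S)" by (rule span_mono) auto
  then show "insert y (span S) \<subseteq> span (insert y S)" by (auto intro: span_base)
  have "insert y S \<subseteq> insert y (span S)" using span_superset by auto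
  then show "insert y S \<subseteq> span (insert y (span S))" using span_superset by blast
qed

lemma indep_list_swap_in:
  assumes "indep_list (as @ x # bs)" "y \<in> span (set (as @ x # bs))" "y \<notin> span (set (as @ bs))"
  shows "indep_list (y # as @ bs)" "span (insert y (set (as @ bs))) = span (set (as @ x # bs))"
proof -
  show i: "indep_list (y # as @ bs)"
    using assms by (simp add: indep_list_insert indep_list_Cons)
  have "set (y # as @ bs) \<subseteq> span (set (as @ x # bs))" using assms(2) by (auto intro: span_base)
  from indep_list_exchange[OF i this] show "span (insert y (set (as @ bs))) = span (set (as @ x # bs))"
    by simp
qed

text \<open>Each letter lies outside the hyperplane that contains all later ones, so the words are
  independent; \<open>h\<close> is 1 on every letter by the normalisation.\<close>

lemma opp_words_in_free_on:
  assumes "Vector_Spaces.linear scale (*) h" "indep_list a" "set b \<subseteq> span (set a)"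
    "length a = k" "length b = k"
  shows "opp_words h k a b \<in> free_on {w. indep_list w \<and> length w = k \<and> set w \<subseteq> span (set a) \<and> (\<forall>v\<in>set w. h v = 1)}"
  using assms(2-)
proof (induction k arbitrary: a b)
  case (Suc k)
  interpret h: Vector_Spaces.linear scale "(*)" h by (rule assms(1))
  show ?case unfolding opp_words.simps
  proof (intro asum_in_subspace[OF free_on_subspace])
    fix as x bs cs y ds assume a: "a = as @ x # bs" and b: "b = cs @ y # ds"
    let ?r = "as @ bs" and ?F = "free_on {w. indep_list w \<and> length w = Suc k \<and> set w \<subseteq> span (set a) \<and> (\<forall>v\<in>set w. h v = 1)}"
    let ?P = "span (set ?r)"
    show "(if y \<notin> ?P \<and> h y \<noteq> 0 then cons_letter (inverse (h y) *s y)
        (opp_words h k ?r (map (proj_span ?P y) (cs @ ds))) else 0) \<in> ?F"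
    proof (cases "y \<notin> ?P \<and> h y \<noteq> 0")
      case True
      then have y: "y \<notin> ?P" "h y \<noteq> 0" by auto
      have ia: "indep_list (as @ x # bs)" using Suc.prems(1) a by simp
      have ya: "y \<in> span (set (as @ x # bs))" using Suc.prems(2) a b by auto
      note sw = indep_list_swap_in[OF ia ya y(1)]
      have sub: "span (insert y ?P) = span (set a)"
        using sw(2) a by (simp add: span_insert_span)
      have w: "opp_words h k ?r (map (proj_span ?P y) (cs @ ds))
          \<in> free_on {w. indep_list w \<and> length w = k \<and> set w \<subseteq> ?P \<and> (\<forall>v\<in>set w. h v = 1)}"
      proof (rule Suc.IH)
        show "indep_list ?r" using ia by (simp add: indep_list_insert)
        have "proj_span ?P y z \<in> ?P" if "z \<in> set (cs @ ds)" for z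
          using that Suc.prems(2) b unfolding sub[symmetric]
          by (intro proj_span_in[OF subspace_span y(1)]) auto
        then show "set (map (proj_span ?P y) (cs @ ds)) \<subseteq> ?P" by auto
      qed (use Suc.prems a b in auto)
      have "cons_letter (inverse (h y) *s y) (opp_words h k ?r (map (proj_span ?P y) (cs @ ds))) \<in> ?F"
      proof (rule lin_ext_in_subspace[OF free_on_subspace])
        fix w' assume "w' \<in> Poly_Mapping.keys (opp_words h k ?r (map (proj_span ?P y) (cs @ ds)))"
        then have w': "indep_list w'" "length w' = k" "set w' \<subseteq> ?P" "\<forall>v\<in>set w'. h v = 1"
          using in_free_onD[OF w] by auto
        have "inverse (h y) *s y \<notin> span (set w')"
        proof
          assume "inverse (h y) *s y \<in> span (set w')"
          then have "h y *s (inverse (h y) *s y) \<in> span (set w')" by (rule span_scale)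
          then show False using y span_mono[OF w'(3)] by (auto simp: span_span)
        qed
        moreover have "inverse (h y) *s y \<in> span (set a)" using ya a by (auto intro: span_scale)
        moreover have "?P \<subseteq> span (set a)" unfolding a by (intro span_mono) auto
        ultimately show "basis_elt (inverse (h y) *s y # w') \<in> ?F"
          using w' y(2) by (auto simp: indep_list_Cons h.scale)
      qed
      then show ?thesis by (subst if_P[OF True])
    next
      case False
      then have *: "(if y \<notin> ?P \<and> h y \<noteq> 0 then q else 0) = 0" for q :: "'b list \<Rightarrow>\<^sub>0 rat" by argo
      show ?thesis unfolding * by (rule rat_free.subspace_0[OF free_on_subspace])
    qed
  qed
qed simp

end

section \<open>Pairs of opposite flags\<close>

lemma alt_zero [simp]: "alt k (\<lambda>w. 0) vs = 0"
proof (induction k arbitrary: vs)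
  case (Suc k)
  show ?case unfolding alt.simps by (rule asum_eq_0) (rule Suc)
qed simp

lemma alt_diff: "alt k (\<lambda>w. f w - g w) vs = alt k f vs - alt k g vs"
proof (induction k arbitrary: f g vs)
  case (Suc k)
  have "alt (Suc k) (\<lambda>w. f w - g w) vs
      = asum (\<lambda>y r. alt k (\<lambda>w. f (y # w)) r - alt k (\<lambda>w. g (y # w)) r) vs"
    unfolding alt.simps by (rule asum_cong) (rule Suc.IH)
  then show ?case unfolding asum_diff alt.simps .
qed simp

lemma alt_asum: "alt k (\<lambda>w. asum (\<lambda>y t. G w y t) b) r = asum (\<lambda>y t. alt k (\<lambda>w. G w y t) r) b"
proof (induction b arbitrary: G)
  case (Cons x b)
  show ?case unfolding asum.simps alt_diff using Cons[of "\<lambda>w y t. G w y (x # t)"] by simp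
qed simp

lemma lin_ext_fun_add: "lin_ext (\<lambda>x. f x + g x) p = lin_ext f p + lin_ext g p"
  by (simp add: lin_ext_def rat_free.scale_right_distrib sum.distrib)

text \<open>Shuffles are counted with multiplicity, so that the product is bilinear on words which
  may share letters; \<open>shuffles\<close> is only a set.\<close>

fun shuffle_prod :: "'c list \<Rightarrow> 'c list \<Rightarrow> ('c list \<Rightarrow>\<^sub>0 rat)" where
  "shuffle_prod [] ys = basis_elt ys"
| "shuffle_prod xs [] = basis_elt xs"
| "shuffle_prod (x # xs) (y # ys) =
     lin_ext (\<lambda>w. basis_elt (x # w)) (shuffle_prod xs (y # ys)) +
     lin_ext (\<lambda>w. basis_elt (y # w)) (shuffle_prod (x # xs) ys)"

lemma shuffle_prod_Nil_right [simp]: "shuffle_prod xs [] = basis_elt xs"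
  by (cases xs) auto

lemma shuffle_prod_eq_sum:
  assumes "set xs \<inter> set ys = {}"
  shows "shuffle_prod xs ys = (\<Sum>w\<in>shuffles xs ys. basis_elt w)"
  using assms
proof (induction xs ys rule: shuffle_prod.induct)
  case (3 x xs y ys)
  then have "x \<noteq> y" by auto
  then show ?case using 3 by (simp add: sum_shuffles_Cons lin_ext_sum del: shuffles.simps)
qed simp_all

definition shuffle_mult ::
  "('c list \<Rightarrow>\<^sub>0 rat) \<Rightarrow> ('c list \<Rightarrow>\<^sub>0 rat) \<Rightarrow> ('c list \<Rightarrow>\<^sub>0 rat)" where
  "shuffle_mult p q = lin_ext (\<lambda>v. lin_ext (shuffle_prod v) q) p"

lemma qlinear_shuffle_mult_left: "qlinear (\<lambda>p. shuffle_mult p q)"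
  unfolding shuffle_mult_def by (rule qlinear_lin_ext)

lemma qlinear_shuffle_mult_right: "qlinear (shuffle_mult p)"
  unfolding shuffle_mult_def by (intro qlinear_lin_ext_right qlinear_lin_ext)

lemma shuffle_mult_Nil [simp]:
  "shuffle_mult (basis_elt []) q = q" "shuffle_mult p (basis_elt []) = p"
proof -
  have "shuffle_prod [] = (basis_elt :: 'a list \<Rightarrow> _)" by (rule ext) simp
  then show "shuffle_mult (basis_elt []) q = q" by (simp add: shuffle_mult_def)
  show "shuffle_mult p (basis_elt []) = p" by (simp add: shuffle_mult_def)
qed

section \<open>Direct sums give shuffle products\<close>

context correlator_space
begin

lemma shuffle_mult_cons_letter:
  "shuffle_mult (cons_letter u \<alpha>) (cons_letter v \<beta>) =
     cons_letter u (shuffle_mult \<alpha> (cons_letter v \<beta>)) + cons_letter v (shuffle_mult (cons_letter u \<alpha>) \<beta>)"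
  by (simp add: shuffle_mult_def lin_ext_lin_ext lin_ext_fun_add)

definition opp_term :: "('b \<Rightarrow> 'a) \<Rightarrow> nat \<Rightarrow> 'b list \<Rightarrow> 'b \<Rightarrow> 'b list \<Rightarrow> ('b list \<Rightarrow>\<^sub>0 rat)" where
  "opp_term h k r y t = opp_words h k r (map (proj_span (span (set r)) y) t)"

definition opp_cond :: "('b \<Rightarrow> 'a) \<Rightarrow> 'b list \<Rightarrow> 'b \<Rightarrow> bool" where
  "opp_cond h r y \<longleftrightarrow> y \<notin> span (set r) \<and> h y \<noteq> 0"

lemma opp_words_Suc: "opp_words h (Suc k) a b = asum (\<lambda>x r. asum (\<lambda>y t.
     if opp_cond h r y then cons_letter (inverse (h y) *s y) (opp_term h k r y t) else 0) b) a"
  by (simp only: opp_words.simps opp_term_def opp_cond_def)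

text \<open>The first letter of a shuffle comes from the left or from the right factor; the two sums
  collect these cases.\<close>

lemma shuffle_mult_opp_words:
  "shuffle_mult (opp_words h (Suc p) a b) (opp_words h (Suc q) c d) =
     asum (\<lambda>x r. asum (\<lambda>y t. if opp_cond h r y then cons_letter (inverse (h y) *s y)
         (shuffle_mult (opp_term h p r y t) (opp_words h (Suc q) c d)) else 0) b) a
   + asum (\<lambda>x r. asum (\<lambda>y t. if opp_cond h r y then cons_letter (inverse (h y) *s y)
         (shuffle_mult (opp_words h (Suc p) a b) (opp_term h q r y t)) else 0) d) c"
proof -
  let ?c = "\<lambda>y. cons_letter (inverse (h y) *s y)"
  let ?E = "opp_words h (Suc q) c d"
  \<comment> \<open>The terms of a product with \<open>?E\<close> whose first letter comes from
    \<open>?E\<close>. Being linear in the left factor, they can be collected again into one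
    expression in the whole left factor.\<close>
  let ?U = "\<lambda>p. asum (\<lambda>x r. asum (\<lambda>y t. if opp_cond h r y then ?c y
         (shuffle_mult p (opp_term h q r y t)) else 0) d) c"
  have if_lin: "T (if P then x else 0) = (if P then T x else 0)" if "qlinear T"
    for T :: "('b list \<Rightarrow>\<^sub>0 rat) \<Rightarrow> ('b list \<Rightarrow>\<^sub>0 rat)" and P x
    using that by (simp add: qlinear_0)
  have 1: "shuffle_mult (cons_letter u \<alpha>) ?E = cons_letter u (shuffle_mult \<alpha> ?E) + ?U (cons_letter u \<alpha>)"
    for u \<alpha>
  proof -
    have "shuffle_mult (cons_letter u \<alpha>) ?E = asum (\<lambda>x r. asum (\<lambda>y t. if opp_cond h r y then
        cons_letter u (shuffle_mult \<alpha> (?c y (opp_term h q r y t)))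
        + ?c y (shuffle_mult (cons_letter u \<alpha>) (opp_term h q r y t)) else 0) d) c"
      unfolding opp_words_Suc asum_linear[OF qlinear_shuffle_mult_right]
        if_lin[OF qlinear_shuffle_mult_right] shuffle_mult_cons_letter ..
    also have "\<dots> = asum (\<lambda>x r. asum (\<lambda>y t. (if opp_cond h r y then
        cons_letter u (shuffle_mult \<alpha> (?c y (opp_term h q r y t))) else 0)
        + (if opp_cond h r y then ?c y (shuffle_mult (cons_letter u \<alpha>) (opp_term h q r y t)) else 0)) d) c"
      by (intro asum_cong) simp
    also have "\<dots> = cons_letter u (shuffle_mult \<alpha> ?E) + ?U (cons_letter u \<alpha>)"
      unfolding opp_words_Suc asum_linear[OF qlinear_shuffle_mult_right]
        if_lin[OF qlinear_shuffle_mult_right] asum_linear[OF qlinear_lin_ext]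
        if_lin[OF qlinear_lin_ext] asum_add ..
    finally show ?thesis .
  qed
  have linU: "qlinear ?U"
  proof (rule qlinearI)
    fix p1 p2 :: "'b list \<Rightarrow>\<^sub>0 rat"
    have "?U (p1 + p2) = asum (\<lambda>x r. asum (\<lambda>y t.
        (if opp_cond h r y then ?c y (shuffle_mult p1 (opp_term h q r y t)) else 0) +
        (if opp_cond h r y then ?c y (shuffle_mult p2 (opp_term h q r y t)) else 0)) d) c"
      by (intro asum_cong) (simp add: qlinear_add'[OF qlinear_shuffle_mult_left] lin_ext_add)
    then show "?U (p1 + p2) = ?U p1 + ?U p2" by (simp only: asum_add)
  next
    fix s and p1 :: "'b list \<Rightarrow>\<^sub>0 rat"
    have "?U (qscale s p1) = asum (\<lambda>x r. asum (\<lambda>y t. qscale s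
        (if opp_cond h r y then ?c y (shuffle_mult p1 (opp_term h q r y t)) else 0)) d) c"
      by (intro asum_cong) (simp add: qlinear_scale[OF qlinear_shuffle_mult_left] lin_ext_scale)
    then show "?U (qscale s p1) = qscale s (?U p1)" by (simp only: asum_scale)
  qed
  have "shuffle_mult (opp_words h (Suc p) a b) ?E = asum (\<lambda>x r. asum (\<lambda>y t. if opp_cond h r y then
      shuffle_mult (?c y (opp_term h p r y t)) ?E else 0) b) a"
    unfolding opp_words_Suc[of h p] asum_linear[OF qlinear_shuffle_mult_left]
      if_lin[OF qlinear_shuffle_mult_left] ..
  also have "\<dots> = asum (\<lambda>x r. asum (\<lambda>y t. (if opp_cond h r y then
      ?c y (shuffle_mult (opp_term h p r y t) ?E) else 0)
      + ?U (if opp_cond h r y then ?c y (opp_term h p r y t) else 0)) b) a"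
    unfolding 1 by (intro asum_cong) (simp add: qlinear_0[OF linU])
  also have "\<dots> = asum (\<lambda>x r. asum (\<lambda>y t. if opp_cond h r y then
      ?c y (shuffle_mult (opp_term h p r y t) ?E) else 0) b) a + ?U (opp_words h (Suc p) a b)"
    unfolding asum_add asum_linear[OF linU, symmetric] opp_words_Suc[of h p] ..
  finally show ?thesis .
qed

lemma proj_span_larger:
  assumes "subspace P" "subspace Q" "P \<subseteq> Q" "y \<notin> Q" "z \<in> span (insert y P)"
  shows "proj_span Q y z = proj_span P y z"
proof -
  obtain c where "z - c *s y \<in> span P" using assms(5) by (auto simp: span_breakdown_eq)
  then have c: "z - c *s y \<in> P" using assms(1) span_eq_iff by blast
  have "y \<notin> P" using assms(3,4) by auto
  then show ?thesis
    using proj_span_eq[OF assms(1) _ c] proj_span_eq[OF assms(2,4)] c assms(3) by auto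
qed

text \<open>\<open>Q\<close> spans a hyperplane of the first summand together with the whole second
  summand \<open>c\<close>. As the sum is direct, splitting off a line \<open>y\<close> of the first
  summand takes place inside it and does not touch the second. These are the facts that make the two
  recursions independent of each other.\<close>

lemma proj_span_complement:
  assumes "indep_list ((as @ x # as') @ c)" "y \<in> span (set (as @ x # as'))"
    "set Q = set (as @ as') \<union> set c"
  shows "y \<in> span (set Q) \<longleftrightarrow> y \<in> span (set (as @ as'))"
    and "y \<notin> span (set Q) \<Longrightarrow> z \<in> span (set (as @ x # as')) \<Longrightarrow>
      proj_span (span (set Q)) y z = proj_span (span (set (as @ as'))) y z"
    and "y \<notin> span (set Q) \<Longrightarrow> z \<in> span (set c) \<Longrightarrow> proj_span (span (set Q)) y z = z"
    and "y \<notin> span (set Q) \<Longrightarrow> z \<in> span (set (as @ x # as')) \<Longrightarrow>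
      proj_span (span (set (as @ as'))) y z \<in> span (set (as @ as'))"
proof -
  let ?r = "as @ as'" and ?a = "as @ x # as'"
  have ia: "indep_list ?a" by (rule indep_list_appendD1[OF assms(1)])
  have mono: "span (set ?r) \<subseteq> span (set Q)" "span (set c) \<subseteq> span (set Q)"
    unfolding assms(3) by (intro span_mono; simp)+
  have "y \<notin> span (set Q)" if y: "y \<notin> span (set ?r)"
  proof -
    note sw = indep_list_swap_in[OF ia assms(2) y]
    have "set (?a @ c) \<subseteq> span (set ((y # ?r) @ c))"
    proof -
      have "set ?a \<subseteq> span (insert y (set ?r))" unfolding sw(2) by (rule span_superset)
      also have "\<dots> \<subseteq> span (set ((y # ?r) @ c))" by (rule span_mono) auto
      finally show ?thesis using span_superset[of "set ((y # ?r) @ c)"] by simp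
    qed
    from indep_list_exchange[OF assms(1) this] have "indep_list (y # ?r @ c)" by simp
    then show ?thesis using assms(3) by (simp add: indep_list_Cons Un_assoc)
  qed
  then show iff: "y \<in> span (set Q) \<longleftrightarrow> y \<in> span (set ?r)" using mono(1) by blast
  assume yQ: "y \<notin> span (set Q)"
  then have yr: "y \<notin> span (set ?r)" using iff by blast
  have spa: "span (insert y (span (set ?r))) = span (set ?a)"
    using indep_list_swap_in(2)[OF ia assms(2) yr] unfolding span_insert_span .
  show "proj_span (span (set Q)) y z = z" if "z \<in> span (set c)"
    using that mono(2) by (intro proj_span_id[OF subspace_span yQ]) auto
  assume "z \<in> span (set ?a)"
  then have z: "z \<in> span (insert y (span (set ?r)))" unfolding spa .
  show "proj_span (span (set Q)) y z = proj_span (span (set ?r)) y z"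
    by (rule proj_span_larger[OF subspace_span subspace_span mono(1) yQ z])
  show "proj_span (span (set ?r)) y z \<in> span (set ?r)"
    by (rule proj_span_in[OF subspace_span yr z])
qed

text \<open>Compare first letters. If the deleted \<open>x\<close> and the line \<open>y\<close>
  belong to different summands, then \<open>y\<close> lies in the remaining hyperplane and the term
  is 0. Otherwise one factor advances by one step and the other stays as it is. Deletions in the
  second summand carry the signs (-1)^(length a) and (-1)^(length b), which cancel since the lengths
  agree.\<close>

lemma opp_words_append:
  assumes "indep_list (a @ c)" "length a = p" "length b = p" "length c = q" "length d = q"
    "set b \<subseteq> span (set a)" "set d \<subseteq> span (set c)"
  shows "opp_words h (p + q) (a @ c) (b @ d) = shuffle_mult (opp_words h p a b) (opp_words h q c d)"
  using assms
proof (induction "p + q" arbitrary: p q a b c d)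
  case (Suc N)
  show ?case
  proof (cases "p = 0 \<or> q = 0")
    case True
    then show ?thesis using Suc.prems by auto
  next
    case False
    then obtain p' q' where pq: "p = Suc p'" "q = Suc q'" by (metis not0_implies_Suc)
    let ?c = "\<lambda>y. cons_letter (inverse (h y) *s y)"
    let ?t = "\<lambda>r y t. if opp_cond h r y then ?c y (opp_term h N r y t) else 0"
    have N: "N = p' + q" "N = p + q'" "p + q = Suc N" using Suc.hyps(2) pq by auto
    have ca: "indep_list (c @ a)" using Suc.prems(1) indep_list_mset[of "c @ a" "a @ c"] by simp
    have b: "y \<in> span (set a)" if "y \<in> set b" for y using that Suc.prems(6) by auto
    have d: "y \<in> span (set c)" if "y \<in> set d" for y using that Suc.prems(7) by auto
    have A: "asum (\<lambda>y t. ?t (r @ c) y t) (b @ d) = asum (\<lambda>y t. if opp_cond h r y then ?c y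
        (shuffle_mult (opp_term h p' r y t) (opp_words h q c d)) else 0) b"
      if a: "a = as @ x # as'" "r = as @ as'" for as x as' r
    proof -
      have "asum (\<lambda>y t. ?t (r @ c) y (b @ t)) d = 0"
      proof (rule asum_eq_0)
        fix ds y ds' assume "d = ds @ y # ds'"
        then have "y \<in> span (set c)" using d by auto
        then have "y \<in> span (set (r @ c))" using span_mono[of "set c" "set (r @ c)"] by auto
        then show "?t (r @ c) y (b @ ds @ ds') = 0" by (simp add: opp_cond_def)
      qed
      moreover have "asum (\<lambda>y t. ?t (r @ c) y (t @ d)) b = asum (\<lambda>y t. if opp_cond h r y then ?c y
        (shuffle_mult (opp_term h p' r y t) (opp_words h q c d)) else 0) b"
      proof (rule asum_cong)
        fix bs y bs' assume bb: "b = bs @ y # bs'"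
        let ?t' = "bs @ bs'"
        have ya: "y \<in> span (set (as @ x # as'))" using b bb a by auto
        have Q: "set (r @ c) = set (as @ as') \<union> set c" using a by auto
        have pc1: "y \<in> span (set (r @ c)) \<longleftrightarrow> y \<in> span (set r)"
          using proj_span_complement(1)[OF Suc.prems(1)[unfolded a(1)] ya Q] a by simp
        have "opp_term h N (r @ c) y (?t' @ d) = shuffle_mult (opp_term h p' r y ?t') (opp_words h q c d)"
          if "opp_cond h r y"
        proof -
          have yQ: "y \<notin> span (set (r @ c))" using that pc1 by (simp add: opp_cond_def)
          note pc = proj_span_complement(2-4)[OF Suc.prems(1)[unfolded a(1)] ya Q yQ]
          have "map (proj_span (span (set (r @ c))) y) ?t' = map (proj_span (span (set r)) y) ?t'"
          proof (rule map_cong[OF refl])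
            fix z assume "z \<in> set ?t'"
            then have "z \<in> span (set (as @ x # as'))" using b bb a(1) by auto
            then show "proj_span (span (set (r @ c))) y z = proj_span (span (set r)) y z"
              using pc(1) a(2) by simp
          qed
          moreover have "map (proj_span (span (set (r @ c))) y) d = d"
            using pc(2) d a(2) by (intro map_idI) simp
          moreover have "opp_words h (p' + q) (r @ c) (map (proj_span (span (set r)) y) ?t' @ d)
            = shuffle_mult (opp_words h p' r (map (proj_span (span (set r)) y) ?t')) (opp_words h q c d)"
          proof (rule Suc.hyps(1)[OF N(1)])
            show "indep_list (r @ c)" using Suc.prems(1) indep_list_insert[of as x "as' @ c"] a by simp
            show "set (map (proj_span (span (set r)) y) ?t') \<subseteq> span (set r)"
              using pc(3) b bb a by auto
          qed (use Suc.prems a bb pq in auto)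
          ultimately show ?thesis
            unfolding opp_term_def N(1) map_append[of "proj_span (span (set (r @ c))) y" ?t' d]
            by (simp only:)
        qed
        moreover have "opp_cond h (r @ c) y \<longleftrightarrow> opp_cond h r y" using pc1 by (simp add: opp_cond_def)
        ultimately show "?t (r @ c) y (?t' @ d) = (if opp_cond h r y then ?c y
          (shuffle_mult (opp_term h p' r y ?t') (opp_words h q c d)) else 0)" by simp
      qed
      ultimately show ?thesis unfolding asum_append by simp
    qed
    have B: "asum (\<lambda>y t. ?t (a @ r) y t) (b @ d) = qscale ((-1) ^ length b) (asum (\<lambda>y t. if opp_cond h r y then ?c y
        (shuffle_mult (opp_words h p a b) (opp_term h q' r y t)) else 0) d)"
      if c: "c = as @ x # as'" "r = as @ as'" for as x as' r
    proof -
      have "asum (\<lambda>y t. ?t (a @ r) y (t @ d)) b = 0"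
      proof (rule asum_eq_0)
        fix bs y bs' assume "b = bs @ y # bs'"
        then have "y \<in> span (set a)" using b by auto
        then have "y \<in> span (set (a @ r))" using span_mono[of "set a" "set (a @ r)"] by auto
        then show "?t (a @ r) y ((bs @ bs') @ d) = 0" by (simp add: opp_cond_def)
      qed
      moreover have "asum (\<lambda>y t. ?t (a @ r) y (b @ t)) d = asum (\<lambda>y t. if opp_cond h r y then ?c y
        (shuffle_mult (opp_words h p a b) (opp_term h q' r y t)) else 0) d"
      proof (rule asum_cong)
        fix ds y ds' assume dd: "d = ds @ y # ds'"
        let ?t' = "ds @ ds'"
        have yc: "y \<in> span (set (as @ x # as'))" using d dd c by auto
        have Q: "set (a @ r) = set (as @ as') \<union> set a" using c by auto
        have pc1: "y \<in> span (set (a @ r)) \<longleftrightarrow> y \<in> span (set r)"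
          using proj_span_complement(1)[OF ca[unfolded c(1)] yc Q] c by simp
        have "opp_term h N (a @ r) y (b @ ?t') = shuffle_mult (opp_words h p a b) (opp_term h q' r y ?t')"
          if "opp_cond h r y"
        proof -
          have yQ: "y \<notin> span (set (a @ r))" using that pc1 by (simp add: opp_cond_def)
          note pc = proj_span_complement(2-4)[OF ca[unfolded c(1)] yc Q yQ]
          have "map (proj_span (span (set (a @ r))) y) ?t' = map (proj_span (span (set r)) y) ?t'"
          proof (rule map_cong[OF refl])
            fix z assume "z \<in> set ?t'"
            then have "z \<in> span (set (as @ x # as'))" using d dd c(1) by auto
            then show "proj_span (span (set (a @ r))) y z = proj_span (span (set r)) y z"
              using pc(1) c(2) by simp
          qed
          moreover have "map (proj_span (span (set (a @ r))) y) b = b"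
            using pc(2) b by (intro map_idI) simp
          moreover have "opp_words h (p + q') (a @ r) (b @ map (proj_span (span (set r)) y) ?t')
            = shuffle_mult (opp_words h p a b) (opp_words h q' r (map (proj_span (span (set r)) y) ?t'))"
          proof (rule Suc.hyps(1)[OF N(2)])
            show "indep_list (a @ r)" using Suc.prems(1) indep_list_insert[of "a @ as" x as'] c by simp
            show "set (map (proj_span (span (set r)) y) ?t') \<subseteq> span (set r)"
              using pc(3) d dd c by auto
          qed (use Suc.prems c dd pq in auto)
          ultimately show ?thesis
            unfolding opp_term_def N(2) map_append[of "proj_span (span (set (a @ r))) y" b ?t']
            by (simp only:)
        qed
        moreover have "opp_cond h (a @ r) y \<longleftrightarrow> opp_cond h r y" using pc1 by (simp add: opp_cond_def)
        ultimately show "?t (a @ r) y (b @ ?t') = (if opp_cond h r y then ?c y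
          (shuffle_mult (opp_words h p a b) (opp_term h q' r y ?t')) else 0)" by simp
      qed
      ultimately show ?thesis unfolding asum_append by simp
    qed
    have "opp_words h (p + q) (a @ c) (b @ d)
        = asum (\<lambda>x r. asum (\<lambda>y t. ?t (r @ c) y t) (b @ d)) a
          + qscale ((-1) ^ length a) (asum (\<lambda>x r. asum (\<lambda>y t. ?t (a @ r) y t) (b @ d)) c)"
      unfolding N(3) opp_words_Suc by (rule asum_append)
    also have "asum (\<lambda>x r. asum (\<lambda>y t. ?t (r @ c) y t) (b @ d)) a
        = asum (\<lambda>x r. asum (\<lambda>y t. if opp_cond h r y then ?c y
        (shuffle_mult (opp_term h p' r y t) (opp_words h q c d)) else 0) b) a"
      by (rule asum_cong) (rule A[OF _ refl])
    also have "asum (\<lambda>x r. asum (\<lambda>y t. ?t (a @ r) y t) (b @ d)) c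
        = asum (\<lambda>x r. qscale ((-1) ^ length b) (asum (\<lambda>y t. if opp_cond h r y then ?c y
        (shuffle_mult (opp_words h p a b) (opp_term h q' r y t)) else 0) d)) c"
      by (rule asum_cong) (rule B[OF _ refl])
    finally show ?thesis
      unfolding asum_scale unfolding pq shuffle_mult_opp_words
      using Suc.prems(2,3) pq by simp
  qed
qed simp

end

text \<open>This is (-1)^(k(k-1)/2), the sign of reversing k entries: the first flag is taken apart
  from its top, the second from its bottom.\<close>

primrec opp_sign :: "nat \<Rightarrow> rat" where
  "opp_sign 0 = 1"
| "opp_sign (Suc k) = (-1) ^ k * opp_sign k"

lemma opp_sign_square [simp]: "opp_sign k * opp_sign k = 1"
  by (induction k) (simp_all add: power_mult_distrib[symmetric] mult.assoc mult.left_commute)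

section \<open>From pairs of bases to pairs of flags\<close>

context correlator_space
begin

text \<open>Both flags include their top spaces. The padding by \<open>{0}\<close> supplies the
  hyperplane of a line, whose flag has nothing below the top.\<close>

primrec opp_flags :: "('b \<Rightarrow> 'a) \<Rightarrow> nat \<Rightarrow> 'b set list \<Rightarrow> 'b set list \<Rightarrow> ('b list \<Rightarrow>\<^sub>0 rat)" where
  "opp_flags h 0 L M = basis_elt []"
| "opp_flags h (Suc k) L M =
     (if \<not> hd M \<subseteq> last ({0} # butlast L) \<and> (\<exists>v\<in>hd M. h v \<noteq> 0)
      then cons_letter (SOME v. v \<in> hd M \<and> h v = 1)
        (opp_flags h k (butlast L) (map (\<lambda>W. W \<inter> last ({0} # butlast L)) (tl M)))
      else 0)"

lemma last_full_flag: "last ({0} # full_flag w) = span (set w)"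
  by (cases w rule: rev_cases) (simp_all add: full_flag_snoc)

lemma full_flag_butlast: "w \<noteq> [] \<Longrightarrow> full_flag w = butlast (full_flag w) @ [span (set w)]"
  by (cases w rule: rev_cases) (simp_all add: full_flag_snoc)

text \<open>An element of the left side is a multiple of \<open>y\<close> plus a combination of
  projections; lying in \<open>P\<close>, it has coefficient 0 at \<open>y\<close>. Thus
  intersecting a flag that starts with \<open>y\<close> with \<open>P\<close> is the same as
  projecting its generators along \<open>y\<close>.\<close>

lemma span_insert_Int:
  assumes "subspace P" "y \<notin> P" "T \<subseteq> span (insert y P)"
  shows "span (insert y T) \<inter> P = span (proj_span P y ` T)"
proof -
  have pr: "proj_span P y z \<in> P" if "z \<in> T" for z
    using that assms by (intro proj_span_in) auto
  have shift: "\<exists>c. proj_span P y z = z - c *s y" for z by (auto simp: proj_span_def)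
  have 1: "proj_span P y z \<in> span (insert y T)" if "z \<in> T" for z
  proof -
    obtain c where c: "proj_span P y z = z - c *s y" using shift by blast
    have "z \<in> span (insert y T)" "y \<in> span (insert y T)" using that by (simp_all add: span_base)
    then show ?thesis unfolding c by (intro span_diff span_scale)
  qed
  have 2: "z \<in> span (insert y (proj_span P y ` T))" if "z \<in> T" for z
  proof -
    obtain c where c: "proj_span P y z = z - c *s y" using shift by blast
    have z: "z = proj_span P y z + c *s y" unfolding c by simp
    have "proj_span P y z \<in> span (insert y (proj_span P y ` T))" "y \<in> span (insert y (proj_span P y ` T))"
      using that by (simp_all add: span_base)
    then have "proj_span P y z + c *s y \<in> span (insert y (proj_span P y ` T))"
      by (intro span_add span_scale)
    then show ?thesis using z by argo
  qed
  have PT: "span (proj_span P y ` T) \<subseteq> P" using pr assms(1) by (intro span_minimal) auto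
  show ?thesis
  proof
    show "span (proj_span P y ` T) \<subseteq> span (insert y T) \<inter> P"
      using PT span_minimal[OF _ subspace_span, of "proj_span P y ` T" "insert y T"] 1 by blast
  next
    show "span (insert y T) \<inter> P \<subseteq> span (proj_span P y ` T)"
    proof
      fix v assume v: "v \<in> span (insert y T) \<inter> P"
      have "span (insert y T) \<subseteq> span (insert y (proj_span P y ` T))"
        by (rule span_minimal[OF _ subspace_span]) (use 2 span_base in blast)
      then obtain k where k: "v - k *s y \<in> span (proj_span P y ` T)"
        using v span_breakdown_eq by blast
      then have "v - (v - k *s y) \<in> P" using v PT subspace_diff[OF assms(1)] by blast
      then have ky: "k *s y \<in> P" by simp
      have "k = 0"
      proof (rule ccontr)
        assume "k \<noteq> 0"
        then have "inverse k *s (k *s y) = y" by simp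
        then show False using subspace_scale[OF assms(1) ky, of "inverse k"] assms(2) by simp
      qed
      then show "v \<in> span (proj_span P y ` T)" using k by simp
    qed
  qed
qed

lemma opp_flags_full_flag:
  assumes "Vector_Spaces.linear scale (*) h"
    "opp_cond h w y \<Longrightarrow> set w' \<subseteq> span (insert y (span (set w)))"
  shows "opp_flags h (Suc k) (full_flag (w @ [x])) (full_flag (y # w')) =
    (if opp_cond h w y then cons_letter (inverse (h y) *s y)
       (opp_flags h k (full_flag w) (full_flag (map (proj_span (span (set w)) y) w'))) else 0)"
proof -
  interpret h: Vector_Spaces.linear scale "(*)" h by (rule assms(1))
  let ?P = "span (set w)"
  have bl: "butlast (full_flag (w @ [x])) = full_flag w" by (simp add: full_flag_snoc)
  have hd: "hd (full_flag (y # w')) = span {y}" by (simp add: full_flag_Cons)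
  have 1: "span {y} \<subseteq> ?P \<longleftrightarrow> y \<in> ?P"
    using span_minimal[of "{y}" ?P] span_base[of y "{y}"] by auto
  have 2: "(\<exists>v\<in>span {y}. h v \<noteq> 0) \<longleftrightarrow> h y \<noteq> 0"
    using span_base[of y "{y}"] by (auto simp: span_singleton h.scale)
  have 3: "(SOME v. v \<in> span {y} \<and> h v = 1) = inverse (h y) *s y" if "h y \<noteq> 0"
  proof (rule some_equality)
    show "inverse (h y) *s y \<in> span {y} \<and> h (inverse (h y) *s y) = 1"
      using that by (auto simp: h.scale intro: span_scale span_base)
    show "v = inverse (h y) *s y" if "v \<in> span {y} \<and> h v = 1" for v
      using that \<open>h y \<noteq> 0\<close> by (auto simp: span_singleton h.scale field_simps)
  qed
  have 4: "map (\<lambda>W. W \<inter> ?P) (tl (full_flag (y # w'))) = full_flag (map (proj_span ?P y) w')"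
    if c: "opp_cond h w y"
  proof -
    have yP: "y \<notin> ?P" using c by (simp add: opp_cond_def)
    have "span (insert y (set (take j w'))) \<inter> ?P = span (set (take j (map (proj_span ?P y) w')))" for j
    proof -
      have "set (take j w') \<subseteq> span (insert y ?P)" using assms(2)[OF c] set_take_subset[of j w'] by blast
      from span_insert_Int[OF subspace_span yP this] show ?thesis by (simp add: take_map)
    qed
    then show ?thesis unfolding full_flag_Cons full_flag_def[of "map _ _"] by (simp del: upt_Suc)
  qed
  show ?thesis
    unfolding opp_flags.simps bl last_full_flag hd 1 2 opp_cond_def[symmetric]
    using 3 4 by (simp add: opp_cond_def)
qed

text \<open>Orderings of \<open>a\<close> are sorted by their last entry and orderings of
  \<open>b\<close> by their first. The hyperplane and the line of the first step depend on these
  choices only, and induction handles the remaining orderings.\<close>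

lemma alt_alt_opp_flags:
  assumes "Vector_Spaces.linear scale (*) h" "indep_list a" "length a = k" "length b = k"
    "set b \<subseteq> span (set a)"
  shows "alt k (\<lambda>w. alt k (\<lambda>w'. opp_flags h k (full_flag w) (full_flag w')) b) a
    = qscale (opp_sign k) (opp_words h k a b)"
  using assms(2-)
proof (induction k arbitrary: a b)
  case (Suc k)
  let ?c = "\<lambda>y. cons_letter (inverse (h y) *s y)"
  have *: "alt k (\<lambda>w. alt k (\<lambda>w'. opp_flags h (Suc k) (full_flag (w @ [x])) (full_flag (y # w'))) t) r
      = qscale (opp_sign k) (if opp_cond h r y then ?c y (opp_term h k r y t) else 0)"
    if a: "a = as @ x # as'" "r = as @ as'" and b: "b = bs @ y # bs'" "t = bs @ bs'"
    for as x as' r bs y bs' t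
  proof -
    have len: "length r = k" "length t = k" using Suc.prems a b by auto
    have ia: "indep_list (as @ x # as')" using Suc.prems(1) a by simp
    have ya: "y \<in> span (set (as @ x # as'))" using Suc.prems(4) a b by auto
    have sub: "set t \<subseteq> span (insert y (span (set r)))" if "opp_cond h r y"
    proof -
      have "y \<notin> span (set (as @ as'))" using that a by (simp add: opp_cond_def)
      from indep_list_swap_in(2)[OF ia ya this] show ?thesis
        unfolding span_insert_span using Suc.prems(4) a b by auto
    qed
    have "alt k (\<lambda>w. alt k (\<lambda>w'. opp_flags h (Suc k) (full_flag (w @ [x])) (full_flag (y # w'))) t) r
      = alt k (\<lambda>w. alt k (\<lambda>w'. if opp_cond h r y then ?c y (opp_flags h k (full_flag w)
           (full_flag (map (proj_span (span (set r)) y) w'))) else 0) t) r"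
    proof (rule alt_cong[OF len(1)], rule alt_cong[OF len(2)])
      fix w w' assume w: "mset w = mset r" "mset w' = mset t"
      have s: "set w = set r" "set w' = set t" by (rule mset_eq_setD[OF w(1)], rule mset_eq_setD[OF w(2)])
      have cw: "opp_cond h w y \<longleftrightarrow> opp_cond h r y" unfolding opp_cond_def s ..
      have "opp_cond h w y \<Longrightarrow> set w' \<subseteq> span (insert y (span (set w)))" unfolding s cw by (rule sub)
      from opp_flags_full_flag[OF assms(1) this]
      show "opp_flags h (Suc k) (full_flag (w @ [x])) (full_flag (y # w')) =
          (if opp_cond h r y then ?c y (opp_flags h k (full_flag w)
           (full_flag (map (proj_span (span (set r)) y) w'))) else 0)"
        unfolding cw s by blast
    qed
    also have "\<dots> = qscale (opp_sign k) (if opp_cond h r y then ?c y (opp_term h k r y t) else 0)"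
    proof (cases "opp_cond h r y")
      case True
      then have yr: "y \<notin> span (set r)" by (simp add: opp_cond_def)
      have "alt k (\<lambda>w. alt k (\<lambda>w'. ?c y (opp_flags h k (full_flag w)
           (full_flag (map (proj_span (span (set r)) y) w')))) t) r
          = ?c y (alt k (\<lambda>w. alt k (\<lambda>w'. opp_flags h k (full_flag w) (full_flag w'))
              (map (proj_span (span (set r)) y) t)) r)"
        unfolding alt_linear[OF qlinear_lin_ext] alt_map ..
      also have "\<dots> = ?c y (qscale (opp_sign k) (opp_term h k r y t))"
        unfolding opp_term_def
      proof (rule arg_cong[where f = "?c y"], rule Suc.IH)
        show "indep_list r" using ia a by (simp add: indep_list_insert)
        show "set (map (proj_span (span (set r)) y) t) \<subseteq> span (set r)"
          using proj_span_in[OF subspace_span yr] sub[OF True] by auto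
      qed (use len in auto)
      finally show ?thesis using True by (simp add: lin_ext_scale)
    qed simp
    finally show ?thesis .
  qed
  have "alt (Suc k) (\<lambda>w. alt (Suc k) (\<lambda>w'. opp_flags h (Suc k) (full_flag w) (full_flag w')) b) a
      = qscale ((-1) ^ k) (asum (\<lambda>x r. alt k (\<lambda>w. asum (\<lambda>y t. alt k (\<lambda>w'.
          opp_flags h (Suc k) (full_flag (w @ [x])) (full_flag (y # w'))) t) b) r) a)"
    unfolding alt_snoc[of k _ a] alt.simps(2)[of k _ b] ..
  also have "asum (\<lambda>x r. alt k (\<lambda>w. asum (\<lambda>y t. alt k (\<lambda>w'.
          opp_flags h (Suc k) (full_flag (w @ [x])) (full_flag (y # w'))) t) b) r) a
      = asum (\<lambda>x r. qscale (opp_sign k) (asum (\<lambda>y t. if opp_cond h r y then ?c y (opp_term h k r y t) else 0) b)) a"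
    unfolding alt_asum asum_scale[symmetric]
    by (rule asum_cong, rule asum_cong) (rule *[OF _ refl _ refl])
  finally show ?case unfolding opp_words_Suc asum_scale by simp
qed simp

text \<open>Simplices of the Tits building omit the full space, which is put back here to obtain
  complete flags.\<close>

definition opp_pairing :: "('b \<Rightarrow> 'a) \<Rightarrow> ('b set list \<times> 'b set list \<Rightarrow>\<^sub>0 rat) \<Rightarrow> ('b list \<Rightarrow>\<^sub>0 rat)" where
  "opp_pairing h = lin_ext (\<lambda>(\<sigma>, \<tau>). opp_flags h (Suc (length \<sigma>)) (\<sigma> @ [UNIV]) (\<tau> @ [UNIV]))"

end

context fd_correlator_space
begin

lemma opp_pairing_apartments:
  assumes "Vector_Spaces.linear scale (*) h" "basis_list a" "basis_list b"
  shows "opp_pairing h (tensor (apartment a) (apartment b)) = qscale (opp_sign n) (opp_words h n a b)"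
proof -
  have la: "length a = n" "indep_list a" and lb: "length b = n"
    using assms(2,3) by (simp_all add: basis_list_iff)
  have spa: "span (set a) = UNIV" using assms(2) unfolding basis_list_def by blast
  have ff: "full_flag w = butlast (full_flag w) @ [UNIV]" "length (butlast (full_flag w)) = n - 1"
    if "mset w = mset v" "basis_list v" for w v
  proof -
    have "basis_list w" using that basis_list_mset by blast
    then have "span (set w) = UNIV" "length w = n" by (simp add: basis_list_def, simp add: basis_list_iff)
    moreover from this have "w \<noteq> []" using n_pos by auto
    ultimately show "full_flag w = butlast (full_flag w) @ [UNIV]" "length (butlast (full_flag w)) = n - 1"
      using full_flag_butlast[of w] by simp_all
  qed
  have "opp_pairing h (tensor (apartment a) (apartment b)) =
      alt n (\<lambda>w. alt n (\<lambda>w'. opp_pairing h (basis_elt (butlast (full_flag w), butlast (full_flag w')))) b) a"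
  proof -
    have 1: "opp_pairing h (tensor (alt n f a) q) = alt n (\<lambda>w. opp_pairing h (tensor (f w) q)) a" for f q
      using alt_linear[OF qlinear_comp[OF qlinear_lin_ext qlinear_tensor_left]] unfolding opp_pairing_def .
    have 2: "opp_pairing h (tensor p (alt n f b)) = alt n (\<lambda>w. opp_pairing h (tensor p (f w))) b" for f p
      using alt_linear[OF qlinear_comp[OF qlinear_lin_ext qlinear_tensor_right]] unfolding opp_pairing_def .
    have "apartment a = alt n (\<lambda>w. basis_elt (butlast (full_flag w))) a"
      "apartment b = alt n (\<lambda>w. basis_elt (butlast (full_flag w))) b"
      using assms(2,3) by (simp_all add: apartment_eq_alt la lb)
    note ap = this
    have 1: "opp_pairing h (tensor (apartment a) q) =
        alt n (\<lambda>w. opp_pairing h (tensor (basis_elt (butlast (full_flag w))) q)) a" for q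
      by (subst ap(1)) (rule 1)
    have 2: "opp_pairing h (tensor p (apartment b)) =
        alt n (\<lambda>w. opp_pairing h (tensor p (basis_elt (butlast (full_flag w))))) b" for p
      by (subst ap(2)) (rule 2)
    show ?thesis unfolding 1 unfolding 2 tensor_basis ..
  qed
  also have "\<dots> = alt n (\<lambda>w. alt n (\<lambda>w'. opp_flags h n (full_flag w) (full_flag w')) b) a"
  proof (rule alt_cong[OF la(1)], rule alt_cong[OF lb])
    fix w w' assume w: "mset w = mset a" "mset w' = mset b"
    have "Suc (n - 1) = n" using n_pos by simp
    then show "opp_pairing h (basis_elt (butlast (full_flag w), butlast (full_flag w'))) =
      opp_flags h n (full_flag w) (full_flag w')"
      unfolding opp_pairing_def lin_ext_basis prod.case ff(2)[OF w(1) assms(2)]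
        ff(1)[OF w(1) assms(2), symmetric] ff(1)[OF w(2) assms(3), symmetric] by simp
  qed
  also have "\<dots> = qscale (opp_sign n) (opp_words h n a b)"
    by (rule alt_alt_opp_flags[OF assms(1) la(2,1) lb]) (simp add: spa)
  finally show ?thesis .
qed

definition FC_words :: "('b list \<Rightarrow>\<^sub>0 rat) \<Rightarrow> ('b list \<Rightarrow>\<^sub>0 rat)" where
  "FC_words = lin_ext (\<lambda>w. basis_elt (0 # rev w))"

lemma FC_rel_subspace: "rat_free.subspace FC_rel"
  unfolding FC_rel_def by (rule rat_free.subspace_span)

lemma affine_basis_zero: "affine_basis (0 # w) \<longleftrightarrow> indep_list w \<and> length w = n"
  by (simp add: affine_basis_def basis_list_iff)

text \<open>A common letter of the two words would lie in both summands and be 0, against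
  \<open>h\<close> being 1 on it. So the letters are disjoint, and \<open>shuffle_prod\<close> is an
  honest sum over the set of shuffles, as in \<open>FC_rel\<close>.\<close>

lemma shuffle_mult_in_FC_rel:
  assumes "Vector_Spaces.linear scale (*) h" "basis_list (a @ c)" "a \<noteq> []" "c \<noteq> []"
    "p \<in> free_on {w. indep_list w \<and> length w = length a \<and> set w \<subseteq> span (set a) \<and> (\<forall>v\<in>set w. h v = 1)}"
    "q \<in> free_on {w. indep_list w \<and> length w = length c \<and> set w \<subseteq> span (set c) \<and> (\<forall>v\<in>set w. h v = 1)}"
  shows "FC_words (shuffle_mult p q) \<in> FC_rel"
proof -
  interpret h: Vector_Spaces.linear scale "(*)" h by (rule assms(1))
  have iac: "indep_list (a @ c)" using assms(2) by (simp add: basis_list_iff)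
  have *: "FC_words (shuffle_prod v w) \<in> FC_rel"
    if v: "indep_list v" "length v = length a" "set v \<subseteq> span (set a)" "\<forall>x\<in>set v. h x = 1"
      and w: "indep_list w" "length w = length c" "set w \<subseteq> span (set c)" "\<forall>x\<in>set w. h x = 1" for v w
  proof -
    have disj: "set v \<inter> set w = {}"
    proof (rule ccontr)
      assume "set v \<inter> set w \<noteq> {}"
      then obtain x where x: "x \<in> set v" "x \<in> set w" by auto
      then have "x = 0" using indep_list_append_disjoint[OF iac] v(3) w(3) by auto
      then show False using x v(4) h.zero by auto
    qed
    have sp: "span (set a) = span (set v)" "span (set c) = span (set w)"
      using indep_list_exchange[OF v(1,3)] indep_list_exchange[OF w(1,3)] v(2) w(2) by simp_all
    have "set (a @ c) \<subseteq> span (set (v @ w))"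
      using span_superset[of "set a"] span_superset[of "set c"] sp
        span_mono[of "set v" "set (v @ w)"] span_mono[of "set w" "set (v @ w)"] by auto
    from indep_list_exchange[OF iac this] have "indep_list (v @ w)" using v(2) w(2) by simp
    then have "indep_list (rev v @ rev w)" using indep_list_mset[of "rev v @ rev w" "v @ w"] by simp
    moreover have "length (rev v @ rev w) = n" using v(2) w(2) assms(2) by (simp add: basis_list_iff)
    ultimately have ab: "affine_basis (0 # rev v @ rev w)" by (simp only: affine_basis_zero)
    have "FC_words (shuffle_prod v w) = (\<Sum>z\<in>shuffles v w. basis_elt (0 # rev z))"
      by (simp add: FC_words_def shuffle_prod_eq_sum[OF disj] lin_ext_sum)
    also have "\<dots> = (\<Sum>z\<in>shuffles (rev v) (rev w). basis_elt (0 # z))"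
      by (rule sum_shuffles_rev[OF disj])
    also have "\<dots> \<in> FC_rel" unfolding FC_rel_def
    proof (rule rat_free.span_base, rule UnI2, rule CollectI, intro exI conjI)
      show "rev v \<noteq> []" "rev w \<noteq> []" using v(2) w(2) assms(3,4) by auto
    qed (rule refl, rule ab)
    finally show ?thesis .
  qed
  have "FC_words (shuffle_mult p q) = lin_ext (\<lambda>v. lin_ext (\<lambda>w. FC_words (shuffle_prod v w)) q) p"
    by (simp add: FC_words_def shuffle_mult_def lin_ext_lin_ext)
  also have "\<dots> \<in> FC_rel"
  proof (intro lin_ext_in_subspace FC_rel_subspace)
    fix v w assume "v \<in> Poly_Mapping.keys p" "w \<in> Poly_Mapping.keys q"
    from in_free_onD[OF assms(5) this(1)] in_free_onD[OF assms(6) this(2)]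
    show "FC_words (shuffle_prod v w) \<in> FC_rel" by (intro *) simp_all
  qed
  finally show ?thesis .
qed

text \<open>A generator with a vanishing apartment contributes nothing. In the others
  \<open>a @ c\<close> is a basis adapted to the decomposition, which forces its parts to span the
  two summands, so that the subspaces can be eliminated.\<close>

lemma decomposables_subset_span:
  "decomposables \<subseteq> rat_free.span {tensor (apartment (a @ c)) (apartment (b @ d)) |a b c d.
     a \<noteq> [] \<and> c \<noteq> [] \<and> length b = length a \<and> length d = length c \<and>
     set b \<subseteq> span (set a) \<and> set d \<subseteq> span (set c) \<and> basis_list (a @ c) \<and> basis_list (b @ d)}"
  (is "_ \<subseteq> rat_free.span ?S")
  unfolding decomposables_def
proof (intro rat_free.span_minimal rat_free.subspace_span subsetI)
  fix x assume "x \<in> {tensor (apartment (a @ c)) (apartment (b @ d)) |a b c d.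
        \<exists>V1 V2. direct_sum_decomp V1 V2 \<and>
          set a \<subseteq> V1 \<and> length a = dim V1 \<and> set b \<subseteq> V1 \<and> length b = dim V1 \<and>
          set c \<subseteq> V2 \<and> length c = dim V2 \<and> set d \<subseteq> V2 \<and> length d = dim V2}"
  then obtain a b c d V1 V2 where x: "x = tensor (apartment (a @ c)) (apartment (b @ d))"
    and V: "direct_sum_decomp V1 V2"
    and ab: "set a \<subseteq> V1" "length a = dim V1" "set b \<subseteq> V1" "length b = dim V1"
    and cd: "set c \<subseteq> V2" "length c = dim V2" "set d \<subseteq> V2" "length d = dim V2" by blast
  show "x \<in> rat_free.span ?S"
  proof (cases "basis_list (a @ c) \<and> basis_list (b @ d)")
    case False
    then have "apartment (a @ c) = 0 \<or> apartment (b @ d) = 0" unfolding apartment_def by argo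
    then have "x = 0" unfolding x by (elim disjE) simp_all
    then show ?thesis by (simp only: rat_free.span_zero)
  next
    case True
    have sV: "subspace V1" "subspace V2" "V1 \<inter> V2 = {0}" "V1 \<noteq> {0}" "V2 \<noteq> {0}"
      using V by (auto simp: direct_sum_decomp_def)
    have spac: "span (set (a @ c)) = UNIV" using True by (simp add: basis_list_def)
    have dec: "\<exists>p q. x = p + q \<and> p \<in> span (set a) \<and> q \<in> span (set c)" for x
    proof -
      have "x \<in> span (set (a @ c))" using spac by simp
      then show ?thesis unfolding set_append span_Un by auto
    qed
    have V1: "span (set a) = V1"
    proof
      show sa: "span (set a) \<subseteq> V1" by (rule span_minimal[OF ab(1) sV(1)])
      show "V1 \<subseteq> span (set a)"
      proof
        fix x assume xV: "x \<in> V1"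
        obtain p q where pq: "x = p + q" "p \<in> span (set a)" "q \<in> span (set c)" using dec by blast
        have "q \<in> V2" using pq(3) span_minimal[OF cd(1) sV(2)] by blast
        moreover have "x - p \<in> V1" using sa pq(2) by (intro subspace_diff[OF sV(1) xV]) blast
        then have "q \<in> V1" unfolding pq(1) by simp
        ultimately have "q = 0" using sV(3) by blast
        then show "x \<in> span (set a)" using pq by simp
      qed
    qed
    have V2: "span (set c) = V2"
    proof
      show sa: "span (set c) \<subseteq> V2" by (rule span_minimal[OF cd(1) sV(2)])
      show "V2 \<subseteq> span (set c)"
      proof
        fix x assume xV: "x \<in> V2"
        obtain p q where pq: "x = p + q" "p \<in> span (set a)" "q \<in> span (set c)" using dec by blast
        have "p \<in> V1" using pq(2) V1 by blast
        moreover have "x - q \<in> V2" using sa pq(3) by (intro subspace_diff[OF sV(2) xV]) blast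
        then have "p \<in> V2" unfolding pq(1) by simp
        ultimately have "p = 0" using sV(3) by blast
        then show "x \<in> span (set c)" using pq by simp
      qed
    qed
    have ne: "a \<noteq> []" "c \<noteq> []"
      by (rule notI, use V1 sV(4) in simp) (rule notI, use V2 sV(5) in simp)
    have "length b = length a" "length d = length c" "set b \<subseteq> span (set a)" "set d \<subseteq> span (set c)"
      using ab cd V1 V2 by simp_all
    then show ?thesis unfolding x using ne True by (intro rat_free.span_base) blast
  qed
qed

lemma opp_pairing_decomposables:
  assumes "Vector_Spaces.linear scale (*) h" "z \<in> decomposables"
  shows "FC_words (opp_pairing h z) \<in> FC_rel"
proof (rule span_induct_linear[OF subsetD[OF decomposables_subset_span assms(2)] FC_rel_subspace])
  show "qlinear (\<lambda>z. FC_words (opp_pairing h z))"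
    unfolding FC_words_def opp_pairing_def by (rule qlinear_comp[OF qlinear_lin_ext qlinear_lin_ext])
next
  fix x assume "x \<in> {tensor (apartment (a @ c)) (apartment (b @ d)) |a b c d.
     a \<noteq> [] \<and> c \<noteq> [] \<and> length b = length a \<and> length d = length c \<and>
     set b \<subseteq> span (set a) \<and> set d \<subseteq> span (set c) \<and> basis_list (a @ c) \<and> basis_list (b @ d)}"
  then obtain a b c d where x: "x = tensor (apartment (a @ c)) (apartment (b @ d))"
    and ne: "a \<noteq> []" "c \<noteq> []"
    and bd: "length b = length a" "length d = length c" "set b \<subseteq> span (set a)" "set d \<subseteq> span (set c)"
    and bas: "basis_list (a @ c)" "basis_list (b @ d)" by blast
  have iac: "indep_list (a @ c)" and len: "length a + length c = n" using bas by (auto simp: basis_list_iff)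
  have ia: "indep_list a" "indep_list c"
    by (rule indep_list_appendD1[OF iac], rule indep_list_appendD2[OF iac])
  have "opp_pairing h x = qscale (opp_sign n) (opp_words h n (a @ c) (b @ d))"
    unfolding x by (rule opp_pairing_apartments[OF assms(1) bas])
  also have "opp_words h n (a @ c) (b @ d)
      = shuffle_mult (opp_words h (length a) a b) (opp_words h (length c) c d)"
    using opp_words_append[OF iac refl bd(1) refl bd(2) bd(3,4)] len by simp
  finally have "FC_words (opp_pairing h x) = qscale (opp_sign n)
      (FC_words (shuffle_mult (opp_words h (length a) a b) (opp_words h (length c) c d)))"
    by (simp add: FC_words_def lin_ext_scale)
  moreover have "FC_words (shuffle_mult (opp_words h (length a) a b) (opp_words h (length c) c d)) \<in> FC_rel"
    by (rule shuffle_mult_in_FC_rel[OF assms(1) bas(1) ne opp_words_in_free_on[OF assms(1) ia(1) bd(3) refl bd(1)]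
          opp_words_in_free_on[OF assms(1) ia(2) bd(4) refl bd(2)]])
  ultimately show "FC_words (opp_pairing h x) \<in> FC_rel"
    by (simp only: rat_free.subspace_scale[OF FC_rel_subspace])
qed

end

section \<open>The polynomials S and the maps D\<close>

text \<open>No sign arises, unlike in \<open>asum_swap\<close>: the deletions act on different
  lists.\<close>

lemma asum_commute:
  "asum (\<lambda>x r. asum (\<lambda>y t. G x r y t) b) a = asum (\<lambda>y t. asum (\<lambda>x r. G x r y t) a) b"
  unfolding asum_index rat_free.scale_sum_right
  by (subst sum.swap) (simp add: mult.commute)

lemma del_nth_map: "del_nth i (map f xs) = map f (del_nth i xs)"
  by (simp add: del_nth_def take_map drop_map)

lemma length_del_nth: "i < length xs \<Longrightarrow> length (del_nth i xs) = length xs - 1"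
  by (simp add: del_nth_def)

lemma tl_del_nth: "xs \<noteq> [] \<Longrightarrow> tl (del_nth (Suc i) xs) = del_nth i (tl xs)"
  by (cases xs) auto

lemma rev_del_nth:
  assumes "i < length xs"
  shows "rev (del_nth i xs) = del_nth (length xs - Suc i) (rev xs)"
  using assms by (simp add: del_nth_def rev_drop rev_take Suc_diff_Suc)

lemma del_nth_append: "del_nth (length xs) (xs @ y # ys) = xs @ ys"
  by (simp add: del_nth_def)

section \<open>Stars and paths obey the recursion of S\<close>

context correlator_space
begin

lemma star_in_span_path_edges: "set (star x vs) \<subseteq> span (set (path_edges x vs))"
proof (induction vs arbitrary: x)
  case (Cons v vs)
  show ?case
  proof
    fix z assume "z \<in> set (star x (v # vs))"
    then consider "z = v - x" | w where "w \<in> set vs" "z = w - x" by (auto simp: star_def)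
    then show "z \<in> span (set (path_edges x (v # vs)))"
    proof cases
      case 1
      then show ?thesis by (simp add: span_base)
    next
      case 2
      then have "w - v \<in> span (set (path_edges v vs))" using Cons[of v] by (auto simp: star_def)
      then have "w - v \<in> span (set (path_edges x (v # vs)))"
        using span_mono[of "set (path_edges v vs)" "set (path_edges x (v # vs))"] by auto
      moreover have "v - x \<in> span (set (path_edges x (v # vs)))" by (simp add: span_base)
      ultimately have "(w - v) + (v - x) \<in> span (set (path_edges x (v # vs)))" by (rule span_add)
      then show ?thesis using 2 by simp
    qed
  qed
qed simp

lemma indep_path_edges: "indep_list (star x vs) \<Longrightarrow> indep_list (path_edges x vs)"
  using indep_list_exchange[OF _ star_in_span_path_edges] by simp

lemma diff_in_span_star: "v \<in> insert x (set L) \<Longrightarrow> v - x \<in> span (set (star x L))"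
  by (auto simp: star_def span_zero intro: span_base)

text \<open>The point \<open>v\<close> is deleted from the star, and the line is the edge arriving
  at \<open>v\<close>. Edges not touching \<open>v\<close> lie in the hyperplane; projecting along
  the arriving edge moves \<open>v\<close> to its predecessor, so what remains is the path with
  \<open>v\<close> left out.\<close>

lemma opp_term_star_path_same:
  assumes "indep_list (star x (A @ v # B))"
  shows "v - last (x # A) \<notin> span (set (star x (A @ B)))"
    and "map (proj_span (span (set (star x (A @ B)))) (v - last (x # A))) (path_edges x A @ path_edges v B)
      = path_edges x (A @ B)"
proof -
  let ?P = "span (set (star x (A @ B)))" and ?y = "v - last (x # A)"
  have l: "last (x # A) - x \<in> ?P" by (cases A rule: rev_cases) (simp_all add: span_zero span_base)
  have vx: "v - x \<notin> ?P" using assms by (simp add: indep_list_insert)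
  show y: "?y \<notin> ?P"
  proof
    assume "?y \<in> ?P"
    from span_add[OF this l] show False using vx by simp
  qed
  note id = proj_span_id[OF subspace_span y]
  have edges: "set (path_edges w C) \<subseteq> ?P" if "set (w # C) \<subseteq> insert x (set (A @ B))" for w C
    by (rule path_edges_in_subspace[OF subspace_span], rule diff_in_span_star) (use that in auto)
  show "map (proj_span ?P ?y) (path_edges x A @ path_edges v B) = path_edges x (A @ B)"
  proof (cases B)
    case Nil
    have "map (proj_span ?P ?y) (path_edges x A) = path_edges x A"
      using edges[of x A] by (intro map_idI id) auto
    then show ?thesis using Nil by simp
  next
    case (Cons w C)
    have 1: "map (proj_span ?P ?y) (path_edges x A) = path_edges x A"
      using edges[of x A] by (intro map_idI id) auto
    have 2: "map (proj_span ?P ?y) (path_edges w C) = path_edges w C"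
      using edges[of w C] Cons by (intro map_idI id) auto
    have "(w - x) - (last (x # A) - x) \<in> ?P"
      using Cons by (intro span_diff[OF _ l] span_base) simp
    then have "(w - v) - (- 1) *s ?y \<in> ?P" by (simp add: algebra_simps)
    from proj_span_eq[OF subspace_span y this] have 3: "proj_span ?P ?y (w - v) = w - last (x # A)"
      by simp
    show ?thesis using 1 2 3 unfolding Cons by simp
  qed
qed

text \<open>The same with the edge leaving \<open>v\<close>: projecting along it moves
  \<open>v\<close> to its successor \<open>w\<close>, and the remaining path is again the one with
  \<open>v\<close> left out.\<close>

lemma opp_term_star_path_prev:
  assumes "indep_list (star x (A @ v # w # B))"
  shows "w - v \<notin> span (set (star x (A @ w # B)))"
    and "map (proj_span (span (set (star x (A @ w # B)))) (w - v))
      (path_edges x A @ (v - last (x # A)) # path_edges w B) = path_edges x (A @ w # B)"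
proof -
  let ?P = "span (set (star x (A @ w # B)))" and ?y = "w - v"
  have l: "last (x # A) - x \<in> ?P" by (cases A rule: rev_cases) (simp_all add: span_zero span_base)
  have vx: "v - x \<notin> ?P" using assms by (simp add: indep_list_insert)
  have wx: "w - x \<in> ?P" by (simp add: span_base)
  show y: "?y \<notin> ?P"
  proof
    assume "?y \<in> ?P"
    from span_diff[OF wx this] show False using vx by simp
  qed
  note id = proj_span_id[OF subspace_span y]
  have edges: "set (path_edges z C) \<subseteq> ?P" if "set (z # C) \<subseteq> insert x (set (A @ w # B))" for z C
    by (rule path_edges_in_subspace[OF subspace_span], rule diff_in_span_star) (use that in auto)
  have 1: "map (proj_span ?P ?y) (path_edges x A) = path_edges x A"
    using edges[of x A] by (intro map_idI id) auto
  have 2: "map (proj_span ?P ?y) (path_edges w B) = path_edges w B"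
    using edges[of w B] by (intro map_idI id) auto
  have "(v - last (x # A)) - (- 1) *s ?y = (w - x) - (last (x # A) - x)" by (simp add: algebra_simps)
  then have "(v - last (x # A)) - (- 1) *s ?y \<in> ?P" using span_diff[OF wx l] by argo
  from proj_span_eq[OF subspace_span y this] have 3: "proj_span ?P ?y (v - last (x # A)) = w - last (x # A)"
    by simp
  show "map (proj_span ?P ?y) (path_edges x A @ (v - last (x # A)) # path_edges w B) = path_edges x (A @ w # B)"
    using 1 2 3 by simp
qed

definition edge_letter :: "('b \<Rightarrow> 'a) \<Rightarrow> 'b \<Rightarrow> ('b list \<Rightarrow>\<^sub>0 rat) \<Rightarrow> ('b list \<Rightarrow>\<^sub>0 rat)" where
  "edge_letter h y p = (if h y \<noteq> 0 then cons_letter (inverse (h y) *s y) p else 0)"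

definition star_path_words :: "('b \<Rightarrow> 'a) \<Rightarrow> 'b \<Rightarrow> 'b list \<Rightarrow> ('b list \<Rightarrow>\<^sub>0 rat)" where
  "star_path_words h x rs = opp_words h (length rs) (star x rs) (path_edges x rs)"

text \<open>In the double sum over deleted points i and edges j, an edge that does not touch the
  deleted point lies in the hyperplane and contributes 0. Only the arriving edge j = i, with sign +,
  and the leaving edge j = i + 1, with sign -, survive.\<close>

lemma star_path_words_rec:
  assumes ind: "indep_list (star x rs)" and len: "length rs = Suc m"
  shows "star_path_words h x rs =
    (\<Sum>j<Suc m. edge_letter h (rs ! j - (x # rs) ! j) (star_path_words h x (del_nth j rs)))
    - (\<Sum>j<m. edge_letter h (rs ! Suc j - rs ! j) (star_path_words h x (del_nth j rs)))"
proof -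
  let ?a = "star x rs" and ?b = "path_edges x rs"
  define T where "T i j = (if opp_cond h (del_nth i ?a) (?b ! j)
    then cons_letter (inverse (h (?b ! j)) *s ?b ! j) (opp_term h m (del_nth i ?a) (?b ! j) (del_nth j ?b)) else 0)" for i j
  let ?e = "\<lambda>j. rs ! j - (x # rs) ! j"
  have b: "?b ! j = ?e j" if "j < Suc m" for j using that len by (simp add: nth_path_edges)
  have split: "rs = take j rs @ rs ! j # drop (Suc j) rs" if "j < Suc m" for j
    using that len by (simp add: id_take_nth_drop[symmetric])
  have lst: "(x # rs) ! j = last (x # take j rs)" if "j < Suc m" for j
    using that len by (cases j) (auto simp: take_Suc_conv_app_nth last_conv_nth)
  have diag: "T j j = edge_letter h (?e j) (star_path_words h x (del_nth j rs))" if j: "j < Suc m" for j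
  proof -
    define A v B where "A = take j rs" "v = rs ! j" "B = drop (Suc j) rs"
    have rs: "rs = A @ v # B" and lA: "length A = j" using split[OF j] j len by (simp_all add: A_v_B_def)
    have d: "del_nth j ?a = star x (A @ B)" "del_nth j rs = A @ B" "del_nth j ?b = path_edges x A @ path_edges v B"
      unfolding rs using del_nth_append[of "star x A"] del_nth_append[of A] del_nth_append[of "path_edges x A"] lA by simp_all
    have e: "?e j = v - last (x # A)" using lst[OF j] by (simp add: A_v_B_def)
    note f = opp_term_star_path_same[of x A v B, folded rs, OF ind]
    have "length (A @ B) = m" using len rs by simp
    then show ?thesis
      unfolding T_def b[OF j] d e opp_term_def f(2) edge_letter_def star_path_words_def opp_cond_def
      using f(1) by simp
  qed
  have prev: "T j (Suc j) = edge_letter h (rs ! Suc j - rs ! j) (star_path_words h x (del_nth j rs))" if j: "j < m" for j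
  proof -
    define A v w B where "A = take j rs" "v = rs ! j" "w = rs ! Suc j" "B = drop (Suc (Suc j)) rs"
    have "drop (Suc j) rs = w # B" using j len by (simp add: A_v_w_B_def Cons_nth_drop_Suc)
    then have rs: "rs = A @ v # w # B" and lA: "length A = j" using split[of j] j len by (simp_all add: A_v_w_B_def)
    have d: "del_nth j ?a = star x (A @ w # B)" "del_nth j rs = A @ w # B"
      unfolding rs using del_nth_append[of "star x A"] del_nth_append[of A] lA by simp_all
    have d2: "del_nth (Suc j) ?b = path_edges x A @ (v - last (x # A)) # path_edges w B"
      using del_nth_append[of "path_edges x A @ [v - last (x # A)]" "w - v" "path_edges w B"] lA
      unfolding rs by simp
    have e: "?b ! Suc j = w - v" using b[of "Suc j"] j by (simp add: A_v_w_B_def)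
    have e2: "rs ! Suc j - rs ! j = w - v" by (simp add: A_v_w_B_def)
    note f = opp_term_star_path_prev[of x A v w B, folded rs, OF ind]
    have "length (A @ w # B) = m" using len rs by simp
    then show ?thesis
      unfolding T_def e d d2 e2 opp_term_def f(2) edge_letter_def star_path_words_def opp_cond_def
      using f(1) by simp
  qed
  have zero: "T i j = 0" if i: "i < Suc m" and j: "j < Suc m" and ij: "i \<noteq> j" "Suc i \<noteq> j" for i j
  proof -
    have mem: "?a ! l \<in> set (del_nth i ?a)" if "l < Suc m" "l \<noteq> i" for l
    proof (cases "l < i")
      case True
      then have "?a ! l \<in> set (take i ?a)" using that len i by (auto simp: in_set_conv_nth intro!: exI[of _ l])
      then show ?thesis by (simp add: del_nth_def)
    next
      case False
      then have "?a ! l \<in> set (drop (Suc i) ?a)"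
        using that len by (auto simp: in_set_conv_nth intro!: exI[of _ "l - Suc i"])
      then show ?thesis by (simp add: del_nth_def)
    qed
    have "?e j \<in> span (set (del_nth i ?a))"
    proof (cases j)
      case 0
      then show ?thesis using span_base[OF mem[OF j]] ij len by (simp add: star_def)
    next
      case (Suc l)
      have "?a ! j - ?a ! l \<in> span (set (del_nth i ?a))"
        using Suc j ij by (intro span_diff span_base mem) auto
      then show ?thesis using Suc j len by (simp add: star_def)
    qed
    then show ?thesis unfolding T_def b[OF j] by (simp add: opp_cond_def)
  qed
  have "star_path_words h x rs = (\<Sum>i<Suc m. \<Sum>j<Suc m. qscale ((-1) ^ i * (-1) ^ j) (T i j))"
    unfolding star_path_words_def len opp_words_Suc asum_index T_def
    using len by (simp add: rat_free.scale_sum_right del: sum.lessThan_Suc)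
  also have "\<dots> = (\<Sum>i<Suc m. T i i - (if i < m then T i (Suc i) else 0))"
  proof (rule sum.cong[OF refl])
    fix i assume "i \<in> {..<Suc m}"
    then have i: "i < Suc m" by simp
    have "(\<Sum>j<Suc m. qscale ((-1) ^ i * (-1) ^ j) (T i j))
        = (\<Sum>j\<in>{i, Suc i} \<inter> {..<Suc m}. qscale ((-1) ^ i * (-1) ^ j) (T i j))"
      by (rule sum.mono_neutral_right) (use zero[OF i] in auto)
    also have "\<dots> = T i i - (if i < m then T i (Suc i) else 0)"
    proof (cases "i < m")
      case True
      then have "{i, Suc i} \<inter> {..<Suc m} = {i, Suc i}" by auto
      then show ?thesis using True by (simp add: power_add[symmetric] mult_2[symmetric])
    next
      case False
      then have "{i, Suc i} \<inter> {..<Suc m} = {i}" using i by auto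
      then show ?thesis using False by (simp add: power_add[symmetric] mult_2[symmetric])
    qed
    finally show "(\<Sum>j<Suc m. qscale ((-1) ^ i * (-1) ^ j) (T i j)) = T i i - (if i < m then T i (Suc i) else 0)" .
  qed
  also have "\<dots> = (\<Sum>j<Suc m. T j j) - (\<Sum>j<m. T j (Suc j))"
    by (simp add: sum_subtractf)
  also have "(\<Sum>j<Suc m. T j j) = (\<Sum>j<Suc m. edge_letter h (?e j) (star_path_words h x (del_nth j rs)))"
    by (rule sum.cong[OF refl]) (simp add: diag)
  also have "(\<Sum>j<m. T j (Suc j)) = (\<Sum>j<m. edge_letter h (rs ! Suc j - rs ! j) (star_path_words h x (del_nth j rs)))"
    by (rule sum.cong[OF refl]) (simp add: prev)
  finally show ?thesis .
qed

lemma qlinear_edge_letter: "qlinear (edge_letter h y)"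
  by (rule qlinearI) (simp_all add: edge_letter_def lin_ext_add lin_ext_scale)

text \<open>Evaluation of an edge at the normalised difference of its end points. The word is
  reversed because S appends new letters at the end, while \<open>opp_words\<close> puts them in
  front.\<close>

definition edge_words :: "('b \<Rightarrow> 'a) \<Rightarrow> 'b list \<Rightarrow> ((nat \<times> nat) list \<Rightarrow>\<^sub>0 rat) \<Rightarrow> ('b list \<Rightarrow>\<^sub>0 rat)" where
  "edge_words h u = lin_ext (\<lambda>\<iota>. if \<forall>(i, j)\<in>set \<iota>. h (u ! i - u ! j) \<noteq> 0
     then basis_elt (rev (map (\<lambda>(i, j). inverse (h (u ! i - u ! j)) *s (u ! i - u ! j)) \<iota>)) else 0)"

text \<open>The letter y / h(y) does not change under y -> -y, so the ordering of the end points in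
  \<open>edge\<close> is harmless.\<close>

lemma edge_words_mult_letter:
  assumes "Vector_Spaces.linear scale (*) h"
  shows "edge_words h u (mult_letter p (edge i j)) = edge_letter h (u ! j - u ! i) (edge_words h u p)"
proof -
  interpret h: Vector_Spaces.linear scale "(*)" h by (rule assms)
  let ?y = "u ! j - u ! i"
  have neg: "u ! i - u ! j = - ?y" by simp
  have nrm: "inverse (h (- y)) *s (- y) = inverse (h y) *s y" for y by (simp add: h.neg)
  obtain k l where kl: "edge i j = (k, l)" and y: "h (u ! k - u ! l) = 0 \<longleftrightarrow> h ?y = 0"
    "inverse (h (u ! k - u ! l)) *s (u ! k - u ! l) = inverse (h ?y) *s ?y"
  proof (cases "i \<le> j")
    case True
    show ?thesis
      by (rule that[of i j]) (use True nrm[of ?y] in \<open>simp_all add: edge_def neg h.neg del: minus_diff_eq\<close>)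
  next
    case False
    show ?thesis by (rule that[of j i]) (use False in \<open>simp_all add: edge_def\<close>)
  qed
  let ?W = "\<lambda>\<iota>. if \<forall>(i, j)\<in>set \<iota>. h (u ! i - u ! j) \<noteq> 0
     then basis_elt (rev (map (\<lambda>(i, j). inverse (h (u ! i - u ! j)) *s (u ! i - u ! j)) \<iota>)) else 0"
  have "edge_words h u (mult_letter p (edge i j)) = lin_ext (\<lambda>\<iota>. edge_letter h ?y (?W \<iota>)) p"
    unfolding edge_words_def mult_letter_def lin_ext_lin_ext lin_ext_basis kl edge_letter_def
    by (rule lin_ext_cong) (simp add: y)
  also have "\<dots> = edge_letter h ?y (edge_words h u p)"
    unfolding edge_words_def by (rule qlinear_lin_ext_comp[OF qlinear_edge_letter, symmetric])
  finally show ?thesis .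
qed

text \<open>The recursion of S(s_0, ..., s_n) is \<open>star_path_words_rec\<close> for the path
  s_0, s_n, ..., s_1: removing s_i goes with its arriving edge, from s_(i+1), with sign +, removing
  s_(i+1) goes with its leaving edge, to s_i, with sign -. The separate first term is the initial
  edge from s_0 to s_n.\<close>

lemma edge_words_S_poly:
  assumes "Vector_Spaces.linear scale (*) h" "length s = Suc (Suc m)"
    "indep_list (star (u ! (s ! 0)) (rev (map ((!) u) (tl s))))"
  shows "edge_words h u (S_poly s) = star_path_words h (u ! (s ! 0)) (rev (map ((!) u) (tl s)))"
  using assms(2,3)
proof (induction m arbitrary: s)
  case 0
  have s: "s = [s ! 0, s ! 1]" using 0(1) by (intro nth_equalityI) (auto simp: nth_Cons split: nat.split)
  have "S_poly s = mult_letter (basis_elt []) (edge (s ! 0) (s ! 1))"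
    using 0(1) by (subst S_poly.simps) (simp add: mult_letter_def)
  then have "edge_words h u (S_poly s) = edge_letter h (u ! (s ! 1) - u ! (s ! 0)) (basis_elt [])"
    by (simp add: edge_words_mult_letter[OF assms(1)]) (simp add: edge_words_def)
  moreover have "rev (map ((!) u) (tl s)) = [u ! (s ! 1)]" by (subst s) simp
  moreover have "star_path_words h (u ! (s ! 0)) [u ! (s ! 1)]
      = edge_letter h (u ! (s ! 1) - u ! (s ! 0)) (basis_elt [])"
    using star_path_words_rec[of "u ! (s ! 0)" "[u ! (s ! 1)]" 0 h] 0(2) calculation(2)
    by (simp add: star_path_words_def[of _ _ "[]"])
  ultimately show ?case by simp
next
  case (Suc m)
  let ?x = "u ! (s ! 0)" and ?N = "Suc (Suc m)"
  define rs where "rs = rev (map ((!) u) (tl s))"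
  have len: "length rs = ?N" and ls: "length s = Suc ?N" using Suc.prems(1) by (simp_all add: rs_def)
  have ind: "indep_list (star ?x rs)" using Suc.prems(2) by (simp add: rs_def)
  have nth: "rs ! j = u ! (s ! (?N - j))" if "j < ?N" for j
    using that ls by (simp add: rs_def rev_nth nth_tl Suc_diff_le)
  have IH: "edge_words h u (S_poly (del_nth i s)) = star_path_words h ?x (del_nth (?N - i) rs)"
    if i: "1 \<le> i" "i \<le> ?N" for i
  proof -
    obtain i' where i': "i = Suc i'" using i(1) by (cases i) auto
    have hd: "del_nth i s ! 0 = s ! 0" using ls i' by (cases s) auto
    have tl: "rev (map ((!) u) (tl (del_nth i s))) = del_nth (?N - i) rs"
    proof -
      have "tl (del_nth i s) = del_nth i' (tl s)" unfolding i' using ls by (intro tl_del_nth) auto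
      then have "rev (map ((!) u) (tl (del_nth i s))) = rev (del_nth i' (map ((!) u) (tl s)))"
        by (simp add: del_nth_map)
      also have "\<dots> = del_nth (?N - i) rs"
        using i i' ls by (subst rev_del_nth) (simp_all add: rs_def)
      finally show ?thesis .
    qed
    have "indep_list (star ?x (del_nth (?N - i) rs))"
    proof -
      have "star ?x rs = take (?N - i) (star ?x rs) @ star ?x rs ! (?N - i) # drop (Suc (?N - i)) (star ?x rs)"
        using len i by (intro id_take_nth_drop) simp
      then have "indep_list (take (?N - i) (star ?x rs) @ drop (Suc (?N - i)) (star ?x rs))"
        using ind indep_list_insert by metis
      then show ?thesis by (simp add: star_def del_nth_def take_map drop_map)
    qed
    moreover have "length (del_nth i s) = Suc (Suc m)" using ls i by (simp add: length_del_nth)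
    ultimately show ?thesis using Suc.IH[of "del_nth i s"] hd tl by simp
  qed
  have comm: "edge i j = edge j i" for i j by (simp add: edge_def min.commute max.commute)
  have S: "S_poly s = mult_letter (S_poly (del_nth ?N s)) (edge (s ! 0) (s ! ?N))
       - (\<Sum>i\<in>{1..Suc m}. mult_letter (S_poly (del_nth (i + 1) s)) (edge (s ! (i + 1)) (s ! i)))
       + (\<Sum>i\<in>{1..Suc m}. mult_letter (S_poly (del_nth i s)) (edge (s ! (i + 1)) (s ! i)))"
    using ls by (subst S_poly.simps) (simp add: comm[of "s ! Suc _"] Let_def del: sum.cl_ivl_Suc)
  let ?E = "edge_words h u"
  have lin: "qlinear ?E" unfolding edge_words_def by (rule qlinear_lin_ext)
  have 0: "?E (mult_letter (S_poly (del_nth ?N s)) (edge (s ! 0) (s ! ?N)))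
      = edge_letter h (rs ! 0 - ?x) (star_path_words h ?x (del_nth 0 rs))"
    unfolding edge_words_mult_letter[OF assms(1)] using IH[of ?N] nth[of 0] by simp
  \<comment> \<open>\<open>rs\<close> runs backwards: place j holds the point of s_(?N - j). So the
    edge between s_i and s_(i+1) joins the places Suc m - i and Suc m - i + 1.\<close>
  have 1: "(\<Sum>i\<in>{1..Suc m}. ?E (mult_letter (S_poly (del_nth (i + 1) s)) (edge (s ! (i + 1)) (s ! i))))
      = (\<Sum>j<Suc m. edge_letter h (rs ! Suc j - rs ! j) (star_path_words h ?x (del_nth j rs)))"
  proof (rule sum.reindex_bij_witness[of _ "\<lambda>j. Suc m - j" "\<lambda>i. Suc m - i"])
    fix i assume i: "i \<in> {1..Suc m}"
    then have e: "Suc (Suc m - i) < ?N" "Suc m - i < ?N" "?N - Suc (Suc m - i) = i" "?N - (Suc m - i) = i + 1"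
      "?N - (i + 1) = Suc m - i" by auto
    show "edge_letter h (rs ! Suc (Suc m - i) - rs ! (Suc m - i)) (star_path_words h ?x (del_nth (Suc m - i) rs)) =
      ?E (mult_letter (S_poly (del_nth (i + 1) s)) (edge (s ! (i + 1)) (s ! i)))"
      unfolding edge_words_mult_letter[OF assms(1)] nth[OF e(1)] nth[OF e(2)] e(3,4)
      using IH[of "i + 1"] i unfolding e(5) by simp
  qed auto
  have 2: "(\<Sum>i\<in>{1..Suc m}. ?E (mult_letter (S_poly (del_nth i s)) (edge (s ! (i + 1)) (s ! i))))
      = (\<Sum>j<Suc m. edge_letter h (rs ! Suc j - rs ! j) (star_path_words h ?x (del_nth (Suc j) rs)))"
  proof (rule sum.reindex_bij_witness[of _ "\<lambda>j. Suc m - j" "\<lambda>i. Suc m - i"])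
    fix i assume i: "i \<in> {1..Suc m}"
    then have e: "Suc (Suc m - i) < ?N" "Suc m - i < ?N" "?N - Suc (Suc m - i) = i" "?N - (Suc m - i) = i + 1"
      "?N - i = Suc (Suc m - i)" by auto
    show "edge_letter h (rs ! Suc (Suc m - i) - rs ! (Suc m - i)) (star_path_words h ?x (del_nth (Suc (Suc m - i)) rs)) =
      ?E (mult_letter (S_poly (del_nth i s)) (edge (s ! (i + 1)) (s ! i)))"
      unfolding edge_words_mult_letter[OF assms(1)] nth[OF e(1)] nth[OF e(2)] e(3,4)
      using IH[of i] i unfolding e(5) by simp
  qed auto
  have "?E (S_poly s) = edge_letter h (rs ! 0 - ?x) (star_path_words h ?x (del_nth 0 rs))
      - (\<Sum>j<Suc m. edge_letter h (rs ! Suc j - rs ! j) (star_path_words h ?x (del_nth j rs)))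
      + (\<Sum>j<Suc m. edge_letter h (rs ! Suc j - rs ! j) (star_path_words h ?x (del_nth (Suc j) rs)))"
    unfolding S qlinear_add'[OF lin] qlinear_diff[OF lin] qlinear_sum[OF lin] 0 1 2 ..
  also have "\<dots> = star_path_words h ?x rs"
    unfolding star_path_words_rec[OF ind len] sum.lessThan_Suc_shift[of _ "Suc m"] by simp
  finally show ?case unfolding rs_def .
qed

end

context fd_correlator_space
begin

lemma affine_basis_Cons: "affine_basis (x # vs) \<longleftrightarrow> indep_list (star x (rev vs)) \<and> length vs = n"
  using indep_list_mset[of "star x (rev vs)" "star x vs"]
  by (simp add: affine_basis_def basis_list_iff star_def)

lemma D_map_eq_FC_words:
  assumes "Vector_Spaces.linear scale (*) h" "affine_basis (x # vs)"
  shows "D_map h (x # vs) = FC_words (opp_words h n (star x (rev vs)) (path_edges x (rev vs)))"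
proof -
  let ?u = "x # vs"
  let ?c = "\<lambda>\<iota>. \<forall>(i, j)\<in>set \<iota>. h (?u ! i - ?u ! j) \<noteq> 0"
  let ?w = "\<lambda>\<iota>. map (\<lambda>(i, j). inverse (h (?u ! i - ?u ! j)) *s (?u ! i - ?u ! j)) \<iota>"
  let ?S = "S_poly [0..<n + 1]"
  have len: "length vs = n" and ind: "indep_list (star x (rev vs))"
    using assms(2) by (simp_all add: affine_basis_Cons)
  have "D_map h ?u = (\<Sum>\<iota>\<in>Poly_Mapping.keys ?S \<inter> {\<iota>. ?c \<iota>}. qscale (Poly_Mapping.lookup ?S \<iota>) (basis_elt (0 # ?w \<iota>)))"
    unfolding D_map_def Let_def T_set_def T_sign_def using len by (simp add: Int_def del: upt_Suc)
  also have "\<dots> = (\<Sum>\<iota>\<in>Poly_Mapping.keys ?S. if ?c \<iota> then qscale (Poly_Mapping.lookup ?S \<iota>) (basis_elt (0 # ?w \<iota>)) else 0)"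
    by (subst sum.inter_restrict) (auto intro!: sum.cong)
  also have "\<dots> = lin_ext (\<lambda>\<iota>. if ?c \<iota> then basis_elt (0 # ?w \<iota>) else 0) ?S"
    unfolding lin_ext_def by (rule sum.cong[OF refl]) simp
  also have "\<dots> = FC_words (edge_words h ?u ?S)"
    unfolding FC_words_def edge_words_def lin_ext_lin_ext by (rule lin_ext_cong) simp
  also have "edge_words h ?u ?S = star_path_words h x (rev vs)"
  proof -
    define s where "s = [0..<n + 1]"
    have "s ! 0 = 0" "length s = Suc (Suc (n - 1))" using n_pos by (simp_all add: s_def nth_upt del: upt_Suc)
    moreover have "map ((!) ?u) (tl s) = vs"
      by (rule nth_equalityI) (use len in \<open>auto simp: s_def nth_tl simp del: upt_Suc\<close>)
    ultimately show ?thesis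
      using edge_words_S_poly[OF assms(1), of s "n - 1" ?u] ind unfolding s_def[symmetric] by simp
  qed
  finally show ?thesis using len by (simp add: star_path_words_def)
qed

lemma opp_pairing_C_rep:
  assumes "Vector_Spaces.linear scale (*) h" "affine_basis u"
  shows "FC_words (opp_pairing h (C_rep u)) = qscale (opp_sign n) (D_map h u)"
proof -
  obtain x vs where u: "u = x # vs" using assms(2) by (cases u) (auto simp: affine_basis_def)
  have ind: "indep_list (star x (rev vs))" and len: "length vs = n"
    using assms(2) by (simp_all add: u affine_basis_Cons)
  have ne: "vs \<noteq> []" using len n_pos by auto
  have "basis_list (star x (rev vs))" "basis_list (path_edges x (rev vs))"
    using ind indep_path_edges[OF ind] len by (simp_all add: basis_list_iff)
  from opp_pairing_apartments[OF assms(1) this] show ?thesis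
    using D_map_eq_FC_words[OF assms(1) assms(2)[unfolded u]]
    by (simp add: u C_rep_eq_C_path[OF ne] C_path_def FC_words_def lin_ext_scale)
qed

text \<open>The Steinberg relation for \<open>rs\<close>, \<open>y\<close>, \<open>a\<close>.
  Omitting an entry of \<open>rs\<close> leaves \<open>y\<close> together with all of
  \<open>a\<close>, which is dependent.\<close>

lemma apartment_expand_first:
  assumes "indep_list (rs @ a)" "length (rs @ a) = n" "y \<in> span (set a)" "y \<noteq> 0"
  shows "apartment (rs @ a) = asum (\<lambda>x r. apartment (rs @ y # r)) a"
proof -
  have "asum (\<lambda>_. apartment) (rs @ y # a) = 0"
    using assms indep_list_nonzero[OF assms(1)] by (intro asum_apartment_eq_0) auto
  moreover have "asum (\<lambda>_ r. apartment (r @ y # a)) rs = 0"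
  proof (rule asum_eq_0)
    fix as x bs
    have "y \<in> span (set ((as @ bs) @ a))" using assms(3) span_mono[of "set a" "set ((as @ bs) @ a)"] by auto
    then have "\<not> indep_list ((as @ bs) @ y # a)" unfolding indep_list_insert by blast
    then show "apartment ((as @ bs) @ y # a) = 0" by (simp add: apartment_def basis_list_iff)
  qed
  ultimately have "qscale ((-1) ^ length rs) (apartment (rs @ a) - asum (\<lambda>x r. apartment (rs @ y # r)) a) = 0"
    by (simp add: asum_append)
  then have "qscale ((-1) ^ length rs) (qscale ((-1) ^ length rs) (apartment (rs @ a) - asum (\<lambda>x r. apartment (rs @ y # r)) a)) = 0"
    by (simp only: rat_free.scale_zero_right)
  then show ?thesis by simp
qed

text \<open>The projection relation with value 0 on \<open>Q\<close>, value 1 on \<open>e\<close>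
  and the values of \<open>h\<close> on \<open>b\<close>; \<open>y0\<close> provides the second
  nonzero value. The value 1 is formal and need not be \<open>h e\<close>: in the application
  \<open>e\<close> is the letter chosen last, or 0 at the beginning.\<close>

lemma apartment_expand_proj:
  assumes "length (Q @ b) = n" "y0 \<in> set b" "h y0 \<noteq> 0"
  shows "apartment (Q @ map (\<lambda>z. z - h z *s e) b) = asum (\<lambda>y t. if h y \<noteq> 0
    then apartment (Q @ (y - h y *s e) # map (\<lambda>z. z - (h z / h y) *s y) t) else 0) b"
proof -
  let ?Q = "map (\<lambda>q. (q, 0 :: 'a)) Q" and ?b = "map (\<lambda>y. (y, h y)) b"
  let ?L = "?Q @ (e, 1) # ?b"
  let ?F = "\<lambda>p r. if snd p \<noteq> 0 then apartment (map (proj_along p) r) else 0"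
  let ?G = "\<lambda>y t. if h y \<noteq> 0 then apartment (Q @ (y - h y *s e) # map (\<lambda>z. z - (h z / h y) *s y) t) else 0"
  have Qp: "map (proj_along p) ?Q = Q" for p by (simp add: proj_along_def comp_def)
  have "filter (\<lambda>p. snd p \<noteq> 0) ?b \<noteq> []" using assms(2,3) by (auto simp: filter_empty_conv)
  then have "Suc 0 \<le> length (filter (\<lambda>p. snd p \<noteq> 0) ?b)" by (cases "filter (\<lambda>p. snd p \<noteq> 0) ?b") auto
  then have 0: "asum ?F ?L = 0" using assms(1) by (intro asum_proj_along_eq_0) auto
  have "asum (\<lambda>p r. ?F p (r @ (e, 1) # ?b)) ?Q = 0"
    by (rule asum_eq_0) (auto simp: map_eq_append_conv)
  then have "qscale ((-1) ^ length Q) (asum (\<lambda>p r. ?F p (?Q @ r)) ((e, 1) # ?b)) = 0"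
    using 0 unfolding asum_append[of ?F ?Q] by simp
  then have "qscale ((-1) ^ length Q) (qscale ((-1) ^ length Q) (asum (\<lambda>p r. ?F p (?Q @ r)) ((e, 1) # ?b))) = 0"
    by (simp only: rat_free.scale_zero_right)
  then have "asum (\<lambda>p r. ?F p (?Q @ r)) ((e, 1) # ?b) = 0" by simp
  then have "apartment (Q @ map (proj_along (e, 1)) ?b) = asum (\<lambda>p r. ?F p (?Q @ (e, 1) # r)) ?b"
    by (simp add: Qp del: map_map)
  also have "map (proj_along (e, 1)) ?b = map (\<lambda>z. z - h z *s e) b"
    by (simp add: proj_along_def comp_def)
  also have "asum (\<lambda>p r. ?F p (?Q @ (e, 1) # r)) ?b = asum ?G b"
    unfolding asum_map
  proof (rule asum_cong)
    fix bs y bs' assume "b = bs @ y # bs'"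
    show "?F (y, h y) (?Q @ (e, 1) # map (\<lambda>y. (y, h y)) (bs @ bs')) = ?G y (bs @ bs')"
    proof (cases "h y = 0")
      case False
      have "list_all2 proportional Z Z" for Z
        by (rule list.rel_refl, rule exI[of _ 1], simp)
      moreover have "proportional (e - (1 / h y) *s y) (y - h y *s e)"
        using False by (intro exI[of _ "- h y"]) (simp add: scale_right_diff_distrib)
      ultimately have "apartment (Q @ (e - (1 / h y) *s y) # map (\<lambda>z. z - (h z / h y) *s y) (bs @ bs'))
         = apartment (Q @ (y - h y *s e) # map (\<lambda>z. z - (h z / h y) *s y) (bs @ bs'))"
        by (intro apartment_proportional list_all2_appendI list.rel_intros)
      moreover have "map (proj_along (y, h y)) (?Q @ (e, 1) # map (\<lambda>y. (y, h y)) (bs @ bs'))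
        = Q @ (e - (1 / h y) *s y) # map (\<lambda>z. z - (h z / h y) *s y) (bs @ bs')"
        by (simp add: proj_along_def comp_def)
      ultimately show ?thesis unfolding snd_conv if_P[OF False] by (simp only:)
    qed simp
  qed
  finally show ?thesis .
qed

text \<open>Iterating the two expansions, the pair of flags is moved into general position line by line;
  it becomes decomposable as soon as \<open>h\<close> vanishes on the remaining complement.\<close>

lemma apartments_eq_C_path_mod_decomposables:
  assumes "nonzero_functional h" "indep_list (rs @ a)" "length rs + k = n" "length a = k" "length b = k"
    "set b \<subseteq> span (set a)"
  shows "tensor (apartment (rs @ a)) (apartment (path_edges 0 rs @ map (\<lambda>z. z - h z *s last (0 # rs)) b))
    - lin_ext (\<lambda>w. C_path 0 (rs @ w)) (opp_words h k a b) \<in> decomposables"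
  using assms(2-)
proof (induction k arbitrary: rs a b)
  case 0
  have "star 0 rs = rs" by (simp add: star_def)
  then show ?case using 0 decomposables_subspace
    by (simp add: C_path_def rat_free.subspace_0[OF decomposables_subspace])
next
  case (Suc k)
  have lin: "Vector_Spaces.linear scale (*) h" and hnz: "\<exists>v. h v \<noteq> 0"
    using assms(1) by (auto simp: nonzero_functional_def)
  interpret h: Vector_Spaces.linear scale "(*)" h by (rule lin)
  let ?o = "last (0 # rs)" and ?Q = "path_edges 0 rs"
  show ?case
  proof (cases "\<exists>y\<in>set b. h y \<noteq> 0")
    case False
    then have h0: "h y = 0" if "y \<in> set b" for y using that by blast
    have "opp_words h (Suc k) a b = 0" unfolding opp_words_Suc
      by (intro asum_eq_0) (simp add: opp_cond_def h0)
    moreover have "map (\<lambda>z. z - h z *s ?o) b = b" by (rule map_idI) (simp add: h0)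
    moreover have "tensor (apartment (rs @ a)) (apartment (?Q @ b)) \<in> decomposables"
    proof (cases "rs = []")
      case False
      show ?thesis
      proof (rule tensor_in_decomposables)
        show "set ?Q \<subseteq> span (set rs)" using path_edges_in_span_star[of 0 rs] by (simp add: star_def)
      qed (use False Suc.prems in auto)
    next
      \<comment> \<open>No letter has been chosen yet, so there is nothing to split off; but then
        \<open>b\<close> lies in the kernel of a nonzero functional and its apartment is 0.\<close>
      case True
      have "\<not> basis_list b"
      proof
        assume "basis_list b"
        then have sp: "span (set b) = UNIV" by (simp add: basis_list_def)
        have "h v = 0" for v
        proof -
          have "v \<in> span (set b)" using sp by simp
          then show ?thesis
            by (induction rule: span_induct_alt) (simp_all add: h.zero h.add h.scale h0)
        qed
        then show False using hnz by blast
      qed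
      then show ?thesis using True
        by (simp add: apartment_def rat_free.subspace_0[OF decomposables_subspace])
    qed
    ultimately show ?thesis by simp
  next
    case True
    then obtain y0 where y0: "y0 \<in> set b" "h y0 \<noteq> 0" by blast
    let ?y = "\<lambda>y. inverse (h y) *s y"
    let ?A = "\<lambda>y r. apartment ((rs @ [?y y]) @ r)"
    let ?B = "\<lambda>y t. apartment (path_edges 0 (rs @ [?y y]) @ map (\<lambda>z. z - (h z / h y) *s y) t)"
    let ?t = "\<lambda>y r t. map (proj_span (span (set r)) y) t"
    have refl2: "list_all2 proportional Z Z" for Z
      by (rule list.rel_refl, rule exI[of _ 1], simp)
    have lenb: "length (?Q @ b) = n" using Suc.prems by simp
    have "tensor (apartment (rs @ a)) (apartment (?Q @ map (\<lambda>z. z - h z *s ?o) b))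
        = asum (\<lambda>y t. tensor (apartment (rs @ a)) (if h y \<noteq> 0 then
           apartment (?Q @ (y - h y *s ?o) # map (\<lambda>z. z - (h z / h y) *s y) t) else 0)) b"
      unfolding apartment_expand_proj[where Q = ?Q and b = b and h = h and e = "?o", OF lenb y0] asum_linear[OF qlinear_tensor_right] ..
    also have "\<dots> = asum (\<lambda>y t. asum (\<lambda>x r. if opp_cond h r y then tensor (?A y r) (?B y t) else 0) a) b"
    proof (rule asum_cong)
      fix bs y bs' assume b: "b = bs @ y # bs'"
      let ?t' = "bs @ bs'"
      show "tensor (apartment (rs @ a)) (if h y \<noteq> 0 then
           apartment (?Q @ (y - h y *s ?o) # map (\<lambda>z. z - (h z / h y) *s y) ?t') else 0)
          = asum (\<lambda>x r. if opp_cond h r y then tensor (?A y r) (?B y ?t') else 0) a"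
      proof (cases "h y = 0")
        case True
        have "asum (\<lambda>x r. if opp_cond h r y then tensor (?A y r) (?B y ?t') else 0) a = 0"
          by (rule asum_eq_0) (simp add: opp_cond_def True)
        then show ?thesis using True by simp
      next
        case False
        have ya: "y \<in> span (set a)" using Suc.prems(5) b by auto
        have ynz: "y \<noteq> 0" using False h.zero by auto
        have "proportional (y - h y *s ?o) (?y y - ?o)"
          using False by (intro exI[of _ "inverse (h y)"]) (simp add: scale_right_diff_distrib)
        then have "apartment (?Q @ (y - h y *s ?o) # map (\<lambda>z. z - (h z / h y) *s y) ?t')
            = apartment (?Q @ (?y y - ?o) # map (\<lambda>z. z - (h z / h y) *s y) ?t')"
          by (intro apartment_proportional list_all2_appendI list.rel_intros refl2)
        then have B: "apartment (?Q @ (y - h y *s ?o) # map (\<lambda>z. z - (h z / h y) *s y) ?t') = ?B y ?t'"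
          by simp
        have "apartment (rs @ a) = asum (\<lambda>x r. apartment (rs @ y # r)) a"
          using Suc.prems by (intro apartment_expand_first ya ynz) auto
        also have "\<dots> = asum (\<lambda>x r. if opp_cond h r y then ?A y r else 0) a"
        proof (rule asum_cong)
          fix as :: "'b list" and x and as' :: "'b list"
          let ?r = "as @ as'"
          have "proportional y (?y y)" using False by (intro exI[of _ "inverse (h y)"]) simp
          then have "apartment (rs @ y # ?r) = apartment (rs @ ?y y # ?r)"
            by (intro apartment_proportional list_all2_appendI list.rel_intros refl2)
          moreover have "apartment (rs @ y # ?r) = 0" if "y \<in> span (set ?r)"
          proof -
            have "y \<in> span (set (rs @ ?r))" using that span_mono[of "set ?r" "set (rs @ ?r)"] by auto
            then have "\<not> indep_list (rs @ y # ?r)" unfolding indep_list_insert by blast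
            then show ?thesis by (simp add: apartment_def basis_list_iff)
          qed
          ultimately show "apartment (rs @ y # ?r) = (if opp_cond h ?r y then ?A y ?r else 0)"
            using False by (auto simp: opp_cond_def)
        qed
        finally have "tensor (apartment (rs @ a)) (?B y ?t')
            = asum (\<lambda>x r. tensor (if opp_cond h r y then ?A y r else 0) (?B y ?t')) a"
          by (simp only: asum_linear[OF qlinear_tensor_left])
        also have "\<dots> = asum (\<lambda>x r. if opp_cond h r y then tensor (?A y r) (?B y ?t') else 0) a"
          by (rule asum_cong) simp
        finally show ?thesis using False B by simp
      qed
    qed
    also have "\<dots> = asum (\<lambda>x r. asum (\<lambda>y t. if opp_cond h r y then tensor (?A y r) (?B y t) else 0) b) a"
      by (rule asum_commute)
    finally have 1: "tensor (apartment (rs @ a)) (apartment (?Q @ map (\<lambda>z. z - h z *s ?o) b)) = \<dots>" .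
    let ?C = "\<lambda>y. lin_ext (\<lambda>w. C_path 0 ((rs @ [?y y]) @ w))"
    have if_lin: "T (if P then x else 0) = (if P then T x else 0)" if "qlinear T"
      for T :: "('b list \<Rightarrow>\<^sub>0 rat) \<Rightarrow> ('b set list \<times> 'b set list \<Rightarrow>\<^sub>0 rat)" and P x
      using that by (simp add: qlinear_0)
    have 2: "lin_ext (\<lambda>w. C_path 0 (rs @ w)) (opp_words h (Suc k) a b)
        = asum (\<lambda>x r. asum (\<lambda>y t. if opp_cond h r y then ?C y (opp_term h k r y t) else 0) b) a"
      unfolding opp_words_Suc asum_linear[OF qlinear_lin_ext] if_lin[OF qlinear_lin_ext] lin_ext_lin_ext
        lin_ext_basis append_assoc append_Cons append_Nil ..
    have 3: "(if opp_cond h r y then tensor (?A y r) (?B y t) else 0)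
        - (if opp_cond h r y then ?C y (opp_term h k r y t) else 0) \<in> decomposables"
      if a: "a = as @ x # as'" "r = as @ as'" and b: "b = bs @ y # bs'" "t = bs @ bs'" for as x as' r bs y bs' t
    proof (cases "opp_cond h r y")
      case False
      then show ?thesis by (simp add: rat_free.subspace_0[OF decomposables_subspace])
    next
      case True
      then have y: "y \<notin> span (set r)" and hy: "h y \<noteq> 0" by (auto simp: opp_cond_def)
      have ia: "indep_list ((as @ x # as') @ rs)"
        using Suc.prems(1) indep_list_mset[of "a @ rs" "rs @ a"] a by simp
      have ya: "y \<in> span (set (as @ x # as'))" using Suc.prems(5) a b by auto
      have Qs: "set (rs @ r) = set (as @ as') \<union> set rs" using a by auto
      note pc = proj_span_complement[OF ia ya Qs]
      have yQ: "y \<notin> span (set (rs @ r))" using pc(1) y a by simp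
      have irs: "indep_list (rs @ r)" using Suc.prems(1) indep_list_insert[of "rs @ as" x as'] a by simp
      have "?y y \<notin> span (set (rs @ r))"
      proof
        assume "?y y \<in> span (set (rs @ r))"
        from span_scale[OF this, of "h y"] show False using yQ hy by simp
      qed
      then have i: "indep_list ((rs @ [?y y]) @ r)" using irs by (simp add: indep_list_insert)
      \<comment> \<open>The normalised letter has \<open>h\<close> equal to 1. Projecting along
        \<open>y\<close> to the hyperplane and then along \<open>y\<close> to the kernel of
        \<open>h\<close> is projecting to that kernel at once, which matches the vectors of
        \<open>opp_words\<close> with those of \<open>apartment_expand_proj\<close>.\<close>
      have lift: "proj_span (span (set r)) y z - h (proj_span (span (set r)) y z) *s ?y y = z - (h z / h y) *s y" for z
      proof -
        obtain c where c: "proj_span (span (set r)) y z = z - c *s y" by (auto simp: proj_span_def)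
        have "(h z - c * h y) * inverse (h y) = h z / h y - c" using hy by (simp add: field_simps)
        then show ?thesis unfolding c by (simp add: h.diff h.scale scale_left_diff_distrib)
      qed
      have "tensor (?A y r) (apartment (path_edges 0 (rs @ [?y y]) @
          map (\<lambda>z. z - h z *s last (0 # rs @ [?y y])) (?t y r t)))
        - ?C y (opp_words h k r (?t y r t)) \<in> decomposables"
      proof (rule Suc.IH[OF i])
        show "set (?t y r t) \<subseteq> span (set r)"
        proof
          fix w assume "w \<in> set (?t y r t)"
          then obtain z where z: "z \<in> set t" "w = proj_span (span (set r)) y z" by auto
          have "z \<in> span (set (as @ x # as'))" using z(1) Suc.prems(5) a b by auto
          from pc(4)[OF yQ this] show "w \<in> span (set r)" using z(2) a(2) by simp
        qed
      qed (use Suc.prems a b in auto)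
      moreover have "map (\<lambda>z. z - h z *s last (0 # rs @ [?y y])) (?t y r t) = map (\<lambda>z. z - (h z / h y) *s y) t"
        using lift by simp
      ultimately have "tensor (?A y r) (?B y t) - ?C y (opp_term h k r y t) \<in> decomposables"
        unfolding opp_term_def by argo
      then show ?thesis unfolding if_P[OF True] .
    qed
    show ?thesis unfolding 1 2 asum_diff[symmetric]
      by (rule asum_in_subspace[OF decomposables_subspace], rule asum_in_subspace[OF decomposables_subspace])
         (rule 3[OF _ refl _ refl])
  qed
qed

lemma opp_words_affine:
  assumes "Vector_Spaces.linear scale (*) h" "affine_basis (x # vs)"
  shows "opp_words h n (star x (rev vs)) (path_edges x (rev vs)) \<in> free_on {w. indep_list w \<and> length w = n}"
proof -
  have ind: "indep_list (star x (rev vs))" and len: "length vs = n"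
    using assms(2) by (simp_all add: affine_basis_Cons)
  have "opp_words h n (star x (rev vs)) (path_edges x (rev vs)) \<in>
    free_on {w. indep_list w \<and> length w = n \<and> set w \<subseteq> span (set (star x (rev vs))) \<and> (\<forall>v\<in>set w. h v = 1)}"
    using len by (intro opp_words_in_free_on[OF assms(1) ind path_edges_in_span_star]) auto
  then show ?thesis by (auto simp: free_on_def)
qed

lemma D_map_in_free_on:
  assumes "nonzero_functional h" "affine_basis u"
  shows "D_map h u \<in> free_on {u. affine_basis u}"
proof -
  obtain x vs where u: "u = x # vs" using assms(2) by (cases u) (auto simp: affine_basis_def)
  have lin: "Vector_Spaces.linear scale (*) h" using assms(1) by (simp add: nonzero_functional_def)
  show ?thesis unfolding u D_map_eq_FC_words[OF lin assms(2)[unfolded u]] FC_words_def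
  proof (rule lin_ext_in_subspace[OF free_on_subspace])
    fix w assume "w \<in> Poly_Mapping.keys (opp_words h n (star x (rev vs)) (path_edges x (rev vs)))"
    from in_free_onD[OF opp_words_affine[OF lin assms(2)[unfolded u]] this]
    have "indep_list (rev w)" "length (rev w) = n" using indep_list_mset[of "rev w" w] by simp_all
    then show "basis_elt (0 # rev w) \<in> free_on {u. affine_basis u}" by (simp add: affine_basis_zero)
  qed
qed

lemma C_rep_minus_D_map:
  assumes "nonzero_functional h" "affine_basis u"
  shows "C_rep u - lin_ext C_rep (D_map h u) \<in> decomposables"
proof -
  obtain x vs where u: "u = x # vs" using assms(2) by (cases u) (auto simp: affine_basis_def)
  have lin: "Vector_Spaces.linear scale (*) h" using assms(1) by (simp add: nonzero_functional_def)
  have ind: "indep_list (star x (rev vs))" and len: "length vs = n"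
    using assms(2) by (simp_all add: u affine_basis_Cons)
  have ne: "vs \<noteq> []" using len n_pos by auto
  let ?a = "star x (rev vs)" and ?b = "path_edges x (rev vs)"
  \<comment> \<open>Start of the expansion: no letters are chosen, and the vector subtracted is a
    multiple of 0.\<close>
  have "tensor (apartment ([] @ ?a)) (apartment (path_edges 0 [] @ map (\<lambda>z. z - h z *s last (0 # [])) ?b))
    - lin_ext (\<lambda>w. C_path 0 ([] @ w)) (opp_words h n ?a ?b) \<in> decomposables"
    using ind len by (intro apartments_eq_C_path_mod_decomposables[OF assms(1)] path_edges_in_span_star) auto
  moreover have "lin_ext C_rep (D_map h u) = lin_ext (\<lambda>w. C_path 0 ([] @ w)) (opp_words h n ?a ?b)"
    unfolding u D_map_eq_FC_words[OF lin assms(2)[unfolded u]] FC_words_def lin_ext_lin_ext lin_ext_basis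
  proof (rule lin_ext_cong)
    fix w assume "w \<in> Poly_Mapping.keys (opp_words h n ?a ?b)"
    from in_free_onD[OF opp_words_affine[OF lin assms(2)[unfolded u]] this]
    have "rev w \<noteq> []" using n_pos by auto
    then show "C_rep (0 # rev w) = C_path 0 ([] @ w)" by (simp add: C_rep_eq_C_path)
  qed
  ultimately show ?thesis by (simp add: u C_rep_eq_C_path[OF ne] C_path_def)
qed

lemma FCR_lift_subspace: "rat_free.subspace FCR_lift"
  unfolding FCR_lift_def rat_free.subspace_def
  using decomposables_subspace free_on_subspace[of "{u. affine_basis u}"]
  by (auto simp: rat_free.subspace_def lin_ext_add lin_ext_scale)

lemma basis_minus_D_map_in_FCR_lift:
  assumes "nonzero_functional h" "affine_basis u"
  shows "basis_elt u - D_map h u \<in> FCR_lift"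
  unfolding FCR_lift_def
proof (intro CollectI conjI)
  show "basis_elt u - D_map h u \<in> free_on {u. affine_basis u}"
    by (rule rat_free.subspace_diff[OF free_on_subspace _ D_map_in_free_on[OF assms]]) (simp add: assms(2))
  show "lin_ext C_rep (basis_elt u - D_map h u) \<in> decomposables"
    using C_rep_minus_D_map[OF assms] by (simp add: lin_ext_diff)
qed

lemma lin_ext_D_map_in_FC_rel:
  assumes "nonzero_functional h" "p \<in> FCR_lift"
  shows "lin_ext (D_map h) p \<in> FC_rel"
proof -
  have lin: "Vector_Spaces.linear scale (*) h" using assms(1) by (simp add: nonzero_functional_def)
  have p: "p \<in> free_on {u. affine_basis u}" "lin_ext C_rep p \<in> decomposables"
    using assms(2) by (auto simp: FCR_lift_def)
  have "FC_words (opp_pairing h (lin_ext C_rep p)) = lin_ext (\<lambda>u. FC_words (opp_pairing h (C_rep u))) p"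
    unfolding FC_words_def opp_pairing_def lin_ext_lin_ext ..
  also have "\<dots> = lin_ext (\<lambda>u. qscale (opp_sign n) (D_map h u)) p"
    by (rule lin_ext_cong) (use in_free_onD[OF p(1)] opp_pairing_C_rep[OF lin] in auto)
  also have "\<dots> = qscale (opp_sign n) (lin_ext (D_map h) p)"
    by (simp add: lin_ext_def rat_free.scale_sum_right mult.commute)
  finally have "qscale (opp_sign n) (lin_ext (D_map h) p) \<in> FC_rel"
    using opp_pairing_decomposables[OF lin p(2)] by simp
  from rat_free.subspace_scale[OF FC_rel_subspace this, of "opp_sign n"] show ?thesis by simp
qed

section \<open>The relations of FC(V) hold in St^infinity(V)\<close>

lemma affine_basis_translate: "affine_basis (map (\<lambda>v. v + t) u) \<longleftrightarrow> affine_basis u"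
  by (cases u) (simp_all add: affine_basis_def comp_def)

lemma affine_basis_mset: "mset p = mset q \<Longrightarrow> affine_basis (x # p) \<longleftrightarrow> affine_basis (x # q)"
  unfolding affine_basis_Cons
  using indep_list_mset[of "star x (rev p)" "star x (rev q)"] mset_eq_length[of p q]
  by (simp add: star_def)

lemma affine_basis_distinct:
  assumes "affine_basis (x # vs)"
  shows "distinct (x # vs)"
proof -
  have i: "indep_list (star x (rev vs))" using assms by (simp add: affine_basis_Cons)
  then have "distinct vs" by (auto simp: indep_list_def star_def distinct_map)
  moreover have "x \<notin> set vs" using indep_list_nonzero[OF i] by (auto simp: star_def image_iff)
  ultimately show ?thesis by simp
qed

lemma affine_basis_rotate1:
  assumes "affine_basis u"
  shows "affine_basis (rotate1 u)"
proof -
  obtain x vs where u: "u = x # vs" using assms by (cases u) (auto simp: affine_basis_def)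
  have i: "indep_list (star x (rev vs))" and len: "length vs = n"
    using assms by (simp_all add: u affine_basis_Cons)
  then obtain z ts where vs: "vs = z # ts" using n_pos by (cases vs) auto
  have "set (star x (rev vs)) \<subseteq> span (set (star z (rev (ts @ [x]))))"
  proof
    fix w assume "w \<in> set (star x (rev vs))"
    then obtain v where v: "v \<in> set vs" "w = v - x" by (auto simp: star_def)
    have 1: "v - z \<in> span (set (star z (rev (ts @ [x]))))"
      by (rule diff_in_span_star) (use v vs in auto)
    have 2: "x - z \<in> span (set (star z (rev (ts @ [x]))))"
      by (rule diff_in_span_star) auto
    from span_diff[OF 1 2] show "w \<in> span (set (star z (rev (ts @ [x]))))" using v by simp
  qed
  from indep_list_exchange[OF i this] show ?thesis using len by (simp add: u vs affine_basis_Cons)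
qed

lemma C_rep_translate:
  assumes "affine_basis u"
  shows "C_rep (map (\<lambda>v. v + t) u) = C_rep u"
proof -
  obtain x vs where u: "u = x # vs" using assms by (cases u) (auto simp: affine_basis_def)
  have "vs \<noteq> []" using assms n_pos by (auto simp: u affine_basis_Cons)
  then show ?thesis
    by (simp add: u C_rep_eq_C_path C_path_def rev_map star_translate path_edges_translate)
qed

lemma C_rep_rotate1:
  assumes "affine_basis u"
  shows "C_rep (rotate1 u) - C_rep u \<in> decomposables"
proof -
  obtain x vs where u: "u = x # vs" using assms by (cases u) (auto simp: affine_basis_def)
  have len: "length vs = n" using assms by (simp add: u affine_basis_Cons)
  then obtain z ts where vs: "vs = z # ts" using n_pos by (cases vs) auto
  have "C_path x (rev ts @ [z]) - C_path z (x # rev ts) \<in> decomposables"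
    using len affine_basis_distinct[OF assms[unfolded u]] by (intro C_path_cyclic) (auto simp: vs)
  from rat_free.subspace_neg[OF decomposables_subspace this]
  show ?thesis by (simp add: u vs C_rep_eq_C_path)
qed

text \<open>In other words, the map FC(V) -> St^infinity(V) is well defined.\<close>

lemma FC_rel_subset_FCR_lift: "FC_rel \<subseteq> FCR_lift"
  unfolding FC_rel_def
proof (intro rat_free.span_minimal FCR_lift_subspace Un_least subsetI)
  fix r assume "r \<in> {basis_elt (map (\<lambda>x. x + t) u) - basis_elt u |t u. affine_basis u}"
  then obtain t u where r: "r = basis_elt (map (\<lambda>x. x + t) u) - basis_elt u" and u: "affine_basis u" by blast
  have "r \<in> free_on {u. affine_basis u}" unfolding r
    by (rule rat_free.subspace_diff[OF free_on_subspace]) (simp_all add: u affine_basis_translate)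
  then show "r \<in> FCR_lift"
    by (simp add: FCR_lift_def r lin_ext_diff C_rep_translate[OF u] rat_free.subspace_0[OF decomposables_subspace])
next
  fix r assume "r \<in> {basis_elt (rotate1 u) - basis_elt u |u. affine_basis u}"
  then obtain u where r: "r = basis_elt (rotate1 u) - basis_elt u" and u: "affine_basis u" by blast
  have "r \<in> free_on {u. affine_basis u}" unfolding r
    by (rule rat_free.subspace_diff[OF free_on_subspace]) (simp_all add: u affine_basis_rotate1)
  then show "r \<in> FCR_lift"
    by (simp add: FCR_lift_def r lin_ext_diff C_rep_rotate1[OF u])
next
  fix r :: "'b list \<Rightarrow>\<^sub>0 rat"
  assume "r \<in> {\<Sum>w\<in>shuffles p q. basis_elt (x # w) |x p q. affine_basis (x # p @ q) \<and> p \<noteq> [] \<and> q \<noteq> []}"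
  then obtain x p q where r: "r = (\<Sum>w\<in>shuffles p q. basis_elt (x # w))"
    and u: "affine_basis (x # p @ q)" and ne: "p \<noteq> []" "q \<noteq> []" by blast
  have disj: "set p \<inter> set q = {}" using affine_basis_distinct[OF u] by auto
  have "r \<in> free_on {u. affine_basis u}" unfolding r
  proof (rule rat_free.subspace_sum[OF free_on_subspace])
    fix w assume "w \<in> shuffles p q"
    then have "mset w = mset (p @ q)" by (simp add: mset_shuffles)
    then show "basis_elt (x # w) \<in> free_on {u. affine_basis u}" using affine_basis_mset[of w "p @ q" x] u by simp
  qed
  moreover have "lin_ext C_rep r \<in> decomposables"
    using C_rep_shuffle[OF disj ne] by (simp add: r lin_ext_sum)
  ultimately show "r \<in> FCR_lift" by (simp add: FCR_lift_def)
qed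

end

section \<open>The bar complex\<close>

lemma shuffles_map: "shuffles (map f xs) (map f ys) = map f ` shuffles xs ys"
  by (induction xs ys rule: shuffles.induct) (simp_all add: image_Un image_image)

lemma permutations_of_set_Un_eq_UN_shuffles:
  assumes "finite P" "finite Q" "P \<inter> Q = {}"
  shows "permutations_of_set (P \<union> Q)
    = (\<Union>z\<in>permutations_of_set P \<times> permutations_of_set Q. shuffles (fst z) (snd z))"
proof (intro equalityI subsetI)
  fix w assume w: "w \<in> permutations_of_set (P \<union> Q)"
  let ?p = "filter (\<lambda>x. x \<in> P) w" and ?q = "filter (\<lambda>x. x \<notin> P) w"
  have "?p \<in> permutations_of_set P" "?q \<in> permutations_of_set Q"
    using w assms(3) by (auto simp: permutations_of_set_def)
  then show "w \<in> (\<Union>z\<in>permutations_of_set P \<times> permutations_of_set Q. shuffles (fst z) (snd z))"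
    using partition_in_shuffles[of w "\<lambda>x. x \<in> P"] by (intro UN_I[of "(?p, ?q)"]) auto
next
  fix w assume "w \<in> (\<Union>z\<in>permutations_of_set P \<times> permutations_of_set Q. shuffles (fst z) (snd z))"
  then obtain p q where p: "p \<in> permutations_of_set P" and q: "q \<in> permutations_of_set Q"
    and w: "w \<in> shuffles p q" by auto
  then have "distinct w" using assms(3) distinct_disjoint_shuffles[of p q w]
    by (auto simp: permutations_of_set_def)
  then show "w \<in> permutations_of_set (P \<union> Q)"
    using set_shuffles[OF w] p q by (auto simp: permutations_of_set_def)
qed

text \<open>An ordering of the union is a shuffle of exactly one pair of orderings, namely of its
  restrictions to \<open>P\<close> and \<open>Q\<close>.\<close>

lemma sum_permutations_of_set_Un:
  fixes f :: "'x list \<Rightarrow> 'c::comm_monoid_add"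
  assumes "finite P" "finite Q" "P \<inter> Q = {}"
  shows "(\<Sum>w\<in>permutations_of_set (P \<union> Q). f w) =
    (\<Sum>z\<in>permutations_of_set P \<times> permutations_of_set Q. \<Sum>w\<in>shuffles (fst z) (snd z). f w)"
  unfolding permutations_of_set_Un_eq_UN_shuffles[OF assms]
proof (rule sum.UNION_disjoint)
  show "\<forall>z\<in>permutations_of_set P \<times> permutations_of_set Q.
      \<forall>z'\<in>permutations_of_set P \<times> permutations_of_set Q.
      z \<noteq> z' \<longrightarrow> shuffles (fst z) (snd z) \<inter> shuffles (fst z') (snd z') = {}"
  proof (intro ballI impI)
    fix z z' assume z: "z \<in> permutations_of_set P \<times> permutations_of_set Q"
      "z' \<in> permutations_of_set P \<times> permutations_of_set Q" "z \<noteq> z'"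
    have *: "fst z = filter (\<lambda>x. x \<in> P) w \<and> snd z = filter (\<lambda>x. x \<notin> P) w"
      if "z \<in> permutations_of_set P \<times> permutations_of_set Q" "w \<in> shuffles (fst z) (snd z)" for z w
    proof -
      have s: "set (fst z) = P" "set (snd z) = Q" using that(1) by (auto simp: permutations_of_set_def)
      have disj: "set (fst z) \<inter> set (snd z) = {}" using s assms(3) by simp
      from filter_shuffles_disjoint1[OF disj that(2)] show ?thesis unfolding s by simp
    qed
    show "shuffles (fst z) (snd z) \<inter> shuffles (fst z') (snd z') = {}"
    proof (rule ccontr)
      assume "shuffles (fst z) (snd z) \<inter> shuffles (fst z') (snd z') \<noteq> {}"
      then obtain w where w: "w \<in> shuffles (fst z) (snd z)" "w \<in> shuffles (fst z') (snd z')" by blast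
      have "z = z'" using *[OF z(1) w(1)] *[OF z(2) w(2)] by (simp add: prod_eq_iff)
      then show False using z(3) by blast
    qed
  qed
qed simp_all

lemma coset_eq_iff:
  assumes "rat_free.subspace R"
  shows "coset R x = coset R y \<longleftrightarrow> x - y \<in> R"
proof
  assume "coset R x = coset R y"
  moreover have "x \<in> coset R x" using rat_free.subspace_0[OF assms] by (simp add: coset_def)
  ultimately have "x \<in> coset R y" by blast
  then show "x - y \<in> R" by (simp add: coset_def)
next
  assume xy: "x - y \<in> R"
  have "z - x \<in> R \<longleftrightarrow> z - y \<in> R" for z
  proof
    assume "z - x \<in> R"
    from rat_free.subspace_add[OF assms this xy] show "z - y \<in> R" by simp
  next
    assume "z - y \<in> R"
    from rat_free.subspace_diff[OF assms this xy] show "z - x \<in> R" by simp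
  qed
  then show "coset R x = coset R y" unfolding coset_def by blast
qed

lemma mem_coset: "y \<in> coset R x \<longleftrightarrow> y - x \<in> R"
  by (simp add: coset_def)

lemma bar_bd1_tensor:
  "bar_bd1 act (tensor c (basis_elt g)) = lin_ext (\<lambda>b. basis_elt (act (inv g) b)) c - c"
proof (rule qlinear_eqI[of "\<lambda>c. bar_bd1 act (tensor c (basis_elt g))" "\<lambda>c. lin_ext (\<lambda>b. basis_elt (act (inv g) b)) c - c"])
  show "qlinear (\<lambda>c. bar_bd1 act (tensor c (basis_elt g)))"
    unfolding bar_bd1_def by (rule qlinear_comp[OF qlinear_lin_ext qlinear_tensor_left])
  show "qlinear (\<lambda>c. lin_ext (\<lambda>b. basis_elt (act (inv g) b)) c - c)"
    by (rule qlinearI) (simp_all add: lin_ext_add lin_ext_scale rat_free.scale_right_diff_distrib)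
qed (simp add: bar_bd1_def)

lemma bar_bd2_tensor:
  "bar_bd2 act (tensor c (basis_elt (g, k))) =
    tensor (lin_ext (\<lambda>b. basis_elt (act (inv g) b)) c) (basis_elt k)
    - tensor c (basis_elt (g \<circ> k)) + tensor c (basis_elt g)"
proof (rule qlinear_eqI[of "\<lambda>c. bar_bd2 act (tensor c (basis_elt (g, k)))" "\<lambda>c. tensor (lin_ext (\<lambda>b. basis_elt (act (inv g) b)) c) (basis_elt k)
    - tensor c (basis_elt (g \<circ> k)) + tensor c (basis_elt g)"])
  show "qlinear (\<lambda>c. bar_bd2 act (tensor c (basis_elt (g, k))))"
    unfolding bar_bd2_def by (rule qlinear_comp[OF qlinear_lin_ext qlinear_tensor_left])
  show "qlinear (\<lambda>c. tensor (lin_ext (\<lambda>b. basis_elt (act (inv g) b)) c) (basis_elt k)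
    - tensor c (basis_elt (g \<circ> k)) + tensor c (basis_elt g))"
    by (rule qlinearI) (simp_all add: lin_ext_add lin_ext_scale tensor_add_left tensor_scale_left
        rat_free.scale_right_diff_distrib rat_free.scale_right_distrib)
qed (simp add: bar_bd2_def)

lemma H1_boundaries_subspace: "rat_free.subspace (H1_boundaries G act A R)"
  unfolding rat_free.subspace_def
proof (intro conjI ballI allI)
  let ?S = "tensor_space A (free_on (G \<times> G))" and ?T = "tensor_space R (free_on G)"
  have lin: "qlinear (bar_bd2 act)" unfolding bar_bd2_def by (rule qlinear_lin_ext)
  show "0 \<in> H1_boundaries G act A R"
    unfolding H1_boundaries_def
    using rat_free.subspace_0[OF tensor_space_subspace, of A "free_on (G \<times> G)"]
      rat_free.subspace_0[OF tensor_space_subspace, of R "free_on G"] qlinear_0[OF lin]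
    by (intro CollectI exI[of _ 0]) simp
  fix x assume "x \<in> H1_boundaries G act A R"
  then obtain d r where x: "x = bar_bd2 act d + r" "d \<in> ?S" "r \<in> ?T" by (auto simp: H1_boundaries_def)
  show "qscale c x \<in> H1_boundaries G act A R" for c
    unfolding H1_boundaries_def using rat_free.subspace_scale[OF tensor_space_subspace x(2), of c]
      rat_free.subspace_scale[OF tensor_space_subspace x(3), of c]
    by (intro CollectI exI[of _ "qscale c d"] exI[of _ "qscale c r"])
       (simp add: x(1) qlinear_scale[OF lin] rat_free.scale_right_distrib)
  fix y assume "y \<in> H1_boundaries G act A R"
  then obtain d' r' where y: "y = bar_bd2 act d' + r'" "d' \<in> ?S" "r' \<in> ?T" by (auto simp: H1_boundaries_def)
  show "x + y \<in> H1_boundaries G act A R"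
    unfolding H1_boundaries_def using rat_free.subspace_add[OF tensor_space_subspace x(2) y(2)]
      rat_free.subspace_add[OF tensor_space_subspace x(3) y(3)]
    by (intro CollectI exI[of _ "d + d'"] exI[of _ "r + r'"])
       (simp add: x(1) y(1) qlinear_add'[OF lin])
qed

section \<open>The action of GL(V)\<close>

context correlator_space
begin

lemma GL_compose: "g \<in> GL \<Longrightarrow> k \<in> GL \<Longrightarrow> g \<circ> k \<in> GL"
  unfolding GL_def by (auto intro: Vector_Spaces.linear_compose bij_comp)

lemma GL_inv: "g \<in> GL \<Longrightarrow> inv g \<in> GL"
proof -
  assume g: "g \<in> GL"
  then have lin: "Vector_Spaces.linear scale scale g" and bij: "bij g" by (auto simp: GL_def)
  interpret g: Vector_Spaces.linear scale scale g by (rule lin)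
  have gi: "g (inv g x) = x" for x using bij by (simp add: bij_is_surj surj_f_inv_f)
  have inj: "inj g" using bij by (rule bij_is_inj)
  have "inv g (x + y) = inv g x + inv g y" for x y
    by (rule injD[OF inj]) (simp add: gi g.add)
  moreover have "inv g (c *s x) = c *s inv g x" for c x
    by (rule injD[OF inj]) (simp add: gi g.scale)
  ultimately have "Vector_Spaces.linear scale scale (inv g)"
    unfolding Vector_Spaces.linear_def module_hom_def module_hom_axioms_def
    by (auto intro: module_axioms vector_space_axioms)
  then show ?thesis using bij by (simp add: GL_def bij_imp_bij_inv)
qed

lemma GL_linear: "g \<in> GL \<Longrightarrow> Vector_Spaces.linear scale scale g"
  by (simp add: GL_def)

lemma GL_inv_inv: "g \<in> GL \<Longrightarrow> inv (inv g) = g"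
  by (simp add: GL_def inv_inv_eq)

lemma GL_apply:
  assumes "g \<in> GL"
  shows "g (x + y) = g x + g y" "g (x - y) = g x - g y" "g (c *s x) = c *s g x" "g 0 = 0"
proof -
  interpret g: Vector_Spaces.linear scale scale g using assms by (rule GL_linear)
  show "g (x + y) = g x + g y" "g (x - y) = g x - g y" "g (c *s x) = c *s g x" "g 0 = 0"
    by (rule g.add g.diff g.scale g.zero)+
qed

lemma GL_ext:
  assumes "g \<in> GL" "k \<in> GL" "basis_list b" "map g b = map k b"
  shows "g = k"
proof (rule ext)
  fix v
  have "v \<in> span (set b)" using assms(3) by (simp add: basis_list_def)
  then show "g v = k v"
    by (induction rule: span_induct_alt)
       (use assms(4) in \<open>simp_all add: GL_apply[OF assms(1)] GL_apply[OF assms(2)]\<close>)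
qed

lemma ex_GL_map:
  assumes "basis_list b" "basis_list c" "length b = length c"
  shows "\<exists>g\<in>GL. map g b = c"
proof -
  interpret p: vector_space_pair scale scale by unfold_locales
  have ex: "\<exists>g. Vector_Spaces.linear scale scale g \<and> map g b = c"
    if b: "basis_list b" and len: "length b = length c" for b c
  proof -
    have "distinct b" "independent (set b)" using b by (auto simp: basis_list_def indep_list_def)
    moreover obtain g where g: "Vector_Spaces.linear scale scale g" "\<forall>x\<in>set b. g x = the (map_of (zip b c) x)"
      using p.linear_independent_extend[OF calculation(2), of "\<lambda>x. the (map_of (zip b c) x)"] by blast
    ultimately have "map g b = c" using len
      by (intro nth_equalityI) (auto simp: map_of_zip_nth)
    then show ?thesis using g(1) by blast
  qed
  obtain g k where g: "Vector_Spaces.linear scale scale g" "map g b = c"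
    and k: "Vector_Spaces.linear scale scale k" "map k c = b"
    using ex[OF assms(1,3)] ex[OF assms(2) assms(3)[symmetric]] by blast
  interpret g: Vector_Spaces.linear scale scale g by (rule g(1))
  interpret k: Vector_Spaces.linear scale scale k by (rule k(1))
  have kg: "k (g v) = v" for v
  proof -
    have "v \<in> span (set b)" using assms(1) by (simp add: basis_list_def)
    moreover have "map k (map g b) = map id b" unfolding g(2) k(2) by simp
    then have "\<forall>x\<in>set b. k (g x) = x" by (simp only: map_map map_eq_conv comp_def id_apply)
    ultimately show ?thesis
      by (induction rule: span_induct_alt) (simp_all add: g.zero k.zero g.add k.add g.scale k.scale)
  qed
  have gk: "g (k v) = v" for v
  proof -
    have "v \<in> span (set c)" using assms(2) by (simp add: basis_list_def)
    moreover have "map g (map k c) = map id c" unfolding g(2) k(2) by simp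
    then have "\<forall>x\<in>set c. g (k x) = x" by (simp only: map_map map_eq_conv comp_def id_apply)
    ultimately show ?thesis
      by (induction rule: span_induct_alt) (simp_all add: g.zero k.zero g.add k.add g.scale k.scale)
  qed
  have "bij g" by (rule bij_betw_byWitness[of _ k]) (auto simp: kg gk)
  then show ?thesis using g by (auto simp: GL_def)
qed

text \<open>The representative of a translation class that starts at 0. On affine bases of this form
  GL(V) acts simply transitively, which makes FC(V) before cyclic and shuffle relations a free
  module of rank one.\<close>

definition normalize_base :: "'b list \<Rightarrow> 'b list" where
  "normalize_base u = map (\<lambda>v. v - hd u) u"

lemma normalize_base_map: "g \<in> GL \<Longrightarrow> normalize_base (map g u) = map g (normalize_base u)"
  by (cases u) (simp_all add: normalize_base_def GL_apply)

lemma normalize_base_idem [simp]: "normalize_base (normalize_base u) = normalize_base u"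
  by (cases u) (simp_all add: normalize_base_def)

lemma normalize_base_rotate1: "normalize_base (rotate1 u) = normalize_base (rotate1 (normalize_base u))"
proof (cases u)
  case (Cons x vs)
  then show ?thesis by (cases vs) (simp_all add: normalize_base_def)
qed (simp add: normalize_base_def)

lemma normalize_base_Cons: "normalize_base (x # vs) = 0 # star x vs"
  by (simp add: normalize_base_def star_def)

lemma C_rep_map:
  assumes "g \<in> GL"
  shows "C_rep (map g (x # v # vs)) = lin_ext (\<lambda>b. basis_elt (flag_act g b)) (C_rep (x # v # vs))"
proof -
  have st: "star (g x) (map g rs) = map g (star x rs)" for x rs
    by (simp add: star_def GL_apply[OF assms])
  have pt: "path_edges (g x) (map g rs) = map g (path_edges x rs)" for x rs
    by (induction rs arbitrary: x) (simp_all add: GL_apply[OF assms])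
  have T: "tensor (lin_ext (\<lambda>\<sigma>. basis_elt (map (image g) \<sigma>)) p) (lin_ext (\<lambda>\<sigma>. basis_elt (map (image g) \<sigma>)) q)
      = lin_ext (\<lambda>b. basis_elt (flag_act g b)) (tensor p q)" for p q
    unfolding tensor_def lin_ext_lin_ext lin_ext_basis flag_act_def by simp
  have "C_rep (map g (x # v # vs)) = C_path (g x) (map g (rev (v # vs)))"
    by (simp add: C_rep_eq_C_path rev_map)
  also have "\<dots> = lin_ext (\<lambda>b. basis_elt (flag_act g b)) (C_path x (rev (v # vs)))"
    unfolding C_path_def st pt apartment_map[OF assms] T ..
  finally show ?thesis by (simp add: C_rep_eq_C_path)
qed

lemma opp_words_map:
  assumes "g \<in> GL" "\<And>v. h' (g v) = h v"
  shows "opp_words h' k (map g a) (map g b) = lin_ext (\<lambda>w. basis_elt (map g w)) (opp_words h k a b)"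
proof (induction k arbitrary: a b)
  case (Suc k)
  interpret g: Vector_Spaces.linear scale scale g using assms(1) by (rule GL_linear)
  have inj: "inj g" using assms(1) by (simp add: GL_def bij_is_inj)
  have sp: "span (set (map g r)) = g ` span (set r)" for r by (simp add: g.span_image)
  have pr: "proj_span (g ` P) (g y) (g z) = g (proj_span P y z)" for P y z
  proof -
    have "g z - c *s g y \<in> g ` P \<longleftrightarrow> z - c *s y \<in> P" for c
      using inj_image_mem_iff[OF inj, of "z - c *s y" P] by (simp add: g.diff g.scale)
    then show ?thesis by (simp add: proj_span_def g.diff g.scale)
  qed
  let ?T = "lin_ext (\<lambda>w. basis_elt (map g w))"
  have "opp_words h' (Suc k) (map g a) (map g b) = asum (\<lambda>x r. asum (\<lambda>y t.
     ?T (if y \<notin> span (set r) \<and> h y \<noteq> 0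
     then cons_letter (inverse (h y) *s y) (opp_words h k r (map (proj_span (span (set r)) y) t))
     else 0)) b) a"
    unfolding opp_words.simps asum_map
  proof (intro asum_cong)
    fix as as' bs bs' :: "'b list" and x y
    let ?r = "as @ as'" and ?t = "bs @ bs'"
    have 1: "g y \<in> span (set (map g ?r)) \<longleftrightarrow> y \<in> span (set ?r)"
      unfolding sp by (rule inj_image_mem_iff[OF inj])
    have 2: "map (proj_span (span (set (map g ?r))) (g y)) (map g ?t) = map g (map (proj_span (span (set ?r)) y) ?t)"
      unfolding sp by (simp add: pr)
    have 3: "cons_letter (inverse (h y) *s g y) (?T p) = ?T (cons_letter (inverse (h y) *s y) p)" for p
      by (simp add: lin_ext_lin_ext g.scale)
    show "(if g y \<notin> span (set (map g ?r)) \<and> h' (g y) \<noteq> 0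
       then cons_letter (inverse (h' (g y)) *s g y)
         (opp_words h' k (map g ?r) (map (proj_span (span (set (map g ?r))) (g y)) (map g ?t)))
       else 0) = ?T (if y \<notin> span (set ?r) \<and> h y \<noteq> 0
       then cons_letter (inverse (h y) *s y) (opp_words h k ?r (map (proj_span (span (set ?r)) y) ?t)) else 0)"
      unfolding 1 2 assms(2) Suc 3 by (simp del: map_append)
  qed
  also have "\<dots> = ?T (opp_words h (Suc k) a b)"
    unfolding opp_words.simps asum_linear[OF qlinear_lin_ext] ..
  finally show ?case .
qed simp

end

context fd_correlator_space
begin

abbreviation FC_chains :: "('b list \<times> ('b \<Rightarrow> 'b) \<Rightarrow>\<^sub>0 rat) set" where
  "FC_chains \<equiv> free_on ({u. affine_basis u} \<times> GL)"

abbreviation GL_action :: "('b \<Rightarrow> 'b) \<Rightarrow> ('b list \<Rightarrow>\<^sub>0 rat) \<Rightarrow> ('b list \<Rightarrow>\<^sub>0 rat)" where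
  "GL_action g \<equiv> lin_ext (\<lambda>u. basis_elt (map g u))"

definition C_chain ::
  "('b list \<times> ('b \<Rightarrow> 'b) \<Rightarrow>\<^sub>0 rat) \<Rightarrow> (('b set list \<times> 'b set list) \<times> ('b \<Rightarrow> 'b) \<Rightarrow>\<^sub>0 rat)" where
  "C_chain = lin_ext (\<lambda>(u, g). tensor (C_rep u) (basis_elt g))"

lemma affine_basis_cases:
  assumes "affine_basis u"
  obtains x v vs where "u = x # v # vs"
proof -
  obtain x ws where u: "u = x # ws" using assms by (cases u) (auto simp: affine_basis_def)
  then have "ws \<noteq> []" using assms n_pos by (auto simp: affine_basis_Cons)
  then show ?thesis using that u by (cases ws) auto
qed

lemma normalize_base_eq_translate: "normalize_base u = map (\<lambda>v. v + (- hd u)) u"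
  by (simp add: normalize_base_def)

lemma affine_basis_normalize [simp]: "affine_basis (normalize_base u) \<longleftrightarrow> affine_basis u"
  unfolding normalize_base_eq_translate by (rule affine_basis_translate)

lemma C_rep_normalize: "affine_basis u \<Longrightarrow> C_rep (normalize_base u) = C_rep u"
  unfolding normalize_base_eq_translate by (rule C_rep_translate)

lemma affine_basis_map_GL:
  assumes "g \<in> GL"
  shows "affine_basis (map g u) \<longleftrightarrow> affine_basis u"
proof (cases u)
  case (Cons x vs)
  have "star (g x) (map g (rev vs)) = map g (star x (rev vs))"
    by (simp add: star_def GL_apply[OF assms])
  moreover have "inj g" using assms by (simp add: GL_def bij_is_inj)
  ultimately show ?thesis
    using indep_list_map[OF GL_linear[OF assms], of "star x (rev vs)"]
    by (simp add: Cons affine_basis_Cons rev_map[symmetric])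
qed (simp add: affine_basis_def)

lemma basis_minus_normalize_in_FC_rel:
  assumes "affine_basis u"
  shows "basis_elt u - basis_elt (normalize_base u) \<in> FC_rel"
proof -
  have "basis_elt (normalize_base u) - basis_elt u \<in> FC_rel"
    unfolding FC_rel_def normalize_base_eq_translate
    by (rule rat_free.span_base) (use assms in blast)
  from rat_free.subspace_neg[OF FC_rel_subspace this] show ?thesis by simp
qed

lemma ex_GL_normalize:
  assumes "affine_basis u" "affine_basis u'"
  shows "\<exists>g\<in>GL. map g (normalize_base u) = normalize_base u'"
proof -
  obtain x vs where u: "u = x # vs" using assms(1) by (cases u) (auto simp: affine_basis_def)
  obtain x' vs' where u': "u' = x' # vs'" using assms(2) by (cases u') (auto simp: affine_basis_def)
  have "basis_list (star x vs)" "basis_list (star x' vs')"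
    using assms by (simp_all add: u u' affine_basis_def star_def)
  moreover have "length (star x vs) = length (star x' vs')"
    using assms by (simp add: u u' affine_basis_Cons)
  ultimately obtain g where "g \<in> GL" "map g (star x vs) = star x' vs'" using ex_GL_map by blast
  then show ?thesis by (auto simp: u u' normalize_base_Cons GL_apply)
qed

lemma GL_normalize_unique:
  assumes "affine_basis u" "g \<in> GL" "k \<in> GL" "map g (normalize_base u) = map k (normalize_base u)"
  shows "g = k"
proof -
  obtain x vs where u: "u = x # vs" using assms(1) by (cases u) (auto simp: affine_basis_def)
  have "basis_list (star x vs)" using assms(1) by (simp add: u affine_basis_def star_def)
  moreover have "map g (star x vs) = map k (star x vs)" using assms(4) by (simp add: u normalize_base_Cons)
  ultimately show ?thesis by (rule GL_ext[OF assms(2,3)])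
qed

lemma in_FCR_liftD: "p \<in> FCR_lift \<Longrightarrow> p \<in> free_on {u. affine_basis u}"
  "p \<in> FCR_lift \<Longrightarrow> lin_ext C_rep p \<in> decomposables"
  by (simp_all add: FCR_lift_def)

lemma C_chain_tensor: "C_chain (tensor p (basis_elt g)) = tensor (lin_ext C_rep p) (basis_elt g)"
proof (rule qlinear_eqI[of "\<lambda>p. C_chain (tensor p (basis_elt g))" "\<lambda>p. tensor (lin_ext C_rep p) (basis_elt g)"])
  show "qlinear (\<lambda>p. C_chain (tensor p (basis_elt g)))"
    unfolding C_chain_def by (rule qlinear_comp[OF qlinear_lin_ext qlinear_tensor_left])
  show "qlinear (\<lambda>p. tensor (lin_ext C_rep p) (basis_elt g))"
    by (rule qlinear_comp[OF qlinear_tensor_left qlinear_lin_ext])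
qed (simp add: C_chain_def)

lemma C_rep_GL:
  assumes "g \<in> GL" "affine_basis u"
  shows "C_rep (map g u) = lin_ext (\<lambda>b. basis_elt (flag_act g b)) (C_rep u)"
  using affine_basis_cases[OF assms(2)] C_rep_map[OF assms(1)] by metis

lemma lin_ext_C_rep_GL:
  assumes "g \<in> GL" "p \<in> free_on {u. affine_basis u}"
  shows "lin_ext C_rep (GL_action g p) = lin_ext (\<lambda>b. basis_elt (flag_act g b)) (lin_ext C_rep p)"
  unfolding lin_ext_lin_ext lin_ext_basis
  by (rule lin_ext_cong) (use in_free_onD[OF assms(2)] C_rep_GL[OF assms(1)] in auto)

lemma bar_bd1_C_chain:
  assumes "f \<in> FC_chains"
  shows "bar_bd1 flag_act (C_chain f) = lin_ext C_rep (bar_bd1 map f)"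
proof (rule qlinear_eqI[of "\<lambda>f. bar_bd1 flag_act (C_chain f)" "\<lambda>f. lin_ext C_rep (bar_bd1 map f)"])
  show "qlinear (\<lambda>f. bar_bd1 flag_act (C_chain f))"
    unfolding C_chain_def bar_bd1_def by (rule qlinear_comp[OF qlinear_lin_ext qlinear_lin_ext])
  show "qlinear (\<lambda>f. lin_ext C_rep (bar_bd1 map f))"
    unfolding bar_bd1_def by (rule qlinear_comp[OF qlinear_lin_ext qlinear_lin_ext])
  fix z assume "z \<in> Poly_Mapping.keys f"
  then obtain u g where z: "z = (u, g)" "affine_basis u" "g \<in> GL" using in_free_onD[OF assms] by blast
  show "bar_bd1 flag_act (C_chain (basis_elt z)) = lin_ext C_rep (bar_bd1 map (basis_elt z))"
    unfolding z(1) C_chain_def lin_ext_basis prod.case bar_bd1_tensor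
    by (simp add: bar_bd1_def lin_ext_diff C_rep_GL[OF GL_inv[OF z(3)] z(2)])
qed

lemma C_chain_in:
  assumes "f \<in> FC_chains"
  shows "C_chain f \<in> tensor_space Steinberg2 (free_on GL)"
  unfolding C_chain_def
proof (rule lin_ext_in_subspace[OF tensor_space_subspace])
  fix z assume "z \<in> Poly_Mapping.keys f"
  then obtain u g where z: "z = (u, g)" "g \<in> GL" using in_free_onD[OF assms] by blast
  show "(case z of (u, g) \<Rightarrow> tensor (C_rep u) (basis_elt g)) \<in> tensor_space Steinberg2 (free_on GL)"
    unfolding z prod.case by (rule tensor_in_tensor_space[OF C_rep_in_Steinberg2]) (simp add: z)
qed

lemma G_boundaries_subspace: "rat_free.subspace G_boundaries"
  unfolding G_boundaries_def by (rule H1_boundaries_subspace)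

lemma tensor_decomposables_in_G_boundaries:
  "r \<in> tensor_space decomposables (free_on GL) \<Longrightarrow> r \<in> G_boundaries"
  unfolding G_boundaries_def H1_boundaries_def
  by (intro CollectI exI[of _ 0] exI[of _ r])
     (simp add: bar_bd2_def rat_free.subspace_0[OF tensor_space_subspace])

lemma bar_bd2_in_G_boundaries:
  "d \<in> tensor_space Steinberg2 (free_on (GL \<times> GL)) \<Longrightarrow> bar_bd2 flag_act d \<in> G_boundaries"
  unfolding G_boundaries_def H1_boundaries_def
  by (intro CollectI exI[of _ d] exI[of _ 0])
     (simp add: rat_free.subspace_0[OF tensor_space_subspace])

lemma flag_act_decomposables:
  assumes "g \<in> GL" "z \<in> decomposables"
  shows "lin_ext (\<lambda>b. basis_elt (flag_act g b)) z \<in> decomposables"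
proof (rule span_induct_linear[OF subsetD[OF decomposables_subset_span assms(2)] decomposables_subspace qlinear_lin_ext])
  fix x assume "x \<in> {tensor (apartment (a @ c)) (apartment (b @ d)) |a b c d.
     a \<noteq> [] \<and> c \<noteq> [] \<and> length b = length a \<and> length d = length c \<and>
     set b \<subseteq> span (set a) \<and> set d \<subseteq> span (set c) \<and> basis_list (a @ c) \<and> basis_list (b @ d)}"
  then obtain a b c d where x: "x = tensor (apartment (a @ c)) (apartment (b @ d))"
    and ne: "a \<noteq> []" "c \<noteq> []"
    and bd: "length b = length a" "length d = length c" "set b \<subseteq> span (set a)" "set d \<subseteq> span (set c)" by blast
  interpret g: Vector_Spaces.linear scale scale g using assms(1) by (rule GL_linear)
  have "lin_ext (\<lambda>b. basis_elt (flag_act g b)) x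
      = tensor (apartment (map g a @ map g c)) (apartment (map g b @ map g d))"
    unfolding x map_append[symmetric] apartment_map[OF assms(1)]
    by (simp only: tensor_def lin_ext_lin_ext lin_ext_basis flag_act_def map_prod_simp)
  also have "\<dots> \<in> decomposables"
  proof (rule tensor_in_decomposables)
    show "set (map g b) \<subseteq> span (set (map g a))" "set (map g d) \<subseteq> span (set (map g c))"
      using bd(3,4) by (auto simp: g.span_image)
  qed (use ne bd in auto)
  finally show "lin_ext (\<lambda>b. basis_elt (flag_act g b)) x \<in> decomposables" .
qed

lemma FCR_coinv_rel_subset: "FCR_coinv_rel \<subseteq> FCR_lift"
  unfolding FCR_coinv_rel_def
proof (intro rat_free.span_minimal FCR_lift_subspace Un_least FC_rel_subset_FCR_lift subsetI)
  fix r assume "r \<in> {GL_action g p - p |g p. g \<in> GL \<and> p \<in> FCR_lift}"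
  then obtain g p where r: "r = GL_action g p - p" and g: "g \<in> GL" and p: "p \<in> FCR_lift" by blast
  note pX = in_FCR_liftD(1)[OF p]
  have "GL_action g p \<in> free_on {u. affine_basis u}"
    by (rule lin_ext_in_subspace[OF free_on_subspace])
       (use in_free_onD[OF pX] affine_basis_map_GL[OF g] in auto)
  moreover have "lin_ext C_rep (GL_action g p) \<in> decomposables"
  proof -
    show ?thesis unfolding lin_ext_C_rep_GL[OF g pX]
      by (rule flag_act_decomposables[OF g in_FCR_liftD(2)[OF p]])
  qed
  ultimately have "GL_action g p \<in> FCR_lift" by (simp add: FCR_lift_def)
  then show "r \<in> FCR_lift" unfolding r using p by (rule rat_free.subspace_diff[OF FCR_lift_subspace])
qed

section \<open>Contraction of the bar complex at a base point\<close>

context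
  fixes y0 :: "'b list"
  assumes y0: "affine_basis y0" "normalize_base y0 = y0"
begin

definition transporter :: "'b list \<Rightarrow> ('b \<Rightarrow> 'b)" where
  "transporter u = (SOME g. g \<in> GL \<and> map g y0 = normalize_base u)"

lemma transporter:
  assumes "affine_basis u"
  shows "transporter u \<in> GL" "map (transporter u) y0 = normalize_base u"
proof -
  have "\<exists>g. g \<in> GL \<and> map g y0 = normalize_base u"
    using ex_GL_normalize[OF y0(1) assms] y0(2) by auto
  from someI_ex[OF this] show "transporter u \<in> GL" "map (transporter u) y0 = normalize_base u"
    unfolding transporter_def by blast+
qed

lemma transporter_unique:
  assumes "affine_basis u" "g \<in> GL" "map g y0 = normalize_base u"
  shows "transporter u = g"
  using GL_normalize_unique[OF y0(1) transporter(1)[OF assms(1)] assms(2)]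
    transporter(2)[OF assms(1)] assms(3) y0(2) by simp

lemma transporter_map:
  assumes "g \<in> GL" "affine_basis u"
  shows "transporter (map g u) = g \<circ> transporter u"
proof (rule transporter_unique)
  show "affine_basis (map g u)" using assms affine_basis_map_GL by blast
  show "g \<circ> transporter u \<in> GL" by (rule GL_compose[OF assms(1) transporter(1)[OF assms(2)]])
  show "map (g \<circ> transporter u) y0 = normalize_base (map g u)"
    unfolding map_map[symmetric] transporter(2)[OF assms(2)] normalize_base_map[OF assms(1)] ..
qed

text \<open>Contracting homotopy in degree 0. The inverse comes from the convention that the
  boundary of m [g] is g^-1 m - m: up to translation, the boundary of the filling of
  \<open>u\<close> is \<open>u\<close> minus \<open>y0\<close>.\<close>

definition fill :: "('b list \<Rightarrow>\<^sub>0 rat) \<Rightarrow> ('b list \<times> ('b \<Rightarrow> 'b) \<Rightarrow>\<^sub>0 rat)" where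
  "fill = lin_ext (\<lambda>u. basis_elt (y0, inv (transporter u)))"

lemma fill_in: "p \<in> free_on {u. affine_basis u} \<Longrightarrow> fill p \<in> FC_chains"
  unfolding fill_def
  by (rule lin_ext_in_subspace[OF free_on_subspace])
     (use y0(1) GL_inv transporter(1) in \<open>auto dest: in_free_onD\<close>)

lemma bar_bd1_fill:
  assumes "p \<in> free_on {u. affine_basis u}"
  shows "bar_bd1 map (fill p) = lin_ext (\<lambda>u. basis_elt (normalize_base u)) p - lin_ext (\<lambda>_. basis_elt y0) p"
proof (rule qlinear_eqI[of "\<lambda>p. bar_bd1 map (fill p)"
      "\<lambda>p. lin_ext (\<lambda>u. basis_elt (normalize_base u)) p - lin_ext (\<lambda>_. basis_elt y0) p"])
  show "qlinear (\<lambda>p. bar_bd1 map (fill p))"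
    unfolding fill_def bar_bd1_def by (rule qlinear_comp[OF qlinear_lin_ext qlinear_lin_ext])
  show "qlinear (\<lambda>p. lin_ext (\<lambda>u. basis_elt (normalize_base u)) p - lin_ext (\<lambda>_. basis_elt y0) p)"
    by (rule qlinearI) (simp_all add: lin_ext_add lin_ext_scale rat_free.scale_right_diff_distrib)
  fix u assume "u \<in> Poly_Mapping.keys p"
  then have u: "affine_basis u" using in_free_onD[OF assms] by auto
  have "map (inv (inv (transporter u))) y0 = normalize_base u"
    unfolding GL_inv_inv[OF transporter(1)[OF u]] by (rule transporter(2)[OF u])
  then show "bar_bd1 map (fill (basis_elt u)) =
      lin_ext (\<lambda>u. basis_elt (normalize_base u)) (basis_elt u) - lin_ext (\<lambda>_. basis_elt y0) (basis_elt u)"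
    by (simp add: fill_def bar_bd1_def)
qed

text \<open>As \<open>GL\<close> acts simply transitively on affine bases up to translation, this is the contraction
  of the bar complex of a free module, pushed to \<open>St\<^sup>\<infinity>\<close>.\<close>

lemma C_chain_minus_fill:
  assumes "f \<in> FC_chains"
  shows "C_chain f - C_chain (fill (bar_bd1 map f)) \<in> G_boundaries"
proof -
  \<comment> \<open>Write t for the transporter of u. The boundary of y0 [t^-1 | g] consists of u
    [g], of y0 [t^-1 g] with sign - and of y0 [t^-1]. The last two form minus the filling of the
    boundary of u [g], because the transporter of g^-1 u is g^-1 t.\<close>
  let ?k = "lin_ext (\<lambda>(u, g). tensor (C_rep y0) (basis_elt (inv (transporter u), g)))"
  have "C_chain f - C_chain (fill (bar_bd1 map f)) = bar_bd2 flag_act (?k f)"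
  proof (rule qlinear_eqI[of "\<lambda>f. C_chain f - C_chain (fill (bar_bd1 map f))" "\<lambda>f. bar_bd2 flag_act (?k f)"])
    show "qlinear (\<lambda>f. C_chain f - C_chain (fill (bar_bd1 map f)))"
      by (rule qlinearI) (simp_all add: C_chain_def fill_def bar_bd1_def lin_ext_add lin_ext_scale
          rat_free.scale_right_diff_distrib)
    show "qlinear (\<lambda>f. bar_bd2 flag_act (?k f))"
      unfolding bar_bd2_def by (rule qlinear_comp[OF qlinear_lin_ext qlinear_lin_ext])
    fix z assume "z \<in> Poly_Mapping.keys f"
    then obtain u g where z: "z = (u, g)" and u: "affine_basis u" and g: "g \<in> GL"
      using in_free_onD[OF assms] by blast
    let ?a = "inv (transporter u)"
    note t = transporter[OF u]
    have "lin_ext (\<lambda>b. basis_elt (flag_act (inv ?a) b)) (C_rep y0) = C_rep (normalize_base u)"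
      unfolding GL_inv_inv[OF t(1)] C_rep_GL[OF t(1) y0(1), symmetric] t(2) ..
    then have 1: "lin_ext (\<lambda>b. basis_elt (flag_act (inv ?a) b)) (C_rep y0) = C_rep u"
      using C_rep_normalize[OF u] by simp
    have "inv (inv g \<circ> transporter u) = ?a \<circ> g"
    proof -
      have "bij (inv g)" "bij (transporter u)" using GL_inv[OF g] t(1) by (auto simp: GL_def)
      then show ?thesis by (simp add: o_inv_distrib GL_inv_inv[OF g])
    qed
    then have 2: "inv (transporter (map (inv g) u)) = ?a \<circ> g"
      unfolding transporter_map[OF GL_inv[OF g] u] .
    have "C_chain (basis_elt z) - C_chain (fill (bar_bd1 map (basis_elt z)))
        = tensor (C_rep u) (basis_elt g) - (tensor (C_rep y0) (basis_elt (?a \<circ> g)) - tensor (C_rep y0) (basis_elt ?a))"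
      by (simp add: z C_chain_def fill_def bar_bd1_def lin_ext_diff 2)
    also have "\<dots> = bar_bd2 flag_act (?k (basis_elt z))"
      unfolding z lin_ext_basis prod.case bar_bd2_tensor 1 by simp
    finally show "C_chain (basis_elt z) - C_chain (fill (bar_bd1 map (basis_elt z))) = bar_bd2 flag_act (?k (basis_elt z))" .
  qed
  also have "\<dots> \<in> G_boundaries"
  proof (rule bar_bd2_in_G_boundaries, rule lin_ext_in_subspace[OF tensor_space_subspace])
    fix z assume "z \<in> Poly_Mapping.keys f"
    then obtain u g where z: "z = (u, g)" and u: "affine_basis u" and g: "g \<in> GL"
      using in_free_onD[OF assms] by blast
    show "(case z of (u, g) \<Rightarrow> tensor (C_rep y0) (basis_elt (inv (transporter u), g)))
        \<in> tensor_space Steinberg2 (free_on (GL \<times> GL))"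
      unfolding z prod.case
      by (rule tensor_in_tensor_space[OF C_rep_in_Steinberg2]) (simp add: g GL_inv[OF transporter(1)[OF u]])
  qed
  finally show ?thesis .
qed

definition fill_C :: "('b list \<Rightarrow>\<^sub>0 rat) \<Rightarrow> (('b set list \<times> 'b set list) \<times> ('b \<Rightarrow> 'b) \<Rightarrow>\<^sub>0 rat)" where
  "fill_C p = C_chain (fill p)"

lemma qlinear_fill_C: "qlinear fill_C"
proof -
  have "qlinear (\<lambda>p. C_chain (fill p))"
    unfolding C_chain_def fill_def by (rule qlinear_comp[OF qlinear_lin_ext qlinear_lin_ext])
  then show ?thesis unfolding fill_C_def[abs_def] .
qed

text \<open>The element g p - p is the boundary of p [g^-1], and the image of this chain has
  decomposable coefficients since \<open>p\<close> lies in FCR.\<close>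

lemma fill_C_GL_action:
  assumes "g \<in> GL" "p \<in> FCR_lift"
  shows "fill_C (GL_action g p - p) \<in> G_boundaries"
proof -
  let ?f = "tensor p (basis_elt (inv g))"
  have f: "?f \<in> FC_chains" unfolding tensor_space_free[symmetric]
    by (rule tensor_in_tensor_space[OF in_FCR_liftD(1)[OF assms(2)]]) (simp add: GL_inv[OF assms(1)])
  have bd: "bar_bd1 map ?f = GL_action g p - p"
    unfolding bar_bd1_tensor GL_inv_inv[OF assms(1)] ..
  have C: "C_chain ?f \<in> G_boundaries" unfolding C_chain_tensor
    by (rule tensor_decomposables_in_G_boundaries, rule tensor_in_tensor_space[OF in_FCR_liftD(2)[OF assms(2)]])
       (simp add: GL_inv[OF assms(1)])
  from rat_free.subspace_diff[OF G_boundaries_subspace C C_chain_minus_fill[OF f]]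
  show ?thesis unfolding bd fill_C_def by simp
qed

lemma fill_C_normalize:
  assumes "p \<in> free_on {u. affine_basis u}"
  shows "fill_C (lin_ext (\<lambda>u. basis_elt (normalize_base u)) p) = fill_C p"
proof -
  have "transporter (normalize_base u) = transporter u" for u by (simp add: transporter_def)
  then show ?thesis unfolding fill_C_def fill_def lin_ext_lin_ext lin_ext_basis by simp
qed

text \<open>The filling only sees points up to translation, so elements of FCR(V) matched by an
  affine map have the same filling class. This compares relations of the same shape at different
  affine bases.\<close>

lemma fill_C_transport:
  assumes "p \<in> FCR_lift" "p' \<in> free_on {u. affine_basis u}" "g \<in> GL"
    "lin_ext (\<lambda>u. basis_elt (normalize_base u)) p' = GL_action g (lin_ext (\<lambda>u. basis_elt (normalize_base u)) p)"
  shows "fill_C p' - fill_C p \<in> G_boundaries"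
proof -
  have pX: "p \<in> free_on {u. affine_basis u}" by (rule in_FCR_liftD(1)[OF assms(1)])
  have gp: "GL_action g p \<in> free_on {u. affine_basis u}"
    by (rule lin_ext_in_subspace[OF free_on_subspace])
       (use in_free_onD[OF pX] affine_basis_map_GL[OF assms(3)] in auto)
  have "lin_ext (\<lambda>u. basis_elt (normalize_base u)) p' = lin_ext (\<lambda>u. basis_elt (normalize_base u)) (GL_action g p)"
    unfolding assms(4) lin_ext_lin_ext lin_ext_basis normalize_base_map[OF assms(3)] ..
  then have "fill_C p' = fill_C (GL_action g p)"
    using fill_C_normalize[OF assms(2)] fill_C_normalize[OF gp] by simp
  then show ?thesis using fill_C_GL_action[OF assms(3,1)] by (simp add: qlinear_diff[OF qlinear_fill_C])
qed

end

section \<open>Cyclic and shuffle relations in the coinvariants\<close>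

definition sym_elt :: "'b list \<Rightarrow> ('b list \<Rightarrow>\<^sub>0 rat)" where
  "sym_elt u = (\<Sum>w\<in>permutations_of_set (set (tl u)). basis_elt (hd u # w))"

lemma permutations_of_set_mset:
  assumes "distinct p" "p' \<in> permutations_of_set (set p)"
  shows "mset p' = mset p"
  using assms set_eq_iff_mset_eq_distinct[of p' p] by (auto simp: permutations_of_set_def)

lemma shuffle_sum_in_FC_rel:
  "affine_basis (x # p @ q) \<Longrightarrow> p \<noteq> [] \<Longrightarrow> q \<noteq> [] \<Longrightarrow>
    (\<Sum>w\<in>shuffles p q. basis_elt (x # w)) \<in> FC_rel"
  unfolding FC_rel_def by (rule rat_free.span_base) blast

lemma affine_basis_permutations:
  assumes "affine_basis (x # p @ q)" "z \<in> permutations_of_set (set p) \<times> permutations_of_set (set q)"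
  shows "affine_basis (x # fst z @ snd z)" "length (fst z) = length p" "length (snd z) = length q"
proof -
  have "distinct p" "distinct q" using affine_basis_distinct[OF assms(1)] by auto
  then have m: "mset (fst z) = mset p" "mset (snd z) = mset q"
    using assms(2) by (auto intro: permutations_of_set_mset)
  show "length (fst z) = length p" "length (snd z) = length q"
    using mset_eq_length[OF m(1)] mset_eq_length[OF m(2)] .
  have "mset (fst z @ snd z) = mset (p @ q)" using m by simp
  from affine_basis_mset[OF this] show "affine_basis (x # fst z @ snd z)" using assms(1) by blast
qed

text \<open>For every way of cutting the points after the first into two blocks, the same symmetric
  element is a sum of shuffle relations, one for each pair of orderings of the blocks. This links
  shuffle relations of different shapes.\<close>

lemma sym_elt_eq_sum_shuffles:
  assumes "affine_basis (x # p @ q)"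
  shows "sym_elt (x # p @ q) = (\<Sum>z\<in>permutations_of_set (set p) \<times> permutations_of_set (set q).
    \<Sum>w\<in>shuffles (fst z) (snd z). basis_elt (x # w))"
proof -
  have "set p \<inter> set q = {}" using affine_basis_distinct[OF assms] by auto
  from sum_permutations_of_set_Un[OF _ _ this] show ?thesis by (simp add: sym_elt_def)
qed

lemma sym_elt_in_FC_rel:
  assumes "affine_basis (x # p @ q)" "p \<noteq> []" "q \<noteq> []"
  shows "sym_elt (x # p @ q) \<in> FC_rel"
  unfolding sym_elt_eq_sum_shuffles[OF assms(1)]
proof (rule rat_free.subspace_sum[OF FC_rel_subspace])
  fix z assume z: "z \<in> permutations_of_set (set p) \<times> permutations_of_set (set q)"
  note a = affine_basis_permutations[OF assms(1) z]
  show "(\<Sum>w\<in>shuffles (fst z) (snd z). basis_elt (x # w)) \<in> FC_rel"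
    by (rule shuffle_sum_in_FC_rel[OF a(1)]) (use a(2,3) assms(2,3) in auto)
qed

lemma sym_elt_in_free_on:
  assumes "affine_basis (x # vs)"
  shows "sym_elt (x # vs) \<in> free_on {u. affine_basis u}"
  unfolding sym_elt_def list.sel
proof (rule rat_free.subspace_sum[OF free_on_subspace])
  fix w assume "w \<in> permutations_of_set (set vs)"
  then have "mset w = mset vs"
    using affine_basis_distinct[OF assms] by (intro permutations_of_set_mset) auto
  from affine_basis_mset[OF this] show "basis_elt (x # w) \<in> free_on {u. affine_basis u}"
    using assms by simp
qed

lemma card_permutations_affine:
  assumes "affine_basis (x # vs)"
  shows "card (permutations_of_set (set vs)) = fact n"
proof -
  have "card (set vs) = n"
    using affine_basis_distinct[OF assms] assms by (simp add: distinct_card affine_basis_Cons)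
  then show ?thesis by simp
qed

text \<open>\<open>F\<close> is the affine map v -> g (v - x) + x'. Being injective, it carries the
  shuffles and orderings of one list bijectively to those of the other.\<close>

lemma ex_affine_map:
  assumes "affine_basis (x # vs)" "affine_basis (x' # vs')"
  obtains g F where "g \<in> GL" "inj F" "map F vs = vs'"
    "\<And>w. normalize_base (x' # map F w) = map g (normalize_base (x # w))"
proof -
  obtain g where g: "g \<in> GL" "map g (normalize_base (x # vs)) = normalize_base (x' # vs')"
    using ex_GL_normalize[OF assms] by blast
  define F where "F v = g (v - x) + x'" for v
  have inj: "inj g" using g(1) by (simp add: GL_def bij_is_inj)
  have "inj F" unfolding F_def by (rule injI) (simp add: inj_eq[OF inj])
  moreover have "map F vs = vs'"
  proof -
    have "map g (star x vs) = star x' vs'" using g(2) by (simp add: normalize_base_Cons)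
    then have "map (\<lambda>v. v + x') (map g (star x vs)) = map (\<lambda>v. v + x') (star x' vs')" by simp
    then show ?thesis by (simp add: star_def F_def[abs_def] comp_def)
  qed
  moreover have "normalize_base (x' # map F w) = map g (normalize_base (x # w))" for w
    by (simp add: normalize_base_Cons star_def F_def GL_apply[OF g(1)] comp_def)
  ultimately show ?thesis using that g(1) by blast
qed

context
  fixes y0 :: "'b list"
  assumes y0: "affine_basis y0" "normalize_base y0 = y0"
begin

abbreviation fill_class where "fill_class \<equiv> fill_C y0"

lemma fill_class_shuffle:
  assumes "affine_basis (x # p @ q)" "affine_basis (x' # p' @ q')" "length p' = length p"
    "length q' = length q" "p \<noteq> []" "q \<noteq> []"
  shows "fill_class (\<Sum>w\<in>shuffles p' q'. basis_elt (x' # w)) - fill_class (\<Sum>w\<in>shuffles p q. basis_elt (x # w))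
    \<in> G_boundaries"
proof -
  obtain g F where g: "g \<in> GL" and F: "inj F" "map F (p @ q) = p' @ q'"
    and nF: "\<And>w. normalize_base (x' # map F w) = map g (normalize_base (x # w))"
    using ex_affine_map[OF assms(1,2)] by blast
  have pq: "p' = map F p" "q' = map F q" using F(2) assms(3) by (auto simp: append_eq_append_conv)
  have ne: "p' \<noteq> []" "q' \<noteq> []" using assms by auto
  show ?thesis
  proof (rule fill_C_transport[OF y0 _ _ g])
    show "(\<Sum>w\<in>shuffles p q. basis_elt (x # w)) \<in> FCR_lift"
      using shuffle_sum_in_FC_rel[OF assms(1,5,6)] FC_rel_subset_FCR_lift by blast
    show "(\<Sum>w\<in>shuffles p' q'. basis_elt (x' # w)) \<in> free_on {u. affine_basis u}"
      using shuffle_sum_in_FC_rel[OF assms(2) ne] FC_rel_subset_FCR_lift in_FCR_liftD(1) by blast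
    have "inj_on (map F) (shuffles p q)" using F(1) by (meson inj_mapI inj_on_subset subset_UNIV)
    then show "lin_ext (\<lambda>u. basis_elt (normalize_base u)) (\<Sum>w\<in>shuffles p' q'. basis_elt (x' # w)) =
      GL_action g (lin_ext (\<lambda>u. basis_elt (normalize_base u)) (\<Sum>w\<in>shuffles p q. basis_elt (x # w)))"
      unfolding pq shuffles_map by (simp add: lin_ext_sum sum.reindex nF)
  qed
qed

lemma fill_class_sym_elt:
  assumes "affine_basis (x # vs)" "affine_basis (x' # vs')" "sym_elt (x # vs) \<in> FCR_lift"
  shows "fill_class (sym_elt (x' # vs')) - fill_class (sym_elt (x # vs)) \<in> G_boundaries"
proof -
  obtain g F where g: "g \<in> GL" and F: "inj F" "map F vs = vs'"
    and nF: "\<And>w. normalize_base (x' # map F w) = map g (normalize_base (x # w))"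
    using ex_affine_map[OF assms(1,2)] by blast
  show ?thesis
  proof (rule fill_C_transport[OF y0 assms(3) sym_elt_in_free_on[OF assms(2)] g])
    have inj: "inj_on (map F) (permutations_of_set (set vs))"
      using F(1) by (meson inj_mapI inj_on_subset subset_UNIV)
    have "permutations_of_set (set vs') = map F ` permutations_of_set (set vs)"
      unfolding F(2)[symmetric] set_map
      by (rule permutations_of_set_image_inj) (use F(1) inj_on_subset in blast)
    then show "lin_ext (\<lambda>u. basis_elt (normalize_base u)) (sym_elt (x' # vs')) =
      GL_action g (lin_ext (\<lambda>u. basis_elt (normalize_base u)) (sym_elt (x # vs)))"
      by (simp add: sym_elt_def lin_ext_sum sum.reindex[OF inj] nF)
  qed
qed

text \<open>An affine map carries \<open>u\<close> and its rotation to any later pair of consecutive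
  rotations, so modulo boundaries the class changes by the same amount at each step. After
  \<open>length u\<close> steps the list is back at \<open>u\<close>, so this amount times
  \<open>length u\<close> is 0, and one can divide.\<close>

lemma fill_class_rotate1:
  assumes "affine_basis u"
  shows "fill_class (basis_elt (rotate1 u) - basis_elt u) \<in> G_boundaries"
proof -
  let ?u = "\<lambda>i. (rotate1 ^^ i) u"
  let ?a = "\<lambda>i. fill_class (basis_elt (?u i))"
  have aff: "affine_basis (?u i)" for i
    by (induction i) (simp_all add: assms affine_basis_rotate1)
  have rel: "basis_elt (rotate1 v) - basis_elt v \<in> FCR_lift" if "affine_basis v" for v
  proof -
    have "basis_elt (rotate1 v) - basis_elt v \<in> FC_rel"
      unfolding FC_rel_def by (rule rat_free.span_base) (use that in blast)
    then show ?thesis using FC_rel_subset_FCR_lift by blast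
  qed
  have step: "(?a (Suc i) - ?a i) - (?a 1 - ?a 0) \<in> G_boundaries" for i
  proof -
    obtain g where g: "g \<in> GL" "map g (normalize_base u) = normalize_base (?u i)"
      using ex_GL_normalize[OF assms aff] by blast
    have "normalize_base (rotate1 (?u i)) = normalize_base (rotate1 (map g (normalize_base u)))"
      unfolding g(2) by (rule normalize_base_rotate1)
    also have "\<dots> = map g (normalize_base (rotate1 u))"
      unfolding rotate1_map normalize_base_map[OF g(1)] normalize_base_rotate1[of u, symmetric] ..
    finally have n: "normalize_base (rotate1 (?u i)) = map g (normalize_base (rotate1 u))" .
    have "fill_class (basis_elt (rotate1 (?u i)) - basis_elt (?u i)) - fill_class (basis_elt (rotate1 u) - basis_elt u)
      \<in> G_boundaries"
      by (rule fill_C_transport[OF y0 rel[OF assms] in_FCR_liftD(1)[OF rel[OF aff]] g(1)])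
         (simp add: lin_ext_diff n g(2))
    then show ?thesis by (simp add: qlinear_diff[OF qlinear_fill_C[OF y0]])
  qed
  have "(?a N - ?a 0) - qscale (of_nat N) (?a 1 - ?a 0) \<in> G_boundaries" for N
  proof (induction N)
    case 0
    then show ?case by (simp add: rat_free.subspace_0[OF G_boundaries_subspace])
  next
    case (Suc N)
    from rat_free.subspace_add[OF G_boundaries_subspace Suc step[of N]] show ?case
      by (simp add: rat_free.scale_left_distrib algebra_simps)
  qed
  \<comment> \<open>At this \<open>N\<close> the rotation is the identity and the first difference
    vanishes.\<close>
  from this[of "length u"] have "- qscale (of_nat (length u)) (?a 1 - ?a 0) \<in> G_boundaries"
    using rotate_id[of "length u" u] by (simp add: rotate_def)
  from rat_free.subspace_scale[OF G_boundaries_subspace this, of "- inverse (of_nat (length u))"]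
  have "qscale (inverse (of_nat (length u)) * of_nat (length u)) (?a 1 - ?a 0) \<in> G_boundaries"
    by simp
  moreover have "length u \<noteq> 0" using assms by (auto simp: affine_basis_def)
  ultimately show ?thesis by (simp add: qlinear_diff[OF qlinear_fill_C[OF y0]])
qed

text \<open>\<open>sym_elt y0\<close> has n! terms, so this element has coefficient sum 1, and
  \<open>augment p\<close> below is the coefficient sum of \<open>p\<close> times it. Taking values
  in the free space instead of the rationals lets it be subtracted from \<open>p\<close>.\<close>

definition mean_elt :: "'b list \<Rightarrow>\<^sub>0 rat" where
  "mean_elt = qscale (1 / fact n) (sym_elt y0)"

abbreviation augment :: "('b list \<Rightarrow>\<^sub>0 rat) \<Rightarrow> ('b list \<Rightarrow>\<^sub>0 rat)" where
  "augment \<equiv> lin_ext (\<lambda>_. mean_elt)"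

lemma y0_split:
  assumes "k \<le> n"
  obtains x p q where "y0 = x # p @ q" "length p = k" "length q = n - k"
proof -
  obtain x vs where y: "y0 = x # vs" using y0(1) by (cases y0) (auto simp: affine_basis_def)
  then have "length vs = n" using y0(1) by (simp add: affine_basis_Cons)
  then show ?thesis using that[of x "take k vs" "drop k vs"] y assms by simp
qed

text \<open>With k and l the lengths of \<open>p\<close> and \<open>q\<close>, the symmetric element
  is a sum of k! l! shuffle relations of the same shape, all with the same filling class. So one of
  them has 1 / (k! l!) times the class of the symmetric element. Its coefficient sum is the binomial
  coefficient n! / (k! l!), hence its augmentation is the same multiple.\<close>

lemma fill_class_shuffle_sum:
  assumes "affine_basis (x # p @ q)" "p \<noteq> []" "q \<noteq> []"
  shows "fill_class ((\<Sum>w\<in>shuffles p q. basis_elt (x # w)) - augment (\<Sum>w\<in>shuffles p q. basis_elt (x # w)))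
    \<in> G_boundaries"
proof -
  let ?sh = "\<lambda>x p q. \<Sum>w\<in>shuffles p q. basis_elt (x # w)"
  let ?Z = "permutations_of_set (set p) \<times> permutations_of_set (set q)"
  let ?s = "fill_class (?sh x p q)" and ?t = "fill_class (sym_elt y0)"
  note lin = qlinear_fill_C[OF y0]
  have n: "length p + length q = n" and dist: "distinct p" "distinct q" "set p \<inter> set q = {}"
    using assms(1) affine_basis_distinct[OF assms(1)] by (auto simp: affine_basis_Cons)
  obtain y p0 q0 where y: "y0 = y # p0 @ q0" "length p0 = length p" "length q0 = n - length p"
    using y0_split[of "length p"] n by auto
  have "p0 \<noteq> []" "q0 \<noteq> []" using y n assms(2,3) by auto
  from sym_elt_in_FC_rel[OF y0(1)[unfolded y(1)] this] have "sym_elt y0 \<in> FCR_lift"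
    using FC_rel_subset_FCR_lift y(1) by auto
  from fill_class_sym_elt[OF y0(1)[unfolded y(1)] assms(1) this[unfolded y(1)]]
  have 1: "fill_class (sym_elt (x # p @ q)) - ?t \<in> G_boundaries" using y(1) by simp
  have "(\<Sum>z\<in>?Z. fill_class (?sh x (fst z) (snd z)) - ?s) \<in> G_boundaries"
  proof (rule rat_free.subspace_sum[OF G_boundaries_subspace])
    fix z assume z: "z \<in> ?Z"
    note a = affine_basis_permutations[OF assms(1) z]
    show "fill_class (?sh x (fst z) (snd z)) - ?s \<in> G_boundaries"
      by (rule fill_class_shuffle[OF assms(1) a assms(2,3)])
  qed
  moreover have "card ?Z = fact (length p) * fact (length q)"
    using dist by (simp add: card_cartesian_product distinct_card)
  ultimately have 2: "fill_class (sym_elt (x # p @ q)) - qscale (fact (length p) * fact (length q)) ?s \<in> G_boundaries"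
    by (simp add: sym_elt_eq_sum_shuffles[OF assms(1)] qlinear_sum[OF lin] sum_subtractf
        rat_free.sum_constant_scale del: sum_constant)
  let ?c = "fact (length p) * fact (length q) :: rat"
  have "qscale ?c ?s - ?t \<in> G_boundaries"
    using rat_free.subspace_diff[OF G_boundaries_subspace 1 2] by simp
  from rat_free.subspace_scale[OF G_boundaries_subspace this, of "1 / ?c"]
  have 3: "?s - qscale (1 / ?c) ?t \<in> G_boundaries"
    by (simp add: rat_free.scale_right_diff_distrib)
  have "augment (?sh x p q) = qscale (of_nat (card (shuffles p q)) * (1 / fact n)) (sym_elt y0)"
    by (simp add: lin_ext_sum mean_elt_def rat_free.sum_constant_scale del: sum_constant)
  also have "of_nat (card (shuffles p q)) * (1 / fact n) = 1 / ?c"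
  proof -
    have "n - length p = length q" using n by simp
    then show ?thesis using n binomial_fact[of "length p" n, where ?'a = rat]
      by (simp add: card_disjoint_shuffles[OF dist(3)] field_simps)
  qed
  finally have "fill_class (augment (?sh x p q)) = qscale (1 / ?c) ?t" by (simp only: qlinear_scale[OF lin])
  then show ?thesis using 3 by (simp only: qlinear_diff[OF lin])
qed

text \<open>On relations the filling class depends on the coefficient sum only. Translations,
  rotations and differences g p - p have coefficient sum 0 and a trivial class; shuffle relations
  are covered by the preceding count.\<close>

lemma fill_class_coinv_rel:
  assumes "r \<in> FCR_coinv_rel"
  shows "fill_class (r - augment r) \<in> G_boundaries"
proof -
  note lin = qlinear_fill_C[OF y0]
  have T: "qlinear (\<lambda>r. fill_class (r - augment r))"
    by (rule qlinearI) (simp_all add: lin_ext_add lin_ext_scale qlinear_diff[OF lin] qlinear_add'[OF lin]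
        qlinear_scale[OF lin] rat_free.scale_right_diff_distrib)
  show ?thesis
  proof (rule span_induct_linear[OF assms[unfolded FCR_coinv_rel_def] G_boundaries_subspace T], erule UnE)
    fix r assume "r \<in> FC_rel"
    show "fill_class (r - augment r) \<in> G_boundaries"
    proof (rule span_induct_linear[OF \<open>r \<in> FC_rel\<close>[unfolded FC_rel_def] G_boundaries_subspace T], elim UnE)
      fix r assume "r \<in> {basis_elt (map (\<lambda>x. x + t) u) - basis_elt u |t u. affine_basis u}"
      then obtain t u where r: "r = basis_elt (map (\<lambda>x. x + t) u) - basis_elt u" and u: "affine_basis u" by blast
      have "normalize_base (map (\<lambda>x. x + t) u) = normalize_base u"
        by (cases u) (simp_all add: normalize_base_def)
      then have "fill_class (basis_elt (map (\<lambda>x. x + t) u)) = fill_class (basis_elt u)"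
        using fill_C_normalize[OF y0, of "basis_elt (map (\<lambda>x. x + t) u)"] fill_C_normalize[OF y0, of "basis_elt u"] u
        by (simp add: affine_basis_translate)
      then show "fill_class (r - augment r) \<in> G_boundaries"
        by (simp add: r lin_ext_diff qlinear_diff[OF lin] rat_free.subspace_0[OF G_boundaries_subspace])
    next
      fix r assume "r \<in> {basis_elt (rotate1 u) - basis_elt u |u. affine_basis u}"
      then obtain u where "r = basis_elt (rotate1 u) - basis_elt u" "affine_basis u" by blast
      then show "fill_class (r - augment r) \<in> G_boundaries"
        using fill_class_rotate1 by (simp add: lin_ext_diff)
    next
      fix r :: "'b list \<Rightarrow>\<^sub>0 rat"
      assume "r \<in> {\<Sum>w\<in>shuffles p q. basis_elt (x # w) |x p q. affine_basis (x # p @ q) \<and> p \<noteq> [] \<and> q \<noteq> []}"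
      then show "fill_class (r - augment r) \<in> G_boundaries" using fill_class_shuffle_sum by blast
    qed
  next
    fix r assume "r \<in> {GL_action g p - p |g p. g \<in> GL \<and> p \<in> FCR_lift}"
    then obtain g p where r: "r = GL_action g p - p" and g: "g \<in> GL" and p: "p \<in> FCR_lift" by blast
    have "augment r = 0" by (simp add: r lin_ext_diff lin_ext_lin_ext)
    then show "fill_class (r - augment r) \<in> G_boundaries"
      using fill_C_GL_action[OF y0 g p] by (simp add: r)
  qed
qed

text \<open>Injectivity of the connecting map on the level of chains. A chain agrees with the
  filling of its boundary, and a boundary has coefficient sum 0, so that its filling class is
  trivial once it is a relation.\<close>

lemma C_chain_in_G_boundaries_based:
  assumes "f \<in> FC_chains" "bar_bd1 map f \<in> FCR_coinv_rel"
  shows "C_chain f \<in> G_boundaries"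
proof -
  have "augment (bar_bd1 map f) = lin_ext (\<lambda>_. 0) f"
    unfolding bar_bd1_def lin_ext_lin_ext by (rule lin_ext_cong) (auto simp: lin_ext_diff)
  then have "augment (bar_bd1 map f) = 0" by (simp add: lin_ext_def)
  then have "fill_class (bar_bd1 map f) \<in> G_boundaries" using fill_class_coinv_rel[OF assms(2)] by simp
  from rat_free.subspace_add[OF G_boundaries_subspace C_chain_minus_fill[OF y0 assms(1)] this]
  show ?thesis by (simp add: fill_C_def[OF y0])
qed

text \<open>The filling bounds any element of coefficient sum 0. For n at least 2
  \<open>mean_elt\<close> is itself a relation, so the coefficient sum can be removed by subtracting
  a multiple of it; for n = 1 there is no shuffle relation to do so, and the sum has to vanish
  beforehand.\<close>

lemma ex_chain_boundary_based:
  assumes "p \<in> free_on {u. affine_basis u}" "n \<ge> 2 \<or> augment p = 0"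
  shows "\<exists>e\<in>FC_chains. bar_bd1 map e - p \<in> FC_rel"
proof -
  let ?nu = "lin_ext (\<lambda>u. basis_elt (normalize_base u))"
  obtain x vs where y: "y0 = x # vs" using y0(1) by (cases y0) (auto simp: affine_basis_def)
  have mean: "mean_elt \<in> free_on {u. affine_basis u}"
  proof -
    have "sym_elt y0 \<in> free_on {u. affine_basis u}"
      unfolding y by (rule sym_elt_in_free_on) (use y0(1) y in simp)
    then show ?thesis unfolding mean_elt_def by (rule rat_free.subspace_scale[OF free_on_subspace])
  qed
  have aug: "augment p \<in> free_on {u. affine_basis u}"
    by (rule lin_ext_in_subspace[OF free_on_subspace mean])
  have augrel: "augment p \<in> FC_rel"
  proof (cases "n \<ge> 2")
    case True
    obtain x p' q where s: "y0 = x # p' @ q" "length p' = 1" "length q = n - 1"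
      using y0_split[of 1] n_pos by auto
    have "p' \<noteq> []" "q \<noteq> []" using s True by auto
    from sym_elt_in_FC_rel[OF y0(1)[unfolded s(1)] this] have "mean_elt \<in> FC_rel"
      unfolding mean_elt_def unfolding s(1) by (rule rat_free.subspace_scale[OF FC_rel_subspace])
    then show ?thesis by (rule lin_ext_in_subspace[OF FC_rel_subspace])
  next
    case False
    then show ?thesis using assms(2) by (simp add: rat_free.subspace_0[OF FC_rel_subspace])
  qed
  have nu: "?nu r - r \<in> FC_rel" if "r \<in> free_on {u. affine_basis u}" for r
  proof -
    have "?nu r - r = lin_ext (\<lambda>u. basis_elt (normalize_base u) - basis_elt u) r"
      by (rule qlinear_eqI[of "\<lambda>r. ?nu r - r"])
         (auto intro!: qlinearI simp: lin_ext_add lin_ext_scale rat_free.scale_right_diff_distrib)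
    also have "\<dots> \<in> FC_rel"
    proof (rule lin_ext_in_subspace[OF FC_rel_subspace])
      fix u assume "u \<in> Poly_Mapping.keys r"
      then have "affine_basis u" using in_free_onD[OF that] by auto
      from rat_free.subspace_neg[OF FC_rel_subspace basis_minus_normalize_in_FC_rel[OF this]]
      show "basis_elt (normalize_base u) - basis_elt u \<in> FC_rel" by simp
    qed
    finally show ?thesis .
  qed
  have "lin_ext (\<lambda>_. basis_elt y0) mean_elt = basis_elt y0"
    using card_permutations_affine[OF y0(1)[unfolded y]]
    unfolding mean_elt_def unfolding y
    by (simp add: sym_elt_def lin_ext_scale lin_ext_sum rat_free.sum_constant_scale del: sum_constant card_permutations_of_set)
  then have 0: "lin_ext (\<lambda>_. basis_elt y0) (p - augment p) = 0"
    by (simp add: lin_ext_diff lin_ext_lin_ext)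
  have pa: "p - augment p \<in> free_on {u. affine_basis u}"
    by (rule rat_free.subspace_diff[OF free_on_subspace assms(1) aug])
  let ?e = "fill y0 (p - augment p)"
  have "bar_bd1 map ?e - p = (?nu p - p) - ((?nu (augment p) - augment p) + augment p)"
    unfolding bar_bd1_fill[OF y0 pa] 0 by (simp add: lin_ext_diff)
  also have "\<dots> \<in> FC_rel"
    by (intro rat_free.subspace_diff[OF FC_rel_subspace] rat_free.subspace_add[OF FC_rel_subspace] nu assms(1) aug augrel)
  finally show ?thesis using fill_in[OF y0 pa] by blast
qed

end

end

section \<open>Correlators\<close>

lemma quot_lincomb_coset:
  assumes "rat_free.subspace R" "\<And>i. i \<in> I \<Longrightarrow> X i = coset R (x i)"
  shows "quot_lincomb R I a X = coset R (\<Sum>i\<in>I. qscale (a i) (x i))"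
proof -
  have "(SOME y. y \<in> X i) - x i \<in> R" if "i \<in> I" for i
  proof -
    have "x i \<in> X i" using assms(2)[OF that] rat_free.subspace_0[OF assms(1)] by (simp add: mem_coset)
    then have "(SOME y. y \<in> X i) \<in> X i" by (rule someI)
    then show ?thesis using assms(2)[OF that] by (simp add: mem_coset)
  qed
  then have "(\<Sum>i\<in>I. qscale (a i) ((SOME y. y \<in> X i) - x i)) \<in> R"
    by (intro rat_free.subspace_sum[OF assms(1)] rat_free.subspace_scale[OF assms(1)])
  then show ?thesis
    unfolding quot_lincomb_def coset_eq_iff[OF assms(1)]
    by (simp add: rat_free.scale_right_diff_distrib sum_subtractf)
qed

context fd_correlator_space
begin

lemma ex_normalized_affine_basis: "\<exists>y0. affine_basis y0 \<and> normalize_base y0 = y0"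
proof -
  obtain B where B: "finite B" "independent B" "card B = n" using ex_basis by blast
  obtain bs where bs: "set bs = B" "distinct bs" using finite_distinct_list[OF B(1)] by blast
  have "affine_basis (0 # bs)"
    using B bs distinct_card[OF bs(2)] by (simp add: affine_basis_zero indep_list_def)
  moreover have "normalize_base (0 # bs) = 0 # bs" by (simp add: normalize_base_def)
  ultimately show ?thesis by blast
qed

lemma C_chain_in_G_boundaries:
  assumes "f \<in> FC_chains" "bar_bd1 map f \<in> FCR_coinv_rel"
  shows "C_chain f \<in> G_boundaries"
  using ex_normalized_affine_basis C_chain_in_G_boundaries_based[OF _ _ assms] by blast

text \<open>A nonzero functional on a line does not vanish on u_1 - u_0, and S(0,1) is one monomial.
  Hence id - D_h has coefficient sum 0 on generators in dimension 1, as the existence of a bounding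
  chain requires.\<close>

lemma D_map_dim_1:
  assumes "nonzero_functional h" "affine_basis u" "n = 1"
  shows "\<exists>w. D_map h u = basis_elt w"
proof -
  have lin: "Vector_Spaces.linear scale (*) h" and hnz: "\<exists>v. h v \<noteq> 0"
    using assms(1) by (auto simp: nonzero_functional_def)
  interpret h: Vector_Spaces.linear scale "(*)" h by (rule lin)
  obtain x v vs where u: "u = x # v # vs" using affine_basis_cases[OF assms(2)] .
  then have vs: "vs = []" using assms(2,3) by (simp add: affine_basis_Cons)
  let ?y = "v - x"
  have bas: "basis_list [?y]" using assms(2) by (simp add: u vs affine_basis_def)
  then have y: "?y \<notin> span {}" by (simp add: basis_list_def indep_list_Cons)
  have "h ?y \<noteq> 0"
  proof
    assume h0: "h ?y = 0"
    have "h z = 0" for z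
    proof -
      have "z \<in> span {?y}" using bas by (simp add: basis_list_def)
      then show ?thesis using h0 by (auto simp: span_singleton h.scale)
    qed
    then show False using hnz by blast
  qed
  then have "opp_words h (Suc 0) [?y] [?y] = basis_elt [inverse (h ?y) *s ?y]" using y by simp
  then have "D_map h u = basis_elt [0, inverse (h ?y) *s ?y]"
    using D_map_eq_FC_words[OF lin assms(2)[unfolded u vs]] by (simp add: u vs assms(3) FC_words_def)
  then show ?thesis by blast
qed

lemma ex_chain_boundary:
  assumes "nonzero_functional h" "affine_basis u"
  shows "\<exists>e\<in>FC_chains. bar_bd1 map e - (basis_elt u - D_map h u) \<in> FC_rel"
proof -
  obtain y0 where y0: "affine_basis y0" "normalize_base y0 = y0" using ex_normalized_affine_basis by blast
  have "n \<ge> 2 \<or> lin_ext (\<lambda>_. mean_elt y0) (basis_elt u - D_map h u) = 0"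
  proof (cases "n = 1")
    case True
    then show ?thesis using D_map_dim_1[OF assms True] by (auto simp: lin_ext_diff)
  qed (use n_pos in simp)
  from ex_chain_boundary_based[OF y0 in_FCR_liftD(1)[OF basis_minus_D_map_in_FCR_lift[OF assms]] this]
  show ?thesis .
qed

lemma D_map_GL:
  assumes "g \<in> GL" "\<And>v. h' (g v) = h v" "nonzero_functional h" "nonzero_functional h'"
    "affine_basis u" "affine_basis u'" "map g (normalize_base u) = normalize_base u'"
  shows "D_map h' u' = GL_action g (D_map h u)"
proof -
  have lin: "Vector_Spaces.linear scale (*) h" "Vector_Spaces.linear scale (*) h'"
    using assms(3,4) by (auto simp: nonzero_functional_def)
  obtain x vs where u: "u = x # vs" using assms(5) by (cases u) (auto simp: affine_basis_def)
  obtain x' vs' where u': "u' = x' # vs'" using assms(6) by (cases u') (auto simp: affine_basis_def)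
  have path: "path_edges x rs = path_edges 0 (star x rs)" for x rs
    using path_edges_translate[of x "- x" rs] by (simp add: star_def)
  have path_map: "path_edges (g x) (map g rs) = map g (path_edges x rs)" for x rs
    by (induction rs arbitrary: x) (simp_all add: GL_apply[OF assms(1)])
  have "map g (star x vs) = star x' vs'" using assms(7) by (simp add: u u' normalize_base_Cons)
  then have "rev (map g (star x vs)) = rev (star x' vs')" by simp
  then have st: "star x' (rev vs') = map g (star x (rev vs))" by (simp add: star_def rev_map)
  have pt: "path_edges x' (rev vs') = map g (path_edges x (rev vs))"
    unfolding path[of x'] path[of x] st path_map[symmetric] GL_apply(4)[OF assms(1)] ..
  have "D_map h' u' = FC_words (lin_ext (\<lambda>w. basis_elt (map g w)) (opp_words h n (star x (rev vs)) (path_edges x (rev vs))))"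
    unfolding u' D_map_eq_FC_words[OF lin(2) assms(6)[unfolded u']] st pt opp_words_map[OF assms(1), of h' h, OF assms(2)] ..
  also have "\<dots> = GL_action g (D_map h u)"
    unfolding u D_map_eq_FC_words[OF lin(1) assms(5)[unfolded u]]
    by (simp add: FC_words_def lin_ext_lin_ext rev_map GL_apply[OF assms(1)])
  finally show ?thesis .
qed

text \<open>A \<open>g\<close> that matches the two affine bases up to translation also matches
  \<open>h\<close> with \<open>h'\<close>, since these agree on differences of points; so it carries
  D_h to D_h'. The difference is then a translation relation plus g p - p with \<open>p\<close> in
  FCR. This is the independence of choices in \<open>Cor\<close>.\<close>

lemma minus_D_map_coinvariant:
  assumes "nonzero_functional h" "nonzero_functional h'" "affine_basis u" "affine_basis u'"
    "\<And>i. i < length u \<Longrightarrow> h' (u' ! i) - h' (u' ! 0) = h (u ! i) - h (u ! 0)"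
  shows "(basis_elt u' - D_map h' u') - (basis_elt u - D_map h u) \<in> FCR_coinv_rel"
proof -
  have lin: "Vector_Spaces.linear scale (*) h" "Vector_Spaces.linear scale (*) h'"
    using assms(1,2) by (auto simp: nonzero_functional_def)
  interpret h: Vector_Spaces.linear scale "(*)" h by (rule lin)
  interpret h': Vector_Spaces.linear scale "(*)" h' by (rule lin)
  obtain x vs where u: "u = x # vs" using assms(3) by (cases u) (auto simp: affine_basis_def)
  obtain x' vs' where u': "u' = x' # vs'" using assms(4) by (cases u') (auto simp: affine_basis_def)
  have len: "length vs = n" "length vs' = n" using assms(3,4) by (simp_all add: u u' affine_basis_Cons)
  obtain g where g: "g \<in> GL" "map g (normalize_base u) = normalize_base u'"
    using ex_GL_normalize[OF assms(3,4)] by blast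
  have st: "map g (star x vs) = star x' vs'" using g(2) by (simp add: u u' normalize_base_Cons)
  have hg: "h' (g v) = h v" for v
  proof -
    have base: "h' (g w) = h w" if w: "w \<in> set (star x vs)" for w
    proof -
      obtain j where j: "j < n" "w = vs ! j - x" using w len by (auto simp: star_def in_set_conv_nth)
      have "g (star x vs ! j) = star x' vs' ! j" unfolding st[symmetric] using j len by simp
      then have "g w = vs' ! j - x'" using j len by (simp add: star_def)
      then show ?thesis using assms(5)[of "Suc j"] j len by (simp add: u u' h.diff h'.diff)
    qed
    have "v \<in> span (set (star x vs))"
      using assms(3) by (simp add: u affine_basis_def star_def basis_list_def)
    then show ?thesis
      by (induction rule: span_induct_alt)
         (simp_all add: base GL_apply[OF g(1)] h.zero h'.zero h.add h'.add h.scale h'.scale)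
  qed
  let ?p = "basis_elt u - D_map h u"
  have gu: "affine_basis (map g u)" using affine_basis_map_GL[OF g(1)] assms(3) by blast
  have "normalize_base (map g u) = normalize_base u'" unfolding normalize_base_map[OF g(1)] g(2) ..
  then have "(basis_elt u' - basis_elt (normalize_base u')) - (basis_elt (map g u) - basis_elt (normalize_base (map g u)))
      = basis_elt u' - basis_elt (map g u)" by simp
  then have 1: "basis_elt u' - basis_elt (map g u) \<in> FC_rel"
    using rat_free.subspace_diff[OF FC_rel_subspace basis_minus_normalize_in_FC_rel[OF assms(4)]
        basis_minus_normalize_in_FC_rel[OF gu]] by argo
  have "D_map h' u' = GL_action g (D_map h u)"
    by (rule D_map_GL[OF g(1) hg assms(1-4) g(2)])
  then have "(basis_elt u' - D_map h' u') - ?p = (basis_elt u' - basis_elt (map g u)) + (GL_action g ?p - ?p)"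
    by (simp add: lin_ext_diff)
  also have "\<dots> \<in> FCR_coinv_rel"
    unfolding FCR_coinv_rel_def
  proof (intro rat_free.span_add rat_free.span_base)
    show "basis_elt u' - basis_elt (map g u) \<in> FC_rel \<union> {GL_action g p - p |g p. g \<in> GL \<and> p \<in> FCR_lift}"
      using 1 by blast
    show "GL_action g ?p - ?p \<in> FC_rel \<union> {GL_action g p - p |g p. g \<in> GL \<and> p \<in> FCR_lift}"
      using g(1) basis_minus_D_map_in_FCR_lift[OF assms(1,3)] by blast
  qed
  finally show ?thesis .
qed

lemma FCR_coinv_rel_subspace: "rat_free.subspace FCR_coinv_rel"
  unfolding FCR_coinv_rel_def by (rule rat_free.subspace_span)

lemma FC_rel_subset_FCR_coinv_rel: "FC_rel \<subseteq> FCR_coinv_rel"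
  unfolding FCR_coinv_rel_def using rat_free.span_superset by blast

lemma bar_bd1_diff: "bar_bd1 act (p - q) = bar_bd1 act p - bar_bd1 act q"
  and bar_bd1_scale: "bar_bd1 act (qscale c p) = qscale c (bar_bd1 act p)"
  and bar_bd1_sum: "bar_bd1 act (\<Sum>i\<in>I. f i) = (\<Sum>i\<in>I. bar_bd1 act (f i))"
  unfolding bar_bd1_def by (rule lin_ext_diff lin_ext_scale lin_ext_sum)+

text \<open>Turns the definite description into a usable representative. A chain bounding (id -
  D_h)(u) gives existence; any other candidate comes from a chain with the same boundary in the
  coinvariants, and injectivity identifies the classes.\<close>

lemma Cor_eq_coset:
  assumes "nonzero_functional h" "affine_basis u"
  shows "\<exists>e\<in>FC_chains. bar_bd1 map e - (basis_elt u - D_map h u) \<in> FCR_coinv_rel \<and>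
    Cor (map h u) = coset G_boundaries (C_chain e)"
proof -
  let ?p = "basis_elt u - D_map h u"
  obtain e where e: "e \<in> FC_chains" and be: "bar_bd1 map e - ?p \<in> FCR_coinv_rel"
    using ex_chain_boundary[OF assms] FC_rel_subset_FCR_coinv_rel by blast
  have lift: "bar_bd1 map e \<in> FCR_lift"
  proof -
    have "(bar_bd1 map e - ?p) + ?p \<in> FCR_lift"
      using be FCR_coinv_rel_subset basis_minus_D_map_in_FCR_lift[OF assms]
      by (intro rat_free.subspace_add[OF FCR_lift_subspace]) auto
    then show ?thesis by simp
  qed
  have chains: "tensor_space (free_on {u. affine_basis u}) (free_on GL) = FC_chains"
    by (rule tensor_space_free)
  have "Cor (map h u) = coset G_boundaries (C_chain e)"
    unfolding Cor_def
  proof (rule the_equality)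
    have cyc: "C_chain e \<in> H1_cycles GL flag_act Steinberg2 decomposables"
      unfolding H1_cycles_def using C_chain_in[OF e] bar_bd1_C_chain[OF e] in_FCR_liftD(2)[OF lift] by simp
    have "connecting (coset G_boundaries (C_chain e)) (coset FCR_coinv_rel ?p)"
      unfolding connecting_def chains C_chain_def[symmetric]
    proof (intro conjI bexI)
      show "coset G_boundaries (C_chain e) \<in> G_space"
        unfolding G_space_def group_H1_def G_boundaries_def[symmetric] using cyc by blast
      show "C_chain e - C_chain e \<in> tensor_space decomposables (free_on GL)"
        by (simp add: rat_free.subspace_0[OF tensor_space_subspace])
      show "coset FCR_coinv_rel ?p = coset FCR_coinv_rel (bar_bd1 map e)"
        using be coset_eq_iff[OF FCR_coinv_rel_subspace, of "bar_bd1 map e" ?p] by simp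
      show "C_chain e \<in> coset G_boundaries (C_chain e)"
        by (simp add: mem_coset rat_free.subspace_0[OF G_boundaries_subspace])
    qed (rule lift, rule e)
    moreover have "h (u ! i) - h (u ! 0) = map h u ! i - map h u ! 0" if "i < length u" for i
    proof -
      have "0 < length u" using that by linarith
      then show ?thesis using that by simp
    qed
    ultimately show "\<exists>v k. affine_basis v \<and> nonzero_functional k \<and> length (map h u) = length v \<and>
      (\<forall>i<length v. k (v ! i) - k (v ! 0) = map h u ! i - map h u ! 0) \<and>
      connecting (coset G_boundaries (C_chain e)) (coset FCR_coinv_rel (basis_elt v - D_map k v))"
      using assms by (intro exI[of _ u] exI[of _ h]) simp
  next
    fix z
    assume "\<exists>v k. affine_basis v \<and> nonzero_functional k \<and> length (map h u) = length v \<and>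
      (\<forall>i<length v. k (v ! i) - k (v ! 0) = map h u ! i - map h u ! 0) \<and>
      connecting z (coset FCR_coinv_rel (basis_elt v - D_map k v))"
    then obtain v k where v: "affine_basis v" and k: "nonzero_functional k" and len: "length u = length v"
      and kv: "\<And>i. i < length v \<Longrightarrow> k (v ! i) - k (v ! 0) = map h u ! i - map h u ! 0"
      and con: "connecting z (coset FCR_coinv_rel (basis_elt v - D_map k v))" by auto
    let ?q = "basis_elt v - D_map k v"
    from con obtain c e' where z: "z \<in> G_space" and c: "c \<in> z" and e': "e' \<in> FC_chains"
      and ce: "C_chain e' - c \<in> tensor_space decomposables (free_on GL)"
      and cos: "coset FCR_coinv_rel ?q = coset FCR_coinv_rel (bar_bd1 map e')"
      unfolding connecting_def chains C_chain_def[symmetric] by blast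
    have be': "?q - bar_bd1 map e' \<in> FCR_coinv_rel"
      using cos unfolding coset_eq_iff[OF FCR_coinv_rel_subspace] .
    have "?q - ?p \<in> FCR_coinv_rel"
    proof (rule minus_D_map_coinvariant[OF assms(1) k assms(2) v])
      fix i assume i: "i < length u"
      then have "0 < length u" by linarith
      then show "k (v ! i) - k (v ! 0) = h (u ! i) - h (u ! 0)" using kv[of i] i len by simp
    qed
    \<comment> \<open>In this combination \<open>?p\<close> and \<open>?q\<close> drop out and only
      the boundary of e' - e remains.\<close>
    from rat_free.subspace_diff[OF FCR_coinv_rel_subspace rat_free.subspace_diff[OF FCR_coinv_rel_subspace this be'] be]
    have "(?q - ?p) - (?q - bar_bd1 map e') - (bar_bd1 map e - ?p) \<in> FCR_coinv_rel" .
    then have "bar_bd1 map (e' - e) \<in> FCR_coinv_rel" by (simp add: bar_bd1_diff)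
    moreover have "e' - e \<in> FC_chains" using rat_free.subspace_diff[OF free_on_subspace e' e] .
    ultimately have "C_chain (e' - e) \<in> G_boundaries" by (intro C_chain_in_G_boundaries)
    then have 1: "C_chain e' - C_chain e \<in> G_boundaries" by (simp add: C_chain_def lin_ext_diff)
    have 2: "C_chain e' - c \<in> G_boundaries" by (rule tensor_decomposables_in_G_boundaries[OF ce])
    obtain d where d: "z = coset G_boundaries d"
      using z unfolding G_space_def group_H1_def G_boundaries_def[symmetric] by blast
    have 3: "c - d \<in> G_boundaries" using c by (simp add: d mem_coset)
    from rat_free.subspace_diff[OF G_boundaries_subspace rat_free.subspace_diff[OF G_boundaries_subspace 1 2] 3]
    have "(C_chain e' - C_chain e) - (C_chain e' - c) - (c - d) \<in> G_boundaries" .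
    then have "d - C_chain e \<in> G_boundaries" by (simp add: algebra_simps)
    then show "z = coset G_boundaries (C_chain e)"
      unfolding d coset_eq_iff[OF G_boundaries_subspace] .
  qed
  then show ?thesis using e be by blast
qed

text \<open>Compare bounding chains for the two functionals. The generators \<open>u i\<close>
  cancel in the boundary of the difference, which modulo relations is D_h2 p - D_h1 p. Both terms
  are relations because \<open>p\<close> lies in FCR, so injectivity makes the difference of the
  chains a boundary.\<close>

lemma quot_lincomb_Cor_eq:
  assumes "\<And>i. i \<in> I \<Longrightarrow> affine_basis (u i)"
    "quot_lincomb decomposables I a (\<lambda>i. C_class (u i)) = coset decomposables 0"
    "nonzero_functional h1" "nonzero_functional h2"
  shows "quot_lincomb G_boundaries I a (\<lambda>i. Cor (map h1 (u i)))
    = quot_lincomb G_boundaries I a (\<lambda>i. Cor (map h2 (u i)))"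
proof -
  define p where "p = (\<Sum>i\<in>I. qscale (a i) (basis_elt (u i)))"
  have C: "(\<Sum>i\<in>I. qscale (a i) (C_rep (u i))) \<in> decomposables"
    using assms(2)
    unfolding quot_lincomb_coset[OF decomposables_subspace C_class_def] coset_eq_iff[OF decomposables_subspace]
    by simp
  have p: "p \<in> FCR_lift"
  proof -
    have "p \<in> free_on {u. affine_basis u}" unfolding p_def
      using assms(1) by (intro rat_free.subspace_sum[OF free_on_subspace] rat_free.subspace_scale[OF free_on_subspace]) simp
    moreover have "lin_ext C_rep p \<in> decomposables" using C by (simp add: p_def lin_ext_sum lin_ext_scale)
    ultimately show ?thesis by (simp add: FCR_lift_def)
  qed
  have "\<forall>i\<in>I. \<exists>e. e \<in> FC_chains \<and> bar_bd1 map e - (basis_elt (u i) - D_map h (u i)) \<in> FCR_coinv_rel \<and>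
      Cor (map h (u i)) = coset G_boundaries (C_chain e)" if "nonzero_functional h" for h
    using Cor_eq_coset[OF that assms(1)] by blast
  from bchoice[OF this[OF assms(3)]] bchoice[OF this[OF assms(4)]] obtain e1 e2
    where e1: "\<And>i. i \<in> I \<Longrightarrow> e1 i \<in> FC_chains"
        "\<And>i. i \<in> I \<Longrightarrow> bar_bd1 map (e1 i) - (basis_elt (u i) - D_map h1 (u i)) \<in> FCR_coinv_rel"
        "\<And>i. i \<in> I \<Longrightarrow> Cor (map h1 (u i)) = coset G_boundaries (C_chain (e1 i))"
      and e2: "\<And>i. i \<in> I \<Longrightarrow> e2 i \<in> FC_chains"
        "\<And>i. i \<in> I \<Longrightarrow> bar_bd1 map (e2 i) - (basis_elt (u i) - D_map h2 (u i)) \<in> FCR_coinv_rel"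
        "\<And>i. i \<in> I \<Longrightarrow> Cor (map h2 (u i)) = coset G_boundaries (C_chain (e2 i))"
    by blast
  let ?e = "\<Sum>i\<in>I. qscale (a i) (e1 i - e2 i)"
  have e: "?e \<in> FC_chains"
    using e1(1) e2(1)
    by (intro rat_free.subspace_sum[OF free_on_subspace] rat_free.subspace_scale[OF free_on_subspace]
        rat_free.subspace_diff[OF free_on_subspace])
  let ?d = "\<lambda>e h i. bar_bd1 map (e i) - (basis_elt (u i) - D_map h (u i))"
  have "(\<Sum>i\<in>I. qscale (a i) (?d e1 h1 i - ?d e2 h2 i)) \<in> FCR_coinv_rel"
    by (rule rat_free.subspace_sum[OF FCR_coinv_rel_subspace], rule rat_free.subspace_scale[OF FCR_coinv_rel_subspace],
        rule rat_free.subspace_diff[OF FCR_coinv_rel_subspace e1(2) e2(2)])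
  moreover have "lin_ext (D_map h2) p - lin_ext (D_map h1) p \<in> FCR_coinv_rel"
    using lin_ext_D_map_in_FC_rel[OF assms(3) p] lin_ext_D_map_in_FC_rel[OF assms(4) p] FC_rel_subset_FCR_coinv_rel
    by (intro rat_free.subspace_diff[OF FCR_coinv_rel_subspace]) auto
  moreover have "bar_bd1 map ?e = (\<Sum>i\<in>I. qscale (a i) (?d e1 h1 i - ?d e2 h2 i))
      + (lin_ext (D_map h2) p - lin_ext (D_map h1) p)"
    by (simp add: bar_bd1_sum bar_bd1_scale bar_bd1_diff p_def lin_ext_sum lin_ext_scale
        sum_subtractf[symmetric] sum.distrib[symmetric] rat_free.scale_right_diff_distrib[symmetric]
        rat_free.scale_right_distrib[symmetric])
  ultimately have "bar_bd1 map ?e \<in> FCR_coinv_rel"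
    using rat_free.subspace_add[OF FCR_coinv_rel_subspace] by simp
  from C_chain_in_G_boundaries[OF e this]
  have "(\<Sum>i\<in>I. qscale (a i) (C_chain (e1 i))) - (\<Sum>i\<in>I. qscale (a i) (C_chain (e2 i))) \<in> G_boundaries"
    by (simp add: C_chain_def lin_ext_sum lin_ext_scale lin_ext_diff rat_free.scale_right_diff_distrib sum_subtractf)
  moreover have "quot_lincomb G_boundaries I a (\<lambda>i. Cor (map h1 (u i)))
      = coset G_boundaries (\<Sum>i\<in>I. qscale (a i) (C_chain (e1 i)))"
    by (rule quot_lincomb_coset[OF G_boundaries_subspace e1(3)])
  moreover have "quot_lincomb G_boundaries I a (\<lambda>i. Cor (map h2 (u i)))
      = coset G_boundaries (\<Sum>i\<in>I. qscale (a i) (C_chain (e2 i)))"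
    by (rule quot_lincomb_coset[OF G_boundaries_subspace e2(3)])
  ultimately show ?thesis by (simp only: coset_eq_iff[OF G_boundaries_subspace])
qed

end

theorem theoremE:
  fixes scale :: "'f::field \<Rightarrow> 'v::ab_group_add \<Rightarrow> 'v"
    and n :: nat
    and I :: "'i set"
    and a :: "'i \<Rightarrow> rat"
    and u :: "'i \<Rightarrow> 'v list"
    and h1 h2 :: "'v \<Rightarrow> 'f"
  assumes "vector_space scale"
    and "n \<ge> 1"
    and "vector_space.dim scale UNIV = n"
    and "finite I"
    and "\<And>i. i \<in> I \<Longrightarrow> correlator_space.affine_basis scale (u i)"
    and "quot_lincomb (correlator_space.decomposables scale) I a
           (\<lambda>i. correlator_space.C_class scale (u i))
         = coset (correlator_space.decomposables scale) 0"
    and "correlator_space.nonzero_functional scale h1"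
    and "correlator_space.nonzero_functional scale h2"
  shows "quot_lincomb (correlator_space.G_boundaries scale) I a
           (\<lambda>i. correlator_space.Cor scale (map h1 (u i)))
         = quot_lincomb (correlator_space.G_boundaries scale) I a
           (\<lambda>i. correlator_space.Cor scale (map h2 (u i)))"
proof -
  interpret correlator_space scale using assms(1) by (simp add: correlator_space_def)
  interpret fd_correlator_space scale n by unfold_locales (use assms(2,3) in simp_all)
  show ?thesis by (rule quot_lincomb_Cor_eq[OF assms(5-8)])
qed

end
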